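(* Consider the problem $$-u''=\lambda u+\mathbf{1}_{[0,\pi/4]}(t)\,u^3\ \text{ in }(0,\pi),\qquad u(0)=u(\pi),\quad u'(0)=u'(\pi),\tag{$*$}$$ and let $k\in\mathbb{N}$ be odd. Then exactly four branches of nontrivial periodic solutions of $( * )$ with $2k$ zeros in $[0,\pi)$ emanate locally from $(4k^2,0)\in\mathbb{R}\times H^2(\mathbb{T})$ for $\lambda<4k^2$, while the unique solutions in a neighborhood of $(4k^2,0)$ in $\mathbb{R}\times H^2(\mathbb{T})$ for $\lambda>4k^2$, $\lambda\sim4k^2$, are the trivial ones. Moreover, these nontrivial branches are locally given by $$(\lambda,u_{i,k}(\lambda))=\Psi_k\big(\lambda,\sqrt{4k^2-\lambda}\,z_{i,k}(\lambda),\sqrt{4k^2-\lambda}\,w_{i,k}(\lambda)\big),\quad\lambda<4k^2,\ \lambda\sim4k^2,\ i\in\{1,2,3,4\},$$ where $(z_{i,k}(\lambda),w_{i,k}(\lambda))$ are $\mathcal{C}^1$ functions defined in a left neighborhood of $4k^2$ (including $4k^2$) satisfying $$(z_{1,k}(4k^2),w_{1,k}(4k^2))=\Big(\tfrac{2\sqrt k\,\pi}{\sqrt{3k\pi+8}},\tfrac{2\sqrt k\,\pi}{\sqrt{3k\pi+8}}\Big),\quad(z_{2,k}(4k^2),w_{2,k}(4k^2))=\Big(\tfrac{-2\sqrt k\,\pi}{\sqrt{3k\pi+8}},\tfrac{-2\sqrt k\,\pi}{\sqrt{3k\pi+8}}\Big),$$ $$(z_{3,k}(4k^2),w_{3,k}(4k^2))=\Big(\tfrac{2\sqrt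 k\,\pi}{\sqrt{3k\pi-8}},\tfrac{-2\sqrt k\,\pi}{\sqrt{3k\pi-8}}\Big),\quad(z_{4,k}(4k^2),w_{4,k}(4k^2))=\Big(\tfrac{-2\sqrt k\,\pi}{\sqrt{3k\pi-8}},\tfrac{2\sqrt k\,\pi}{\sqrt{3k\pi-8}}\Big).$$
   Context: $T=\pi$, $a=\mathbf{1}_{[0,\pi/4]}$ is the indicator function of $[0,\pi/4]$, $\mathbb{T}=\mathbb{R}/(\pi\mathbb{Z})$. $H^s(\mathbb{T})$ is the space of real $u\in H^s([0,\pi])$ with $D^\alpha u(0)=D^\alpha u(\pi)$ for integers $0\le\alpha<s$, with inner product $(u,v)_{H^s}=\sum_{0\le\alpha\le s}\int_0^\pi D^\alpha u\,D^\alpha v\,dt$; $L^2(\mathbb{T})=H^0(\mathbb{T})$. Solutions are $u\in H^2(\mathbb{T})$ satisfying the equation a.e. $\mathfrak{F}(\lambda,u)=u''+\lambda u+a(t)u^3$, $\sigma_k=4k^2$. "$\lambda\sim 4k^2$" means $\lambda$ sufficiently close to $4k^2$. Lyapunov–Schmidt setup. $\varphi_k(t)=\sqrt{2/\pi}\cos(2kt)$, $\phi_k(t)=\sqrt{2/\pi}\sin(2kt)$, $N=\mathrm{span}\{\varphi_k,\phi_k\}$ (the kernel of $v\mapsto v''+\sigma_kv$ on $H^2(\mathbb{T})$), $N^\perp$ its orthogonal complement in $H^2(\mathbb{T})$, $Q_k[v]=(v,\varphi_k)_{L^2}\varphi_k+(v,\phi_k)_{L^2}\phi_k$. By the implicit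 function theorem one fixes (small enough) open neighborhoods $I_k\subset\mathbb{R}$ of $\sigma_k$, $\mathcal{N}_k\subset N$ of $0$, $\mathcal{O}_k\subset\mathbb{R}\times H^2(\mathbb{T})$ of $(\sigma_k,0)$, and a $\mathcal{C}^\infty$ map $\psi:I_k\times\mathcal{N}_k\to N^\perp$ with $\psi(\sigma_k,0)=0$, such that for $x\in N$, $y\in N^\perp$: $(\lambda,x+y)\in\mathcal{O}_k$ and $(I-Q_k)\mathfrak{F}(\lambda,x+y)=0$ if and only if $(\lambda,x)\in I_k\times\mathcal{N}_k$ and $y=\psi(\lambda,x)$. With $L(x_1,x_2)=x_1\varphi_k+x_2\phi_k$, $\Omega_k=L^{-1}(\mathcal{N}_k)$ and $\mathfrak{H}:I_k\times\Omega_k\to\mathbb{R}^2$ whose components are the $L^2$ inner products of $Q_k\mathfrak{F}(\lambda,L(x_1,x_2)+\psi(\lambda,L(x_1,x_2)))$ with $\varphi_k$ and $\phi_k$, the map $\Psi_k:\mathfrak{H}^{-1}(0)\to\mathfrak{F}^{-1}(0)\cap\mathcal{O}_k$ is the homeomorphism $\Psi_k(\lambda,x_1,x_2)=(\lambda,L(x_1,x_2)+\psi(\lambda,L(x_1,x_2)))$. *)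

theory Defs
  imports "HOL-Analysis.Analysis"
begin

section \<open>The Sobolev space of twice weakly differentiable periodic functions\<close>

text \<open>
  Elements of \<open>L\<^sup>2([0,\<pi>])\<close> are handled through representatives: two functions stand for the
  same element iff they agree almost everywhere on \<open>[0,\<pi>]\<close>.
\<close>

abbreviation dom_measure :: "real measure" where
  "dom_measure \<equiv> lebesgue_on {0..pi}"

definition L2 :: "(real \<Rightarrow> real) set" where
  "L2 = {f. f \<in> borel_measurable dom_measure \<and> integrable dom_measure (\<lambda>t. (f t)\<^sup>2)}"

definition l2_inner :: "(real \<Rightarrow> real) \<Rightarrow> (real \<Rightarrow> real) \<Rightarrow> real" where
  "l2_inner f g = (LINT t|dom_measure. f t * g t)"

text \<open>
  \<open>H2_derivs u d\<close>: on \<open>[0,\<pi>]\<close> the function \<open>u\<close> is (the continuous representative of) an element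
  of \<open>H\<^sup>2\<close>, and \<open>d \<alpha>\<close> is its weak derivative of order \<open>\<alpha> \<le> 2\<close>. In dimension one, \<open>g \<in> L\<^sup>2\<close> is the
  weak derivative of \<open>f\<close> iff the continuous representative of \<open>f\<close> is a primitive of \<open>g\<close>. In
  particular \<open>d 0\<close> and \<open>d 1\<close> are continuous on \<open>[0,\<pi>]\<close> and have boundary values, whereas \<open>d 2\<close> is
  determined only almost everywhere.
\<close>

definition H2_derivs :: "(real \<Rightarrow> real) \<Rightarrow> (nat \<Rightarrow> real \<Rightarrow> real) \<Rightarrow> bool" where
  "H2_derivs u d \<longleftrightarrow> d 0 = u \<and>
     (\<forall>\<alpha><2. d (Suc \<alpha>) \<in> L2 \<and>
        (\<forall>t\<in>{0..pi}. d \<alpha> t = d \<alpha> 0 + integral {0..t} (d (Suc \<alpha>))))"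

text \<open>
  The condition \<open>u (t + \<pi>) = u t\<close> contains \<open>u(0) = u(\<pi>)\<close>, and it fixes the values outside
  \<open>[0,\<pi>]\<close>, so that an element of \<open>H\<^sup>2\<close> on the circle is a unique function on the real line.
\<close>

definition H2_periodic :: "(real \<Rightarrow> real) set" where
  "H2_periodic = {u. (\<forall>t. u (t + pi) = u t) \<and>
                     (\<exists>d. H2_derivs u d \<and> (\<forall>\<alpha><2. d \<alpha> 0 = d \<alpha> pi))}"


subsection \<open>Auxiliary facts\<close>

lemma dom_measure_simps [simp]: "{0..pi} \<in> sets lebesgue" "{0..pi} \<in> lmeasurable"
  by (simp_all only: lmeasurable_interval fmeasurableD)

lemma L2_integrable: "f \<in> L2 \<Longrightarrow> integrable dom_measure f"
  unfolding L2_def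
  by (rule finite_measure.square_integrable_imp_integrable)
    (simp_all add: finite_measure_lebesgue_on)

lemma L2_integrable_on: "f \<in> L2 \<Longrightarrow> f integrable_on {0..pi}"
  by (intro integrable_on_lebesgue_on L2_integrable) simp_all

lemma L2_integrable_on_sub: "f \<in> L2 \<Longrightarrow> t \<in> {0..pi} \<Longrightarrow> f integrable_on {0..t}"
  using L2_integrable_on integrable_on_subinterval[of f "{0..pi}" 0 t] by auto

lemma L2_mult_integrable:
  assumes "f \<in> L2" "g \<in> L2"
  shows "integrable dom_measure (\<lambda>t. f t * g t)"
proof (rule Bochner_Integration.integrable_bound)
  show "integrable dom_measure (\<lambda>t. (f t)\<^sup>2 + (g t)\<^sup>2)"
    using assms by (auto simp: L2_def)
  show "(\<lambda>t. f t * g t) \<in> borel_measurable dom_measure"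
    using assms by (auto simp: L2_def)
  have "\<bar>a * b\<bar> \<le> a\<^sup>2 + b\<^sup>2" for a b :: real
  proof -
    have "2 * (\<bar>a\<bar> * \<bar>b\<bar>) \<le> a\<^sup>2 + b\<^sup>2"
      using sum_squares_bound[of "\<bar>a\<bar>" "\<bar>b\<bar>"] by simp
    moreover have "0 \<le> \<bar>a\<bar> * \<bar>b\<bar>" by simp
    ultimately show ?thesis unfolding abs_mult by linarith
  qed
  then show "AE t in dom_measure. norm (f t * g t) \<le> norm ((f t)\<^sup>2 + (g t)\<^sup>2)"
    by (auto intro!: AE_I2)
qed

lemma L2_add:
  assumes "f \<in> L2" "g \<in> L2"
  shows "(\<lambda>t. f t + g t) \<in> L2"
proof -
  have "integrable dom_measure (\<lambda>t. (f t)\<^sup>2 + (g t)\<^sup>2 + 2 * (f t * g t))"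
    using assms L2_mult_integrable[OF assms] by (auto simp: L2_def)
  moreover have "(\<lambda>t. (f t + g t)\<^sup>2) = (\<lambda>t. (f t)\<^sup>2 + (g t)\<^sup>2 + 2 * (f t * g t))"
    by (auto simp: power2_sum)
  ultimately show ?thesis
    using assms by (auto simp: L2_def)
qed

lemma L2_scale: "f \<in> L2 \<Longrightarrow> (\<lambda>t. c * f t) \<in> L2"
  by (auto simp: L2_def power_mult_distrib)

lemma L2_cong_AE:
  assumes "f \<in> L2" "g \<in> borel_measurable dom_measure" "AE t in dom_measure. f t = g t"
  shows "g \<in> L2"
proof -
  have "integrable dom_measure (\<lambda>t. (g t)\<^sup>2)"
    by (rule integrable_cong_AE_imp[where g = "\<lambda>t. (f t)\<^sup>2"])
      (use assms in \<open>auto simp: L2_def elim!: eventually_mono\<close>)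
  then show ?thesis using assms by (auto simp: L2_def)
qed

lemma continuous_on_imp_L2:
  assumes "continuous_on {0..pi} f"
  shows "f \<in> L2"
  unfolding L2_def
proof (intro CollectI conjI)
  show "f \<in> borel_measurable dom_measure"
    by (intro continuous_imp_measurable_on_sets_lebesgue assms) auto
  show "integrable dom_measure (\<lambda>t. (f t)\<^sup>2)"
    by (intro continuous_imp_integrable_real continuous_intros assms)
qed

lemma primitive_continuous:
  assumes "g \<in> L2" "\<And>t. t \<in> {0..pi} \<Longrightarrow> f t = f 0 + integral {0..t} g"
  shows "continuous_on {0..pi} f"
proof -
  have "continuous_on {0..pi} (\<lambda>t. f 0 + integral {0..t} g)"
    by (intro continuous_intros indefinite_integral_continuous_1 L2_integrable_on assms)
  then show ?thesis
    by (subst continuous_on_cong[OF refl assms(2)])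
qed

lemma zero_primitive_imp_AE_zero:
  assumes g: "g \<in> L2" and z: "\<And>t. t \<in> {0..pi} \<Longrightarrow> integral {0..t} g = 0"
  shows "AE t in dom_measure. g t = 0"
proof -
  define G where "G = (\<lambda>t. if t \<in> {0..pi} then g t else 0)"
  have sub: "integral {a..b} g = 0" if "0 \<le> a" "a \<le> b" "b \<le> pi" for a b
  proof -
    have "integral {0..a} g + integral {a..b} g = integral {0..b} g"
      using that L2_integrable_on_sub[OF g, of b]
      by (intro Henstock_Kurzweil_Integration.integral_combine) auto
    then show ?thesis using z[of a] z[of b] that by auto
  qed
  have int: "G integrable_on cbox a b" for a b
  proof -
    have "G integrable_on UNIV"
      unfolding G_def using L2_integrable_on[OF g] by (subst integrable_restrict_UNIV)
    then show ?thesis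
      by (rule integrable_on_subcbox) auto
  qed
  obtain N where N: "negligible N"
    "\<And>x e. \<lbrakk>x \<notin> N; 0 < e\<rbrakk> \<Longrightarrow> \<exists>d>0. \<forall>h. 0 < h \<and> h < d \<longrightarrow>
        norm (integral (cbox x (x + h *\<^sub>R One)) G /\<^sub>R h ^ DIM(real) - G x) < e"
    using integrable_ccontinuous_explicit[OF int] by blast
  have zero: "g x = 0" if x: "x \<notin> insert pi N" "x \<in> {0..pi}" for x
  proof (rule ccontr)
    assume nz: "g x \<noteq> 0"
    then obtain d where d: "d > 0" "\<And>h. 0 < h \<Longrightarrow> h < d \<Longrightarrow>
        norm (integral (cbox x (x + h *\<^sub>R One)) G /\<^sub>R h ^ DIM(real) - G x) < \<bar>g x\<bar>"
      using N(2)[of x "\<bar>g x\<bar>"] x by auto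
    define h where "h = min (d / 2) (pi - x)"
    have h: "0 < h" "h < d" "x + h \<le> pi"
      using d(1) x by (auto simp: h_def min_def)
    have "integral {x..x + h} G = integral {x..x + h} g"
      by (rule Henstock_Kurzweil_Integration.integral_cong) (use x h in \<open>auto simp: G_def\<close>)
    also have "\<dots> = 0"
      using sub[of x "x + h"] x h by auto
    finally have "integral (cbox x (x + h *\<^sub>R One)) G = 0" by simp
    then show False
      using d(2)[OF h(1,2)] x by (simp add: G_def)
  qed
  have "AE x in lebesgue. x \<notin> insert pi N"
    using N(1) by (intro AE_not_in) (simp add: negligible_iff_null_sets[symmetric])
  then have "AE x in lebesgue. x \<in> {0..pi} \<longrightarrow> g x = 0"
    by (rule eventually_mono) (use zero in blast)
  then show ?thesis
    by (subst AE_restrict_space_iff) auto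
qed

lemma H2_derivsD:
  assumes "H2_derivs u d"
  shows "d 0 = u" "d 1 \<in> L2" "d 2 \<in> L2" "continuous_on {0..pi} u" "continuous_on {0..pi} (d 1)"
    "u \<in> L2"
    "\<And>t. t \<in> {0..pi} \<Longrightarrow> u t = u 0 + integral {0..t} (d 1)"
    "\<And>t. t \<in> {0..pi} \<Longrightarrow> d 1 t = d 1 0 + integral {0..t} (d 2)"
proof -
  have step: "d (Suc \<alpha>) \<in> L2"
    "\<And>t. t \<in> {0..pi} \<Longrightarrow> d \<alpha> t = d \<alpha> 0 + integral {0..t} (d (Suc \<alpha>))" if "\<alpha> < 2" for \<alpha>
    using assms that unfolding H2_derivs_def by blast+
  show 0: "d 0 = u"
    using assms unfolding H2_derivs_def by blast
  show *: "d 1 \<in> L2" "d 2 \<in> L2"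
    "\<And>t. t \<in> {0..pi} \<Longrightarrow> u t = u 0 + integral {0..t} (d 1)"
    "\<And>t. t \<in> {0..pi} \<Longrightarrow> d 1 t = d 1 0 + integral {0..t} (d 2)"
    using step[of 0] step[of 1] unfolding 0 One_nat_def Suc_1[symmetric] by blast+
  show "continuous_on {0..pi} u" "continuous_on {0..pi} (d 1)"
    using primitive_continuous * by blast+
  then show "u \<in> L2" by (intro continuous_on_imp_L2)
qed

lemma H2_derivsI:
  assumes "d 0 = u" "d 1 \<in> L2" "d 2 \<in> L2"
    "\<And>t. t \<in> {0..pi} \<Longrightarrow> u t = u 0 + integral {0..t} (d 1)"
    "\<And>t. t \<in> {0..pi} \<Longrightarrow> d 1 t = d 1 0 + integral {0..t} (d 2)"
  shows "H2_derivs u d"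
  unfolding H2_derivs_def
proof (intro conjI allI impI ballI)
  fix \<alpha> :: nat assume "\<alpha> < 2"
  then consider "\<alpha> = 0" | "\<alpha> = 1" by linarith
  note cases = this
  show "d (Suc \<alpha>) \<in> L2"
    by (cases rule: cases) (use assms(2,3) in \<open>simp_all add: numeral_2_eq_2\<close>)
  show "d \<alpha> t = d \<alpha> 0 + integral {0..t} (d (Suc \<alpha>))" if "t \<in> {0..pi}" for t
    using assms(4,5)[OF that]
    by (cases rule: cases) (simp_all only: assms(1) One_nat_def Suc_1[symmetric])
qed (rule assms(1))

lemma H2_derivs_lincomb:
  assumes "H2_derivs u d" "H2_derivs v e"
  shows "H2_derivs (\<lambda>t. a * u t + b * v t) (\<lambda>\<alpha> t. a * d \<alpha> t + b * e \<alpha> t)"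
proof -
  note D = H2_derivsD[OF assms(1)] and E = H2_derivsD[OF assms(2)]
  have int: "integral {0..t} (\<lambda>s. a * f s + b * g s)
      = a * integral {0..t} f + b * integral {0..t} g"
    if "f \<in> L2" "g \<in> L2" "t \<in> {0..pi}" for f g t
  proof -
    have f: "f integrable_on {0..t}" and g: "g integrable_on {0..t}"
      using that L2_integrable_on_sub by blast+
    have "((\<lambda>s. a * f s + b * g s) has_integral
        (a * integral {0..t} f + b * integral {0..t} g)) {0..t}"
      by (intro has_integral_add has_integral_mult_right integrable_integral f g)
    then show ?thesis by (rule integral_unique)
  qed
  show ?thesis
  proof (rule H2_derivsI)
    fix t :: real assume t: "t \<in> {0..pi}"
    show "a * u t + b * v t = a * u 0 + b * v 0 + integral {0..t} (\<lambda>t. a * d 1 t + b * e 1 t)"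
      by (subst int[OF D(2) E(2) t], subst D(7)[OF t], subst E(7)[OF t])
        (simp add: algebra_simps)
    show "a * d 1 t + b * e 1 t
        = a * d 1 0 + b * e 1 0 + integral {0..t} (\<lambda>t. a * d 2 t + b * e 2 t)"
      by (subst int[OF D(3) E(3) t], subst D(8)[OF t], subst E(8)[OF t])
        (simp add: algebra_simps)
  qed (use D E in \<open>auto intro!: L2_add L2_scale\<close>)
qed

lemma H2_derivs_zero:
  assumes "H2_derivs u d" and z: "\<And>t. t \<in> {0..pi} \<Longrightarrow> u t = 0"
  shows "t \<in> {0..pi} \<Longrightarrow> d 1 t = 0" "AE t in dom_measure. d 2 t = 0"
proof -
  note D = H2_derivsD[OF assms(1)]
  have 1: "d 1 t = 0" if t: "t \<in> {0..pi}" for t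
  proof -
    have "((\<lambda>s. integral {0..s} (d 1)) has_vector_derivative d 1 t) (at t within {0..pi})"
      by (rule integral_has_vector_derivative[OF D(5) t])
    moreover have "integral {0..s} (d 1) = 0" if "s \<in> {0..pi}" for s
      using D(7)[OF that] z[OF that] z[of 0] by simp
    ultimately have "((\<lambda>s. 0) has_vector_derivative d 1 t) (at t within {0..pi})"
      using has_vector_derivative_transform[OF t, of "\<lambda>s. 0" "\<lambda>s. integral {0..s} (d 1)"] by simp
    moreover have "((\<lambda>s. 0) has_vector_derivative (0::real)) (at t within {0..pi})"
      by simp
    ultimately show ?thesis
      using vector_derivative_unique_within_closed_interval[of 0 pi t "\<lambda>s. 0" "d 1 t" 0] t
      by simp
  qed
  show "t \<in> {0..pi} \<Longrightarrow> d 1 t = 0" by (rule 1)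
  show "AE t in dom_measure. d 2 t = 0"
  proof (rule zero_primitive_imp_AE_zero[OF D(3)])
    show "integral {0..t} (d 2) = 0" if "t \<in> {0..pi}" for t
      using D(8)[OF that] 1[OF that] 1[of 0] by auto
  qed
qed

lemma H2_derivs_unique:
  assumes "H2_derivs u d" "H2_derivs u e"
  shows "t \<in> {0..pi} \<Longrightarrow> d 1 t = e 1 t" "AE t in dom_measure. d 2 t = e 2 t"
  using H2_derivs_zero[OF H2_derivs_lincomb[OF assms, of 1 "-1"]] by auto

lemma H2_periodic_lincomb:
  assumes "u \<in> H2_periodic" "v \<in> H2_periodic"
  shows "(\<lambda>t. a * u t + b * v t) \<in> H2_periodic"
proof -
  from assms obtain d e where
    "H2_derivs u d" "\<forall>\<alpha><2. d \<alpha> 0 = d \<alpha> pi" "H2_derivs v e" "\<forall>\<alpha><2. e \<alpha> 0 = e \<alpha> pi"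
    by (auto simp: H2_periodic_def)
  then show ?thesis
    using assms H2_derivs_lincomb[of u d v e a b] unfolding H2_periodic_def
    by (auto intro!: exI[of _ "\<lambda>\<alpha> t. a * d \<alpha> t + b * e \<alpha> t"])
qed

lemma C2_imp_H2_periodic:
  assumes "\<And>t. u (t + pi) = u t" "v 0 = v pi"
    "\<And>t. (u has_real_derivative v t) (at t)" "\<And>t. (v has_real_derivative w t) (at t)"
    "continuous_on UNIV w"
  shows "u \<in> H2_periodic" "H2_derivs u (\<lambda>\<alpha>. if \<alpha> = 0 then u else if \<alpha> = 1 then v else w)"
proof -
  let ?d = "\<lambda>\<alpha>::nat. if \<alpha> = 0 then u else if \<alpha> = 1 then v else w"
  have FTC: "f t = f 0 + integral {0..t} g"
    if "\<And>t. (f has_real_derivative g t) (at t)" "t \<in> {0..pi}" for f g :: "real \<Rightarrow> real" and t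
  proof -
    have "(g has_integral (f t - f 0)) {0..t}"
      by (rule fundamental_theorem_of_calculus)
        (use that in \<open>auto simp: has_real_derivative_iff_has_vector_derivative[symmetric]
                        intro: has_field_derivative_at_within\<close>)
    then show ?thesis by (simp add: integral_unique)
  qed
  have cont: "v \<in> L2" "w \<in> L2"
    by (intro continuous_on_imp_L2 DERIV_continuous_on[where D = w]
        has_field_derivative_at_within[OF assms(4)])
      (intro continuous_on_imp_L2 continuous_on_subset[OF assms(5)] subset_UNIV)
  show d: "H2_derivs u ?d"
  proof (rule H2_derivsI)
    fix t :: real assume t: "t \<in> {0..pi}"
    show "u t = u 0 + integral {0..t} (?d 1)"
      using FTC[OF assms(3) t] by simp
    show "?d 1 t = ?d 1 0 + integral {0..t} (?d 2)"
      using FTC[OF assms(4) t] by simp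
  qed (use cont in simp_all)
  have "u 0 = u pi" using assms(1)[of 0] by simp
  with d show "u \<in> H2_periodic"
    unfolding H2_periodic_def using assms(1,2) by (auto intro!: exI[of _ ?d])
qed

lemma zero_in_H2_periodic: "(\<lambda>t. 0) \<in> H2_periodic"
  by (rule C2_imp_H2_periodic(1)[where v = "\<lambda>t. 0" and w = "\<lambda>t. 0"]) auto


subsection \<open>The inner product space\<close>

typedef h2 = H2_periodic
  morphisms h2_fun Abs_h2
  using zero_in_H2_periodic by blast

definition h2_D :: "nat \<Rightarrow> h2 \<Rightarrow> real \<Rightarrow> real" where
  "h2_D \<alpha> u = (SOME d. H2_derivs (h2_fun u) d) \<alpha>"

lemma h2_fun_periodic: "h2_fun u (t + pi) = h2_fun u t"
  using h2_fun[of u] by (simp add: H2_periodic_def)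

lemma h2_derivs: "H2_derivs (h2_fun u) (\<lambda>\<alpha>. h2_D \<alpha> u)"
proof -
  have "\<exists>d. H2_derivs (h2_fun u) d"
    using h2_fun[of u] by (auto simp: H2_periodic_def)
  then show ?thesis
    unfolding h2_D_def by (rule someI_ex)
qed

lemma h2_D_0 [simp]: "h2_D 0 u = h2_fun u"
  using H2_derivsD(1)[OF h2_derivs] .

lemma h2_D_L2: "\<alpha> \<le> 2 \<Longrightarrow> h2_D \<alpha> u \<in> L2"
  using H2_derivsD(2,3,6)[OF h2_derivs[of u]]
  by (cases "\<alpha> = 0"; cases "\<alpha> = 1"; cases "\<alpha> = 2") (auto simp: numeral_2_eq_2)

lemma h2_D_boundary: "h2_D 1 u 0 = h2_D 1 u pi"
proof -
  obtain d where d: "H2_derivs (h2_fun u) d" "\<forall>\<alpha><2. d \<alpha> 0 = d \<alpha> pi"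
    using h2_fun[of u] by (auto simp: H2_periodic_def)
  show ?thesis
    using H2_derivs_unique(1)[OF h2_derivs[of u] d(1), of 0]
      H2_derivs_unique(1)[OF h2_derivs[of u] d(1), of pi] d(2) by auto
qed

lemma h2_D_AE_eq:
  assumes "H2_derivs (h2_fun u) d" "\<alpha> \<le> 2"
  shows "AE t in dom_measure. h2_D \<alpha> u t = d \<alpha> t"
proof -
  consider "\<alpha> = 0" | "\<alpha> = 1" | "\<alpha> = 2" using assms(2) by linarith
  then show ?thesis
  proof cases
    case 1
    then show ?thesis using H2_derivsD(1)[OF assms(1)] by simp
  next
    case 2
    then show ?thesis
      using H2_derivs_unique(1)[OF h2_derivs assms(1)] by (auto intro!: AE_I2)
  next
    case 3
    then show ?thesis using H2_derivs_unique(2)[OF h2_derivs assms(1)] by simp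
  qed
qed

instantiation h2 :: real_inner
begin

definition "0 = Abs_h2 (\<lambda>t. 0)"
definition "u + v = Abs_h2 (\<lambda>t. h2_fun u t + h2_fun v t)"
definition "- u = Abs_h2 (\<lambda>t. - h2_fun u t)"
definition "u - v = Abs_h2 (\<lambda>t. h2_fun u t - h2_fun v t)"
definition "c *\<^sub>R u = Abs_h2 (\<lambda>t. c * h2_fun u t)"
definition inner_h2_def:
  "inner u v = (\<Sum>\<alpha>\<le>2. LINT t|dom_measure. h2_D \<alpha> u t * h2_D \<alpha> v t)"
definition norm_h2_def: "norm (u::h2) = sqrt (inner u u)"
definition sgn_h2_def: "sgn (u::h2) = inverse (norm u) *\<^sub>R u"
definition dist_h2_def: "dist (u::h2) v = norm (u - v)"
definition uniformity_h2_def: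
  "(uniformity :: (h2 \<times> h2) filter) = (INF e\<in>{0<..}. principal {(x, y). dist x y < e})"
definition open_h2_def:
  "open (U :: h2 set) \<longleftrightarrow> (\<forall>x\<in>U. \<forall>\<^sub>F (x', y) in uniformity. x' = x \<longrightarrow> y \<in> U)"

lemma h2_fun_zero: "h2_fun 0 = (\<lambda>t. 0)"
  unfolding zero_h2_def by (rule Abs_h2_inverse[OF zero_in_H2_periodic])

lemma h2_fun_add: "h2_fun (u + v) = (\<lambda>t. h2_fun u t + h2_fun v t)"
  unfolding plus_h2_def
  using H2_periodic_lincomb[OF h2_fun h2_fun, of 1 u 1 v] by (simp add: Abs_h2_inverse)

lemma h2_fun_uminus: "h2_fun (- u) = (\<lambda>t. - h2_fun u t)"
  unfolding uminus_h2_def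
  using H2_periodic_lincomb[OF h2_fun h2_fun, of "-1" u 0 u] by (simp add: Abs_h2_inverse)

lemma h2_fun_diff: "h2_fun (u - v) = (\<lambda>t. h2_fun u t - h2_fun v t)"
  unfolding minus_h2_def
  using H2_periodic_lincomb[OF h2_fun h2_fun, of 1 u "-1" v] by (simp add: Abs_h2_inverse)

lemma h2_fun_scaleR: "h2_fun (c *\<^sub>R u) = (\<lambda>t. c * h2_fun u t)"
  unfolding scaleR_h2_def
  using H2_periodic_lincomb[OF h2_fun h2_fun, of c u 0 u] by (simp add: Abs_h2_inverse)

lemmas h2_fun_simps = h2_fun_zero h2_fun_add h2_fun_uminus h2_fun_diff h2_fun_scaleR

lemma h2_D_add:
  assumes "\<alpha> \<le> 2"
  shows "AE t in dom_measure. h2_D \<alpha> (u + v) t = h2_D \<alpha> u t + h2_D \<alpha> v t"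
proof -
  have "H2_derivs (h2_fun (u + v)) (\<lambda>\<alpha> t. h2_D \<alpha> u t + h2_D \<alpha> v t)"
    using H2_derivs_lincomb[OF h2_derivs[of u] h2_derivs[of v], of 1 1]
    by (simp add: h2_fun_add)
  from h2_D_AE_eq[OF this assms] show ?thesis .
qed

lemma h2_D_scaleR:
  assumes "\<alpha> \<le> 2"
  shows "AE t in dom_measure. h2_D \<alpha> (c *\<^sub>R u) t = c * h2_D \<alpha> u t"
proof -
  have "H2_derivs (h2_fun (c *\<^sub>R u)) (\<lambda>\<alpha> t. c * h2_D \<alpha> u t)"
    using H2_derivs_lincomb[OF h2_derivs[of u] h2_derivs[of u], of c 0]
    by (simp add: h2_fun_scaleR)
  from h2_D_AE_eq[OF this assms] show ?thesis .
qed

lemma h2_D_mult_integrable: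
  "\<alpha> \<le> 2 \<Longrightarrow> integrable dom_measure (\<lambda>t. h2_D \<alpha> u t * h2_D \<alpha> v t)"
  by (intro L2_mult_integrable h2_D_L2)

lemma h2_D_measurable: "\<alpha> \<le> 2 \<Longrightarrow> h2_D \<alpha> u \<in> borel_measurable dom_measure"
  using h2_D_L2 by (auto simp: L2_def)

instance
proof
  fix u v w :: h2 and a b r :: real
  show "u + v + w = u + (v + w)" "u + v = v + u" "0 + u = u" "- u + u = 0" "u - v = u + - v"
    "a *\<^sub>R (u + v) = a *\<^sub>R u + a *\<^sub>R v" "(a + b) *\<^sub>R u = a *\<^sub>R u + b *\<^sub>R u"
    "a *\<^sub>R b *\<^sub>R u = (a * b) *\<^sub>R u" "1 *\<^sub>R u = u"
    by (simp_all add: h2_fun_inject[symmetric] h2_fun_simps algebra_simps)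
  show "sgn u = inverse (norm u) *\<^sub>R u" by (rule sgn_h2_def)
  show "dist u v = norm (u - v)" by (rule dist_h2_def)
  show "norm u = sqrt (inner u u)" by (rule norm_h2_def)
  show "(uniformity :: (h2 \<times> h2) filter) = (INF e\<in>{0<..}. principal {(x, y). dist x y < e})"
    by (rule uniformity_h2_def)
  show "open U \<longleftrightarrow> (\<forall>x\<in>U. \<forall>\<^sub>F (x', y) in uniformity. x' = x \<longrightarrow> y \<in> U)" for U :: "h2 set"
    by (rule open_h2_def)
  show "inner u v = inner v u"
    unfolding inner_h2_def by (simp add: mult.commute)
  show "inner (u + v) w = inner u w + inner v w"
    unfolding inner_h2_def sum.distrib[symmetric]
  proof (rule sum.cong[OF refl])
    fix \<alpha> :: nat assume "\<alpha> \<in> {..2}"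
    then have \<alpha>: "\<alpha> \<le> 2" by simp
    have "(LINT t|dom_measure. h2_D \<alpha> (u + v) t * h2_D \<alpha> w t)
        = (LINT t|dom_measure. h2_D \<alpha> u t * h2_D \<alpha> w t + h2_D \<alpha> v t * h2_D \<alpha> w t)"
      by (rule integral_cong_AE)
        (use h2_D_add[OF \<alpha>, of u v] h2_D_measurable[OF \<alpha>] in
          \<open>auto simp: distrib_right elim!: eventually_mono\<close>)
    then show "(LINT t|dom_measure. h2_D \<alpha> (u + v) t * h2_D \<alpha> w t)
        = (LINT t|dom_measure. h2_D \<alpha> u t * h2_D \<alpha> w t)
          + (LINT t|dom_measure. h2_D \<alpha> v t * h2_D \<alpha> w t)"
      by (simp add: h2_D_mult_integrable[OF \<alpha>])
  qed
  show "inner (r *\<^sub>R u) v = r * inner u v"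
    unfolding inner_h2_def sum_distrib_left
  proof (rule sum.cong[OF refl])
    fix \<alpha> :: nat assume "\<alpha> \<in> {..2}"
    then have \<alpha>: "\<alpha> \<le> 2" by simp
    have "(LINT t|dom_measure. h2_D \<alpha> (r *\<^sub>R u) t * h2_D \<alpha> v t)
        = (LINT t|dom_measure. r * (h2_D \<alpha> u t * h2_D \<alpha> v t))"
      by (rule integral_cong_AE)
        (use h2_D_scaleR[OF \<alpha>, of r u] h2_D_measurable[OF \<alpha>] in
          \<open>auto elim!: eventually_mono\<close>)
    then show "(LINT t|dom_measure. h2_D \<alpha> (r *\<^sub>R u) t * h2_D \<alpha> v t)
        = r * (LINT t|dom_measure. h2_D \<alpha> u t * h2_D \<alpha> v t)"
      by simp
  qed
  have nonneg: "0 \<le> (LINT t|dom_measure. h2_D \<alpha> u t * h2_D \<alpha> u t)" for \<alpha>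
    by (rule Bochner_Integration.integral_nonneg) simp
  then show "0 \<le> inner u u"
    unfolding inner_h2_def by (intro sum_nonneg) auto
  show "inner u u = 0 \<longleftrightarrow> u = 0"
  proof
    assume "inner u u = 0"
    then have "\<forall>\<alpha>\<in>{..2}. (LINT t|dom_measure. h2_D \<alpha> u t * h2_D \<alpha> u t) = 0"
      unfolding inner_h2_def using nonneg by (subst (asm) sum_nonneg_eq_0_iff) auto
    then have "(LINT t|dom_measure. h2_D 0 u t * h2_D 0 u t) = 0"
      by (rule bspec) simp
    moreover have cont: "continuous_on {0..pi} (h2_fun u)"
      by (rule H2_derivsD(4)[OF h2_derivs])
    then have "continuous_on {0..pi} (\<lambda>t. h2_fun u t * h2_fun u t)"
      by (intro continuous_intros)
    ultimately have z: "h2_fun u t = 0" if "t \<in> {0..pi}" for t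
      using that integral_eq_0_iff[of 0 pi "\<lambda>t. h2_fun u t * h2_fun u t"]
        lebesgue_integral_eq_integral[OF continuous_imp_integrable_real,
          of 0 pi "\<lambda>t. h2_fun u t * h2_fun u t"]
      by auto
    have per: "h2_fun u (t + of_int n * pi) = h2_fun u t" for t n
    proof (induction n arbitrary: t rule: int_induct[where k = 0])
      case base
      show ?case by simp
    next
      case (step1 i)
      show ?case
        using step1(2)[of t] h2_fun_periodic[of u "t + of_int i * pi"]
        by (simp add: algebra_simps)
    next
      case (step2 i)
      show ?case
        using step2(2)[of t] h2_fun_periodic[of u "t + of_int (i - 1) * pi"]
        by (simp add: algebra_simps)
    qed
    have "h2_fun u t = 0" for t
    proof -
      define n where "n = \<lfloor>t / pi\<rfloor>"
      have "of_int n \<le> t / pi" "t / pi < of_int n + 1"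
        unfolding n_def by linarith+
      then have "of_int n * pi \<le> t" "t \<le> (of_int n + 1) * pi"
        using pi_gt_zero by (auto simp: field_simps)
      then have "h2_fun u (t - of_int n * pi) = 0"
        by (intro z) (auto simp: algebra_simps)
      then show ?thesis using per[of "t - of_int n * pi" n] by simp
    qed
    then show "u = 0"
      by (simp add: h2_fun_inject[symmetric] h2_fun_zero fun_eq_iff)
  next
    assume "u = 0"
    then have "u = 0 *\<^sub>R u"
      by (simp add: h2_fun_inject[symmetric] h2_fun_simps)
    moreover have "inner (0 *\<^sub>R u) u = 0"
    proof -
      have "(LINT t|dom_measure. h2_D \<alpha> (0 *\<^sub>R u) t * h2_D \<alpha> u t) = 0" if "\<alpha> \<le> 2" for \<alpha>
        by (rule integral_eq_zero_AE)
          (use h2_D_scaleR[OF that, of 0 u] in \<open>auto elim!: eventually_mono\<close>)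
      then show ?thesis unfolding inner_h2_def by simp
    qed
    ultimately show "inner u u = 0" by simp
  qed
qed

end


section \<open>The problem\<close>

definition weight :: "real \<Rightarrow> real" where
  "weight = indicat_real {0..pi/4}"

definition is_solution :: "real \<Rightarrow> h2 \<Rightarrow> bool" where
  "is_solution lam u \<longleftrightarrow>
     (AE t in dom_measure. - h2_D 2 u t = lam * h2_fun u t + weight t * (h2_fun u t) ^ 3)"

definition FF :: "real \<Rightarrow> h2 \<Rightarrow> real \<Rightarrow> real" where
  "FF lam u = (\<lambda>t. h2_D 2 u t + lam * h2_fun u t + weight t * (h2_fun u t) ^ 3)"

definition sigma :: "nat \<Rightarrow> real" where
  "sigma k = 4 * (real k)\<^sup>2"


section \<open>Lyapunov--Schmidt reduction\<close>

definition phi_cos :: "nat \<Rightarrow> real \<Rightarrow> real" where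
  "phi_cos k t = sqrt (2 / pi) * cos (2 * real k * t)"

definition phi_sin :: "nat \<Rightarrow> real \<Rightarrow> real" where
  "phi_sin k t = sqrt (2 / pi) * sin (2 * real k * t)"

definition LL :: "nat \<Rightarrow> real \<times> real \<Rightarrow> h2" where
  "LL k = (\<lambda>(x1, x2). x1 *\<^sub>R Abs_h2 (phi_cos k) + x2 *\<^sub>R Abs_h2 (phi_sin k))"

definition ker :: "nat \<Rightarrow> h2 set" where
  "ker k = span {Abs_h2 (phi_cos k), Abs_h2 (phi_sin k)}"

definition QQ :: "nat \<Rightarrow> (real \<Rightarrow> real) \<Rightarrow> real \<Rightarrow> real" where
  "QQ k v = (\<lambda>t. l2_inner v (phi_cos k) * phi_cos k t + l2_inner v (phi_sin k) * phi_sin k t)"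

lemma phi_in_H2_periodic: "phi_cos k \<in> H2_periodic" "phi_sin k \<in> H2_periodic"
proof -
  have per: "cos (2 * real k * (t + pi)) = cos (2 * real k * t)"
    "sin (2 * real k * (t + pi)) = sin (2 * real k * t)" for t
  proof -
    have "2 * real k * (t + pi) = 2 * real k * t + 2 * pi * real k"
      by (simp add: algebra_simps)
    then have "\<exists>n. 2 * real k * (t + pi) = 2 * real k * t + 2 * pi * of_int n"
      by (intro exI[of _ "int k"]) simp
    then show "cos (2 * real k * (t + pi)) = cos (2 * real k * t)"
      "sin (2 * real k * (t + pi)) = sin (2 * real k * t)"
      using sin_cos_eq_iff[of "2 * real k * (t + pi)" "2 * real k * t"] by blast+
  qed
  have per0: "cos (2 * real k * pi) = 1" "sin (2 * real k * pi) = 0"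
    using per[of 0] by simp_all
  show "phi_cos k \<in> H2_periodic"
    by (rule C2_imp_H2_periodic(1)[where
          v = "\<lambda>t. - (sqrt (2 / pi) * (2 * real k) * sin (2 * real k * t))" and
          w = "\<lambda>t. - (sqrt (2 / pi) * (2 * real k) * (2 * real k) * cos (2 * real k * t))"])
      (auto simp: phi_cos_def[abs_def] per per0 intro!: derivative_eq_intros continuous_intros)
  show "phi_sin k \<in> H2_periodic"
    by (rule C2_imp_H2_periodic(1)[where
          v = "\<lambda>t. sqrt (2 / pi) * (2 * real k) * cos (2 * real k * t)" and
          w = "\<lambda>t. - (sqrt (2 / pi) * (2 * real k) * (2 * real k) * sin (2 * real k * t))"])
      (auto simp: phi_sin_def[abs_def] per per0 intro!: derivative_eq_intros continuous_intros)
qed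

lemma h2_fun_LL: "h2_fun (LL k (x1, x2)) t = x1 * phi_cos k t + x2 * phi_sin k t"
  by (simp add: LL_def h2_fun_simps Abs_h2_inverse phi_in_H2_periodic)

text \<open>
  For an open subset of a finite-dimensional space, \<open>f\<close> is of class \<open>C\<^sup>n\<^sup>+\<^sup>1\<close> iff it is Frechet
  differentiable and all its directional derivatives are of class \<open>C\<^sup>n\<close>; the codomain may be
  infinite-dimensional.
\<close>

primrec Ck_on :: "nat \<Rightarrow> 'a::euclidean_space set \<Rightarrow> ('a \<Rightarrow> 'b::real_normed_vector) \<Rightarrow> bool" where
  "Ck_on 0 S f \<longleftrightarrow> continuous_on S f"
| "Ck_on (Suc n) S f \<longleftrightarrow>
     (\<forall>x\<in>S. f differentiable (at x)) \<and>
     (\<forall>v. Ck_on n S (\<lambda>x. frechet_derivative f (at x) v))"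

definition smooth_on :: "'a::euclidean_space set \<Rightarrow> ('a \<Rightarrow> 'b::real_normed_vector) \<Rightarrow> bool" where
  "smooth_on S f \<longleftrightarrow> (\<forall>n. Ck_on n S f)"

text \<open>
  The data fixed by the implicit function theorem: neighbourhoods \<open>I\<close> of \<open>\<sigma>\<^sub>k\<close> in the reals, \<open>\<N>\<close> of
  \<open>0\<close> in the kernel, \<open>\<O>\<close> of \<open>(\<sigma>\<^sub>k, 0)\<close>, and the smooth map \<open>\<psi>\<close>. Smoothness of \<open>\<psi>\<close> on \<open>I \<times> \<N>\<close> is
  expressed in the linear coordinates \<open>LL k\<close> of the two-dimensional kernel. Values of \<open>\<psi>\<close> off
  \<open>I \<times> \<N>\<close> are irrelevant.
\<close>

definition LS_data ::
  "nat \<Rightarrow> real set \<Rightarrow> h2 set \<Rightarrow> (real \<times> h2) set \<Rightarrow> (real \<times> h2 \<Rightarrow> h2) \<Rightarrow> bool" where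
  "LS_data k I \<N> \<O> \<psi> \<longleftrightarrow>
     open I \<and> sigma k \<in> I \<and>
     openin (top_of_set (ker k)) \<N> \<and> 0 \<in> \<N> \<and>
     open \<O> \<and> (sigma k, 0) \<in> \<O> \<and>
     \<psi> ` (I \<times> \<N>) \<subseteq> orthogonal_comp (ker k) \<and>
     smooth_on (I \<times> (LL k -` \<N>)) (\<lambda>(lam, x). \<psi> (lam, LL k x)) \<and>
     \<psi> (sigma k, 0) = 0 \<and>
     (\<forall>lam. \<forall>x\<in>ker k. \<forall>y\<in>orthogonal_comp (ker k).
        ((lam, x + y) \<in> \<O> \<and> (AE t in dom_measure. FF lam (x + y) t - QQ k (FF lam (x + y)) t = 0))
        \<longleftrightarrow> ((lam, x) \<in> I \<times> \<N> \<and> y = \<psi> (lam, x)))"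

definition reduced_map :: "nat \<Rightarrow> (real \<times> h2 \<Rightarrow> h2) \<Rightarrow> real \<times> real \<times> real \<Rightarrow> real \<times> real" where
  "reduced_map k \<psi> = (\<lambda>(lam, x).
     (l2_inner (QQ k (FF lam (LL k x + \<psi> (lam, LL k x)))) (phi_cos k),
      l2_inner (QQ k (FF lam (LL k x + \<psi> (lam, LL k x)))) (phi_sin k)))"

definition reduced_zeros ::
  "nat \<Rightarrow> real set \<Rightarrow> h2 set \<Rightarrow> (real \<times> h2 \<Rightarrow> h2) \<Rightarrow> (real \<times> real \<times> real) set" where
  "reduced_zeros k I \<N> \<psi> = {p \<in> I \<times> (LL k -` \<N>). reduced_map k \<psi> p = 0}"

definition Psi :: "nat \<Rightarrow> (real \<times> h2 \<Rightarrow> h2) \<Rightarrow> real \<times> real \<times> real \<Rightarrow> real \<times> h2" where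
  "Psi k \<psi> = (\<lambda>(lam, x). (lam, LL k x + \<psi> (lam, LL k x)))"

text \<open>One-sided derivatives are meant at endpoints that belong to \<open>J\<close>.\<close>

definition C1_on :: "real set \<Rightarrow> (real \<Rightarrow> real) \<Rightarrow> bool" where
  "C1_on J f \<longleftrightarrow>
     (\<exists>f'. (\<forall>x\<in>J. (f has_real_derivative f' x) (at x within J)) \<and> continuous_on J f')"

end

theory Submission
  imports Defs
begin

text \<open>
  Write a solution near \<open>(\<sigma>\<^sub>k, 0)\<close> as \<open>L x + \<psi>(\<lambda>, L x)\<close>. Uniqueness in the Lyapunov--Schmidt
  data makes \<open>\<psi>\<close> odd, and its derivative in \<open>x\<close> vanishes at the bifurcation point, so \<open>\<psi>\<close> is of
  third order in \<open>x\<close>. Pairing the reduced equation with \<open>x\<close> gives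
  \<open>(\<sigma>\<^sub>k - \<lambda>) |x|\<^sup>2 = \<integral> a u\<^sup>3 L x \<ge> c |x|\<^sup>4\<close>: nontrivial solutions exist only for \<open>\<lambda> < \<sigma>\<^sub>k\<close>, and there
  \<open>y = x / sqrt (\<sigma>\<^sub>k - \<lambda>)\<close> stays in a fixed annulus. In the variable \<open>y\<close> the reduced equation converges
  to \<open>- y + \<integral> a (L y)\<^sup>3 (phi_cos, phi_sin) = 0\<close>, an explicit cubic system in the plane; its nonzero
  solutions are four nondegenerate points, on the two diagonals. An implicit function theorem on
  a left neighbourhood continues each of them, and compactness of the annulus excludes any other
  solution. The one-sided \<open>C\<^sup>1\<close> regularity at \<open>\<sigma>\<^sub>k\<close> comes from the third order Taylor remainder of \<open>\<psi>\<close>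
  in \<open>x\<close>, whose second order term vanishes by oddness. After division by the amplitude the solution
  is \<open>C\<^sup>1\<close>-close to a multiple of \<open>cos (2kt) \<plusminus> sin (2kt)\<close>, which has \<open>2k\<close> simple zeros.
\<close>


section \<open>One-sided limits, remainders and an implicit function theorem\<close>

text \<open>The square root in the rescaling is the obstacle. It is not differentiable at \<sigma>,
  so the rescaled map is meaningful only to the left of \<sigma>, and its \<lambda>-derivative
  carries the factors \<open>1 / ampl\<close> and \<open>1 / ampl ^ 3\<close>. These singular terms
  have a limit because \<psi> has no part of order 0 or 2 in x, which is why oddness is decisive.
  Neither oddness nor the vanishing derivative is part of \<open>LS_data\<close>; both are extracted
  from its equivalence. Oddness reflects the symmetry u -> -u of the equation. The derivative v of
  \<psi> in a direction is identified by dividing the projected equation by the distance to 0 and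
  testing with v'' + \<sigma> v. For odd k the interval [0, pi/4] consists of k quarter periods of
  cos (2kt), an odd number, so the fourth moments of cosine and sine on it agree and the limit
  system is invariant under swapping the two coordinates. The mixed moment 1/(8k) is positive: it
  forces nonzero solutions onto the diagonals and also makes them nondegenerate.\<close>

text \<open>The combination \<open>s *\<^sub>R T1 s - T s\<close> has derivative
  \<open>s *\<^sub>R T2 s\<close>, so the first order term of T cancels by itself. With
  \<open>T 0 = 0\<close> and \<open>T2 0 = 0\<close> the leading term is cubic, and T2 close to
  \<tau> c integrates to c s^3 / 3. The same combination is the numerator of the singular part of
  \<open>rpsi_lam\<close>.\<close>

lemma third_order_remainder:
  fixes T :: "real \<Rightarrow> 'a::real_normed_vector"
  assumes s: "0 \<le> s"
    and T: "\<And>\<tau>. \<tau> \<in> {0..s} \<Longrightarrow> (T has_vector_derivative T1 \<tau>) (at \<tau>)"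
    and T1: "\<And>\<tau>. \<tau> \<in> {0..s} \<Longrightarrow> (T1 has_vector_derivative T2 \<tau>) (at \<tau>)"
    and T2: "\<And>\<tau>. \<tau> \<in> {0..s} \<Longrightarrow> (T2 has_vector_derivative T3 \<tau>) (at \<tau>)"
    and zero: "T 0 = 0" "T2 0 = 0"
    and near: "\<And>\<tau>. \<tau> \<in> {0..s} \<Longrightarrow> norm (T3 \<tau> - c) \<le> e"
  shows "norm (s *\<^sub>R T1 s - T s - (s ^ 3 / 3) *\<^sub>R c) \<le> e * s ^ 3 / 3"
proof (cases "s = 0")
  case True
  then show ?thesis using zero by simp
next
  case False
  then have s0: "0 < s" using s by simp
  have cont: "continuous_on {0..t} f"
    if "\<And>\<tau>. \<tau> \<in> {0..s} \<Longrightarrow> (f has_vector_derivative g \<tau>) (at \<tau>)" "t \<le> s"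
    for f g :: "real \<Rightarrow> 'a" and t
    using that
    by (intro continuous_at_imp_continuous_on ballI has_vector_derivative_continuous[OF that(1)]) auto
  have A: "norm (T2 t - t *\<^sub>R c) \<le> e * t" if t: "t \<in> {0..s}" for t
  proof (cases "t = 0")
    case True
    then show ?thesis using zero by simp
  next
    case False
    have "norm ((\<lambda>\<tau>. T2 \<tau> - \<tau> *\<^sub>R c) t - (\<lambda>\<tau>. T2 \<tau> - \<tau> *\<^sub>R c) 0) \<le> e * t - e * 0"
    proof (rule differentiable_bound_general[where f' = "\<lambda>\<tau>. T3 \<tau> - c" and \<phi>' = "\<lambda>\<tau>. e"])
      show "0 < t" using False t by simp
      show "continuous_on {0..t} (\<lambda>\<tau>. T2 \<tau> - \<tau> *\<^sub>R c)"
        using t by (intro continuous_intros cont[OF T2]) auto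
      show "((\<lambda>\<tau>. T2 \<tau> - \<tau> *\<^sub>R c) has_vector_derivative T3 \<tau> - c) (at \<tau>)"
        if "0 < \<tau>" "\<tau> < t" for \<tau>
        using that t by (auto intro!: derivative_eq_intros T2)
      show "((*) e has_vector_derivative e) (at \<tau>)" for \<tau>
        by (auto intro!: derivative_eq_intros)
    qed (use t near in \<open>auto intro!: continuous_intros\<close>)
    then show ?thesis using zero by simp
  qed
  let ?f = "\<lambda>\<tau>. \<tau> *\<^sub>R T1 \<tau> - T \<tau> - (\<tau> ^ 3 / 3) *\<^sub>R c"
  have "norm (?f s - ?f 0) \<le> e * s ^ 3 / 3 - e * 0 ^ 3 / 3"
  proof (rule differentiable_bound_general[where f' = "\<lambda>\<tau>. \<tau> *\<^sub>R T2 \<tau> - \<tau>\<^sup>2 *\<^sub>R c"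
        and \<phi>' = "\<lambda>\<tau>. e * \<tau>\<^sup>2"])
    show "continuous_on {0..s} ?f"
      by (intro continuous_intros cont[OF T1] cont[OF T]) auto
    show "(?f has_vector_derivative \<tau> *\<^sub>R T2 \<tau> - \<tau>\<^sup>2 *\<^sub>R c) (at \<tau>)"
      if "0 < \<tau>" "\<tau> < s" for \<tau>
      using that by (auto intro!: derivative_eq_intros T T1)
    show "((\<lambda>\<tau>. e * \<tau> ^ 3 / 3) has_vector_derivative e * \<tau>\<^sup>2) (at \<tau>)" for \<tau>
      unfolding has_real_derivative_iff_has_vector_derivative[symmetric]
      by (auto intro!: derivative_eq_intros)
    fix \<tau> assume \<tau>: "0 < \<tau>" "\<tau> < s"
    have "norm (\<tau> *\<^sub>R T2 \<tau> - \<tau>\<^sup>2 *\<^sub>R c) = \<tau> * norm (T2 \<tau> - \<tau> *\<^sub>R c)"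
      using \<tau> by (simp add: power2_eq_square scaleR_right_diff_distrib[symmetric]
          flip: scaleR_scaleR)
    also have "\<dots> \<le> \<tau> * (e * \<tau>)"
      using A[of \<tau>] \<tau> by (intro mult_left_mono) auto
    finally show "norm (\<tau> *\<^sub>R T2 \<tau> - \<tau>\<^sup>2 *\<^sub>R c) \<le> e * \<tau>\<^sup>2"
      by (simp add: power2_eq_square mult_ac)
  qed (use s0 in \<open>auto intro!: continuous_intros\<close>)
  then show ?thesis using zero by simp
qed

text \<open>At an endpoint the derivative is the limit of the interior derivatives, by the mean
  value inequality for f minus the linear function with slope c. This is how a branch becomes
  differentiable at \<sigma> itself.\<close>

lemma has_vector_derivative_left_endpoint:
  fixes f :: "real \<Rightarrow> 'a::real_normed_vector"
  assumes "a < b"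
    and der: "\<And>x. x \<in> {a<..<b} \<Longrightarrow> (f has_vector_derivative f' x) (at x)"
    and lim: "(f \<longlongrightarrow> f b) (at_left b)" "(f' \<longlongrightarrow> c) (at_left b)"
  shows "(f has_vector_derivative c) (at b within {a<..b})"
  unfolding has_vector_derivative_def has_derivative_within_alt
proof (intro conjI allI impI)
  show "bounded_linear (\<lambda>x. x *\<^sub>R c)" by (rule bounded_linear_scaleR_left)
  fix e :: real assume "0 < e"
  then have "\<forall>\<^sub>F x in at_left b. norm (f' x - c) < e"
    using lim(2) unfolding tendsto_iff dist_norm by blast
  then obtain d where d: "d < b" "\<And>x. d < x \<Longrightarrow> x < b \<Longrightarrow> norm (f' x - c) < e"
    unfolding eventually_at_left_field by auto
  show "\<exists>d>0. \<forall>y\<in>{a<..b}. norm (y - b) < d \<longrightarrow>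
      norm (f y - f b - (y - b) *\<^sub>R c) \<le> e * norm (y - b)"
  proof (intro exI[of _ "b - d"] conjI ballI impI)
    show "0 < b - d" using d by simp
    fix y assume y: "y \<in> {a<..b}" "norm (y - b) < b - d"
    show "norm (f y - f b - (y - b) *\<^sub>R c) \<le> e * norm (y - b)"
    proof (cases "y = b")
      case False
      then have yb: "y < b" using y by simp
      let ?g = "\<lambda>x. f x - x *\<^sub>R c"
      have "norm (?g b - ?g y) \<le> e * b - e * y"
      proof (rule differentiable_bound_general[where f' = "\<lambda>x. f' x - c" and \<phi>' = "\<lambda>x. e"])
        have "continuous_on {y..b} f"
        proof (subst continuous_on_eq_continuous_within, intro ballI)
          fix x assume x: "x \<in> {y..b}"
          show "continuous (at x within {y..b}) f"
          proof (cases "x = b")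
            case True
            have "at b within {y..b} = at_left b"
              using yb by (simp add: at_within_Icc_at_left)
            then show ?thesis using lim(1) True by (simp add: continuous_within)
          next
            case False
            then have "continuous (at x) f"
              using x y by (intro has_vector_derivative_continuous[OF der]) auto
            then show ?thesis by (rule continuous_at_imp_continuous_at_within)
          qed
        qed
        then show "continuous_on {y..b} ?g" by (intro continuous_intros)
        show "(?g has_vector_derivative f' x - c) (at x)" if "y < x" "x < b" for x
          using that y by (auto intro!: derivative_eq_intros der)
        show "norm (f' x - c) \<le> e" if "y < x" "x < b" for x
          using that y d(2)[of x] by auto
        show "((*) e has_vector_derivative e) (at \<tau>)" for \<tau>
          by (auto intro!: derivative_eq_intros)
      qed (use yb in \<open>auto intro!: continuous_intros\<close>)
      also have "norm (?g b - ?g y) = norm (f y - f b - (y - b) *\<^sub>R c)"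
        by (subst norm_minus_commute) (simp add: algebra_simps)
      finally show ?thesis using yb by (simp add: algebra_simps)
    qed simp
  qed
qed

text \<open>The value of K at \<sigma> is replaced by limits from the left, since the rescaled map
  is singular there. K is assumed preconditioned: its y-derivative B is within 1/2 of the identity
  on all of D, so y - K (l, y) contracts with one constant for all l, and the radius \<delta> does
  not shrink towards \<sigma>. The limits of a and B are demanded along every Y tending to y0
  because the curve is not known in advance.\<close>

lemma implicit_curve_left:
  fixes K :: "real \<times> 'a::euclidean_space \<Rightarrow> 'a" and \<sigma> \<rho> \<delta> :: real and y0 a0 :: 'a
  defines "D \<equiv> {\<sigma> - \<rho> <..< \<sigma>} \<times> cball y0 \<delta>"
  assumes \<rho>: "\<rho> > 0" and \<delta>: "\<delta> > 0"
    and der: "\<And>l y. (l, y) \<in> D \<Longrightarrow>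
        (K has_derivative (\<lambda>(h, d). h *\<^sub>R a (l, y) + B (l, y) d)) (at (l, y))"
    and near: "\<And>p d. p \<in> D \<Longrightarrow> norm (B p d - d) \<le> norm d / 2"
    and base: "\<And>l. l \<in> {\<sigma> - \<rho> <..< \<sigma>} \<Longrightarrow> norm (K (l, y0)) \<le> \<delta> / 4"
      "((\<lambda>l. K (l, y0)) \<longlongrightarrow> 0) (at_left \<sigma>)"
    and cont: "continuous_on D a" "\<And>d. continuous_on D (\<lambda>p. B p d)"
    and lim_a: "\<And>Y. (Y \<longlongrightarrow> y0) (at_left \<sigma>) \<Longrightarrow> ((\<lambda>l. a (l, Y l)) \<longlongrightarrow> a0) (at_left \<sigma>)"
    and lim_B: "\<And>Y d. (Y \<longlongrightarrow> y0) (at_left \<sigma>) \<Longrightarrow> ((\<lambda>l. B (l, Y l) d) \<longlongrightarrow> d) (at_left \<sigma>)"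
  obtains Y Y' where
    "\<And>l. l \<in> {\<sigma> - \<rho> <..< \<sigma>} \<Longrightarrow> Y l \<in> ball y0 \<delta>"
    "\<And>l y. (l, y) \<in> D \<Longrightarrow> K (l, y) = 0 \<longleftrightarrow> y = Y l"
    "Y \<sigma> = y0"
    "\<And>l. l \<in> {\<sigma> - \<rho> <.. \<sigma>} \<Longrightarrow> (Y has_vector_derivative Y' l) (at l within {\<sigma> - \<rho> <.. \<sigma>})"
    "continuous_on {\<sigma> - \<rho> <.. \<sigma>} Y'"
proof -
  let ?J = "{\<sigma> - \<rho> <..< \<sigma>}"
  have contr: "norm ((y - K (l, y)) - (z - K (l, z))) \<le> 1 / 2 * norm (y - z)"
    if l: "l \<in> ?J" and yz: "y \<in> cball y0 \<delta>" "z \<in> cball y0 \<delta>" for l y z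
  proof (rule differentiable_bound[where S = "cball y0 \<delta>" and f' = "\<lambda>y d. d - B (l, y) d"])
    fix x assume x: "x \<in> cball y0 \<delta>"
    have "((\<lambda>y. K (l, y)) has_derivative (\<lambda>d. B (l, x) d)) (at x within cball y0 \<delta>)"
    proof -
      have "((\<lambda>y. (l, y)) has_derivative (\<lambda>d. (0, d))) (at x within cball y0 \<delta>)"
        by (auto intro!: derivative_eq_intros)
      from has_derivative_compose[OF this der[of l x]] x l show ?thesis
        by (simp add: D_def)
    qed
    then show "((\<lambda>y. y - K (l, y)) has_derivative (\<lambda>d. d - B (l, x) d)) (at x within cball y0 \<delta>)"
      by (auto intro!: derivative_eq_intros)
    show "onorm (\<lambda>d. d - B (l, x) d) \<le> 1 / 2"
      by (rule onorm_le) (use near[of "(l, x)"] l x in \<open>auto simp: D_def norm_minus_commute\<close>)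
  qed (use yz in auto)
  have ex: "\<exists>Y\<in>ball y0 \<delta>. \<forall>y\<in>cball y0 \<delta>. K (l, y) = 0 \<longleftrightarrow> y = Y" if l: "l \<in> ?J" for l
  proof -
    let ?G = "\<lambda>y. y - K (l, y)"
    \<comment> \<open>The contraction halves the distance to y0 and the residual adds \<delta>/4.
      The ball is therefore mapped into itself, and a fixed point lies within 3\<delta>/4, hence in
      the open ball.\<close>
    have in_half: "dist y0 (?G y) \<le> dist y0 y / 2 + \<delta> / 4" if "y \<in> cball y0 \<delta>" for y
    proof -
      have "?G y - y0 = (?G y - ?G y0) - K (l, y0)" by simp
      then have "norm (?G y - y0) \<le> norm (?G y - ?G y0) + norm (K (l, y0))"
        by (metis norm_triangle_ineq4)
      also have "\<dots> \<le> 1 / 2 * norm (y - y0) + \<delta> / 4"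
        using contr[OF l that, of y0] base(1)[OF l] \<delta> by (intro add_mono) auto
      finally show ?thesis by (simp add: dist_norm norm_minus_commute)
    qed
    have "\<exists>!y\<in>cball y0 \<delta>. ?G y = y"
    proof (rule Banach_fix[where c = "1/2"])
      show "?G ` cball y0 \<delta> \<subseteq> cball y0 \<delta>"
      proof
        fix x assume "x \<in> ?G ` cball y0 \<delta>"
        then obtain y where y: "y \<in> cball y0 \<delta>" "x = ?G y" by auto
        then show "x \<in> cball y0 \<delta>" using in_half[of y] \<delta> by (simp del: dist_diff)
      qed
      show "dist (?G y) (?G z) \<le> 1/2 * dist y z" if "y \<in> cball y0 \<delta>" "z \<in> cball y0 \<delta>" for y z
        using contr[OF l that] by (simp only: dist_norm)
    qed (use \<delta> in \<open>auto simp: complete_eq_closed\<close>)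
    then obtain Y where Y: "Y \<in> cball y0 \<delta>" "K (l, Y) = 0"
      "\<And>y. y \<in> cball y0 \<delta> \<Longrightarrow> K (l, y) = 0 \<Longrightarrow> y = Y" by auto
    from in_half[OF Y(1)] Y(2) \<delta> have "Y \<in> ball y0 \<delta>" by simp
    then show ?thesis using Y by blast
  qed
  \<comment> \<open>The value y0 at \<sigma> is inserted by hand; \<open>lim_Y\<close> below shows
    that this makes the curve continuous there.\<close>
  define Y where "Y l = (if l = \<sigma> then y0
      else SOME Y. Y \<in> ball y0 \<delta> \<and> (\<forall>y\<in>cball y0 \<delta>. K (l, y) = 0 \<longleftrightarrow> y = Y))" for l
  have Y: "Y l \<in> ball y0 \<delta>" "\<And>y. y \<in> cball y0 \<delta> \<Longrightarrow> K (l, y) = 0 \<longleftrightarrow> y = Y l"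
    if l: "l \<in> ?J" for l
  proof -
    have "Y l \<in> ball y0 \<delta> \<and> (\<forall>y\<in>cball y0 \<delta>. K (l, y) = 0 \<longleftrightarrow> y = Y l)"
      using someI_ex[OF ex[OF l, unfolded Bex_def]] l by (auto simp: Y_def)
    then show "Y l \<in> ball y0 \<delta>" "\<And>y. y \<in> cball y0 \<delta> \<Longrightarrow> K (l, y) = 0 \<longleftrightarrow> y = Y l" by auto
  qed
  have YD: "(l, Y l) \<in> D" "K (l, Y l) = 0" if "l \<in> ?J" for l
    using Y[OF that] that by (auto simp: D_def)
  \<comment> \<open>The distance to the zero is at most twice the residual. Applied with fixed y,
    this gives both continuity of Y and its limit at \<sigma> from continuity and the limit of K in
    l.\<close>
  have dist_Y: "norm (y - Y l) \<le> 2 * norm (K (l, y))" if l: "l \<in> ?J" and y: "y \<in> cball y0 \<delta>" for l y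
  proof -
    have "y - Y l = ((y - K (l, y)) - (Y l - K (l, Y l))) + K (l, y)"
      using YD[OF l] by simp
    then have "norm (y - Y l) \<le> norm ((y - K (l, y)) - (Y l - K (l, Y l))) + norm (K (l, y))"
      by (metis norm_triangle_ineq)
    also have "\<dots> \<le> 1 / 2 * norm (y - Y l) + norm (K (l, y))"
      using contr[OF l y, of "Y l"] Y(1)[OF l] by auto
    finally show ?thesis by simp
  qed
  have lim_Y: "(Y \<longlongrightarrow> y0) (at_left \<sigma>)"
  proof (rule metric_tendsto_imp_tendsto)
    show "((\<lambda>l. 2 *\<^sub>R K (l, y0)) \<longlongrightarrow> 0) (at_left \<sigma>)"
      using tendsto_scaleR[OF tendsto_const base(2)] by simp
    have "\<forall>\<^sub>F l in at_left \<sigma>. l \<in> ?J"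
      using \<rho> by (intro eventually_at_leftI[of "\<sigma> - \<rho>"]) auto
    then show "\<forall>\<^sub>F l in at_left \<sigma>. dist (Y l) y0 \<le> dist (2 *\<^sub>R K (l, y0)) 0"
      by (rule eventually_mono)
        (use dist_Y[of _ y0] \<delta> in \<open>auto simp: dist_norm norm_minus_commute\<close>)
  qed
  have lin_B: "linear (B p)" if "p \<in> D" for p
  proof -
    obtain l y where p: "p = (l, y)" by (cases p)
    have "linear (\<lambda>(h, d). h *\<^sub>R a (l, y) + B (l, y) d)"
      using der[of l y] that p has_derivative_linear by blast
    then have "linear ((\<lambda>(h, d). h *\<^sub>R a (l, y) + B (l, y) d) \<circ> (\<lambda>d. (0, d)))"
      by (intro linear_compose) (auto intro!: linearI)
    then show ?thesis by (simp add: p o_def)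
  qed
  \<comment> \<open>B is bounded below by 1/2, hence injective, hence onto in finite dimension; the
    same bound replaces continuity of the inverse in the limits below.\<close>
  have low: "norm d \<le> 2 * norm (B p d)" if "p \<in> D" for p d
  proof -
    have "norm d \<le> norm (B p d) + norm (B p d - d)"
      by norm
    then show ?thesis using near[OF that, of d] by simp
  qed
  \<comment> \<open>The candidate derivative: the equation obtained by differentiating
    \<open>K (l, Y l) = 0\<close> in l.\<close>
  have "\<exists>v. B (l, Y l) v = - a (l, Y l)" if "l \<in> ?J" for l
  proof -
    have "inj (B (l, Y l))"
      using low[OF YD(1)[OF that]] lin_B[OF YD(1)[OF that]]
      by (simp add: linear_injective_0)
        (metis norm_eq_zero mult_zero_right norm_le_zero_iff)
    then have "surj (B (l, Y l))"
      using lin_B[OF YD(1)[OF that]] linear_injective_imp_surjective by blast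
    then show ?thesis by (metis surjD)
  qed
  then obtain v where v: "\<And>l. l \<in> ?J \<Longrightarrow> B (l, Y l) (v l) = - a (l, Y l)"
    by metis
  \<comment> \<open>Stability of the linear system: if w solves the limit system, its defect in the
    system at l tends to 0, and \<open>low\<close> bounds \<open>v l - w\<close> by twice that
    defect. This is used at interior points and at \<sigma>.\<close>
  have tend_v: "(v \<longlongrightarrow> w) F"
    if F: "\<forall>\<^sub>F l in F. l \<in> ?J" and la: "((\<lambda>l. a (l, Y l)) \<longlongrightarrow> \<alpha>) F"
      and lB: "((\<lambda>l. B (l, Y l) w) \<longlongrightarrow> - \<alpha>) F" for F w \<alpha>
  proof (rule metric_tendsto_imp_tendsto)
    show "((\<lambda>l. 2 *\<^sub>R (a (l, Y l) + B (l, Y l) w)) \<longlongrightarrow> 0) F"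
      using tendsto_scaleR[OF tendsto_const tendsto_add[OF la lB], of 2] by simp
    show "\<forall>\<^sub>F l in F. dist (v l) w \<le> dist (2 *\<^sub>R (a (l, Y l) + B (l, Y l) w)) 0"
      using F
    proof (rule eventually_mono)
      fix l assume l: "l \<in> ?J"
      have "B (l, Y l) (v l - w) = - (a (l, Y l) + B (l, Y l) w)"
        using v[OF l] linear_diff[OF lin_B[OF YD(1)[OF l]]] by simp
      then show "dist (v l) w \<le> dist (2 *\<^sub>R (a (l, Y l) + B (l, Y l) w)) 0"
        using low[OF YD(1)[OF l], of "v l - w"] by (simp only: dist_norm norm_minus_cancel) simp
    qed
  qed
  have cont_Y: "isCont Y l" if l: "l \<in> ?J" for l
    unfolding isCont_def
  proof (rule metric_tendsto_imp_tendsto)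
    have "isCont K (l, Y l)"
      using der YD(1)[OF l] has_derivative_continuous by blast
    then have "isCont (\<lambda>x. K (x, Y l)) l"
      by (intro isCont_o2[of _ "\<lambda>x. (x, Y l)" K] continuous_intros) auto
    then show "((\<lambda>x. 2 *\<^sub>R K (x, Y l)) \<longlongrightarrow> 0) (at l)"
      using tendsto_scaleR[OF tendsto_const, of "\<lambda>x. K (x, Y l)" 0 "at l" 2] YD(2)[OF l]
      by (simp add: isCont_def)
    have "\<forall>\<^sub>F x in at l. x \<in> ?J"
      using l by (intro eventually_at_in_open') auto
    then show "\<forall>\<^sub>F x in at l. dist (Y x) (Y l) \<le> dist (2 *\<^sub>R K (x, Y l)) 0"
      by (rule eventually_mono)
        (use dist_Y[of _ "Y l"] Y(1)[OF l] in \<open>auto simp: dist_norm norm_minus_commute\<close>)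
  qed
  have der_Y: "(Y has_vector_derivative v l) (at l)" if l: "l \<in> ?J" for l
    unfolding has_vector_derivative_def has_derivative_at_alt
  proof (intro conjI allI impI)
    show "bounded_linear (\<lambda>x. x *\<^sub>R v l)" by (rule bounded_linear_scaleR_left)
    fix e :: real assume e: "0 < e"
    \<comment> \<open>The error \<open>?e\<close> below satisfies |?e| \<le> 2c |x - l| (1 + |v|) +
      2c |?e|. The bound c \<le> 1/4 absorbs the last term into the left side, and the second bound
      makes the remaining factor 4c (1 + |v|) at most e.\<close>
    define c where "c = min (1/4) (e / (4 * (1 + norm (v l))))"
    have nv: "1 + norm (v l) > 0" by (smt (verit) norm_ge_zero)
    have c: "c > 0" "c \<le> 1/4" "4 * c * (1 + norm (v l)) \<le> e"
    proof -
      show "c > 0" using e nv by (auto simp: c_def)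
      show "c \<le> 1/4" unfolding c_def by (rule min.cobounded1)
      have "c \<le> e / (4 * (1 + norm (v l)))" by (simp add: c_def)
      then show "4 * c * (1 + norm (v l)) \<le> e"
        using nv by (simp add: field_simps)
    qed
    obtain d where d: "d > 0" "\<And>p. norm (p - (l, Y l)) < d \<Longrightarrow>
        norm (K p - K (l, Y l) - (\<lambda>(h, d). h *\<^sub>R a (l, Y l) + B (l, Y l) d) (p - (l, Y l)))
          \<le> c * norm (p - (l, Y l))"
      using der[OF YD(1)[OF l]] c(1) unfolding has_derivative_at_alt by blast
    have "isCont (\<lambda>x. (x, Y x)) l"
      by (intro continuous_intros cont_Y[OF l])
    then have "((\<lambda>x. (x, Y x)) \<longlongrightarrow> (l, Y l)) (nhds l)"
      using tendsto_at_iff_tendsto_nhds[of "\<lambda>x. (x, Y x)" l] by (simp add: isCont_def)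
    from tendstoD[OF this d(1)] have "\<forall>\<^sub>F x in nhds l. dist (x, Y x) (l, Y l) < d" .
    moreover have "\<forall>\<^sub>F x in nhds l. x \<in> ?J"
      using l by (intro eventually_nhds_in_open) auto
    ultimately have "\<forall>\<^sub>F x in nhds l. dist (x, Y x) (l, Y l) < d \<and> x \<in> ?J"
      by (rule eventually_conj)
    then obtain r where r: "r > 0"
      "\<And>x. dist x l < r \<Longrightarrow> dist (x, Y x) (l, Y l) < d \<and> x \<in> ?J"
      unfolding eventually_nhds_metric by blast
    show "\<exists>r>0. \<forall>x. norm (x - l) < r \<longrightarrow>
        norm (Y x - Y l - (x - l) *\<^sub>R v l) \<le> e * norm (x - l)"
    proof (intro exI[of _ r] conjI allI impI)
      show "r > 0" by (rule r)
      fix x assume "norm (x - l) < r"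
      then have x: "norm ((x, Y x) - (l, Y l)) < d" "x \<in> ?J"
        using r(2)[of x] by (auto simp: dist_norm)
      let ?e = "Y x - Y l - (x - l) *\<^sub>R v l"
      let ?B = "B (l, Y l)"
      note linear = lin_B[OF YD(1)[OF l]]
      have "?B ?e = - (K (x, Y x) - K (l, Y l) - ((x - l) *\<^sub>R a (l, Y l) + ?B (Y x - Y l)))"
        using v[OF l] YD(2)[OF l] YD(2)[OF x(2)] linear_diff[OF linear] linear_scale[OF linear]
        by simp
      then have "norm (?B ?e) \<le> c * norm ((x, Y x) - (l, Y l))"
        using d(2)[OF x(1)] by (simp only: norm_minus_cancel) simp
      also have "\<dots> \<le> c * (norm (x - l) + norm (Y x - Y l))"
        using c(1) norm_Pair_le[of "x - l" "Y x - Y l"] by (intro mult_left_mono) auto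
      also have "norm (Y x - Y l) \<le> norm ?e + norm ((x - l) *\<^sub>R v l)"
        by (metis diff_add_cancel norm_triangle_ineq)
      finally have "norm (?B ?e) \<le> c * (norm (x - l) + (norm ?e + norm (x - l) * norm (v l)))"
        using c(1) by simp
      then have "norm ?e \<le> 2 * (c * (norm (x - l) * (1 + norm (v l)))) + 2 * c * norm ?e"
        using low[OF YD(1)[OF l], of ?e] by (simp add: algebra_simps)
      moreover have "2 * c * norm ?e \<le> 1/2 * norm ?e"
        using c(2) by (intro mult_right_mono) auto
      ultimately have "norm ?e \<le> (4 * c * (1 + norm (v l))) * norm (x - l)"
        by (simp add: algebra_simps)
      also have "\<dots> \<le> e * norm (x - l)"
        using c(3) by (intro mult_right_mono) auto
      finally show "norm ?e \<le> e * norm (x - l)" .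
    qed
  qed
  define Y' where "Y' l = (if l = \<sigma> then - a0 else v l)" for l
  have J_left: "\<forall>\<^sub>F l in at_left \<sigma>. l \<in> ?J"
    using \<rho> by (intro eventually_at_leftI[of "\<sigma> - \<rho>"]) auto
  have lim_v: "(v \<longlongrightarrow> - a0) (at_left \<sigma>)"
    by (rule tend_v[OF J_left lim_a[OF lim_Y] lim_B[OF lim_Y]])
  have lim_Y': "(Y' \<longlongrightarrow> - a0) (at_left \<sigma>)"
    by (rule Lim_transform_eventually[OF lim_v eventually_mono[OF J_left]]) (simp add: Y'_def)
  show ?thesis
  proof
    show "Y l \<in> ball y0 \<delta>" if "l \<in> ?J" for l using Y(1)[OF that] .
    show "K (l, y) = 0 \<longleftrightarrow> y = Y l" if "(l, y) \<in> D" for l y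
      using Y(2)[of l y] that by (auto simp: D_def)
    show "Y \<sigma> = y0" by (simp add: Y_def)
    fix l assume l: "l \<in> {\<sigma> - \<rho> <.. \<sigma>}"
    show "(Y has_vector_derivative Y' l) (at l within {\<sigma> - \<rho> <.. \<sigma>})"
    proof (cases "l = \<sigma>")
      case True
      have "(Y has_vector_derivative - a0) (at \<sigma> within {\<sigma> - \<rho> <.. \<sigma>})"
        by (rule has_vector_derivative_left_endpoint[OF _ der_Y])
          (use \<rho> lim_Y lim_v in \<open>auto simp: Y_def\<close>)
      then show ?thesis by (simp add: True Y'_def)
    next
      case False
      then show ?thesis
        using l der_Y[of l] by (auto simp: Y'_def intro: has_vector_derivative_at_within)
    qed
  next
    show "continuous_on {\<sigma> - \<rho> <.. \<sigma>} Y'"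
    proof (subst continuous_on_eq_continuous_within, intro ballI)
      fix l assume l: "l \<in> {\<sigma> - \<rho> <.. \<sigma>}"
      show "continuous (at l within {\<sigma> - \<rho> <.. \<sigma>}) Y'"
      proof (cases "l = \<sigma>")
        case True
        have "at \<sigma> within {\<sigma> - \<rho> <.. \<sigma>} = at_left \<sigma>"
          using \<rho> by (intro at_within_nhd[of _ "{\<sigma> - \<rho> <..}"]) auto
        then show ?thesis
          using lim_Y' by (simp add: True continuous_within Y'_def[of \<sigma>])
      next
        case False
        then have lJ: "l \<in> ?J" using l by simp
        have ev: "\<forall>\<^sub>F x in at l. x \<in> ?J"
          using lJ by (intro eventually_at_in_open') auto
        have filt: "filterlim (\<lambda>x. (x, Y x)) (at (l, Y l) within D) (at l)"
          unfolding filterlim_at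
        proof
          show "((\<lambda>x. (x, Y x)) \<longlongrightarrow> (l, Y l)) (at l)"
            using cont_Y[OF lJ] by (intro tendsto_intros) (simp add: isCont_def)
          have "\<forall>\<^sub>F x in at l. x \<noteq> l" by (simp add: eventually_at_filter)
          then show "\<forall>\<^sub>F x in at l. (x, Y x) \<in> D \<and> (x, Y x) \<noteq> (l, Y l)"
            using ev by eventually_elim (use YD(1) in auto)
        qed
        have *: "((\<lambda>x. g (x, Y x)) \<longlongrightarrow> g (l, Y l)) (at l)" if "continuous_on D g" for g :: "real \<times> 'a \<Rightarrow> 'a"
          using that YD(1)[OF lJ] filterlim_compose[OF _ filt, of g "nhds (g (l, Y l))"]
          by (simp add: continuous_on_def)
        have "(v \<longlongrightarrow> v l) (at l)"
          using tend_v[OF ev *[OF cont(1)], of "v l"] *[OF cont(2), of "v l"] v[OF lJ] by simp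
        then have "isCont v l" by (simp add: isCont_def)
        moreover have "\<forall>\<^sub>F x in nhds l. x \<in> ?J"
          using lJ by (intro eventually_nhds_in_open) auto
        then have "\<forall>\<^sub>F x in nhds l. v x = Y' x"
          by (rule eventually_mono) (simp add: Y'_def)
        ultimately have "isCont Y' l"
          using isCont_cong by blast
        then show ?thesis by (rule continuous_at_imp_continuous_at_within)
      qed
    qed
  qed
qed


section \<open>Square integrable functions\<close>

definition l2_norm :: "(real \<Rightarrow> real) \<Rightarrow> real" where
  "l2_norm f = sqrt (l2_inner f f)"

lemma l2_inner_self_nonneg: "0 \<le> l2_inner f f"
  unfolding l2_inner_def by (rule Bochner_Integration.integral_nonneg) simp

lemma l2_norm_nonneg [simp]: "0 \<le> l2_norm f"
  by (simp add: l2_norm_def l2_inner_self_nonneg)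

lemma l2_inner_commute: "l2_inner f g = l2_inner g f"
  by (simp add: l2_inner_def mult.commute)

lemma l2_inner_lincomb:
  assumes "f \<in> L2" "g \<in> L2" "h \<in> L2"
  shows "l2_inner (\<lambda>t. a * f t + b * g t) h = a * l2_inner f h + b * l2_inner g h"
  unfolding l2_inner_def
  using L2_mult_integrable[OF assms(1,3)] L2_mult_integrable[OF assms(2,3)]
  by (simp add: distrib_right mult.assoc)

lemma l2_inner_add: "f \<in> L2 \<Longrightarrow> g \<in> L2 \<Longrightarrow> h \<in> L2 \<Longrightarrow>
    l2_inner (\<lambda>t. f t + g t) h = l2_inner f h + l2_inner g h"
  using l2_inner_lincomb[of f g h 1 1] by simp

lemma l2_inner_scale: "l2_inner (\<lambda>t. c * f t) h = c * l2_inner f h"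
  unfolding l2_inner_def by (simp add: mult.assoc)

lemma l2_inner_cong_AE:
  assumes "AE t in dom_measure. f t = g t" "f \<in> L2" "g \<in> L2" "h \<in> L2"
  shows "l2_inner f h = l2_inner g h"
  unfolding l2_inner_def
  by (rule integral_cong_AE) (use assms in \<open>auto simp: L2_def elim!: eventually_mono\<close>)

text \<open>The squared norm of f + c g is a quadratic in c that never becomes negative. The form is
  only semidefinite on representatives, so the case of a vanishing leading coefficient is treated
  apart.\<close>

lemma l2_Cauchy_Schwarz:
  assumes f: "f \<in> L2" and g: "g \<in> L2"
  shows "\<bar>l2_inner f g\<bar> \<le> l2_norm f * l2_norm g"
proof -
  let ?A = "l2_inner f f" and ?B = "l2_inner f g" and ?C = "l2_inner g g"
  have quad: "0 \<le> ?A + 2 * c * ?B + c\<^sup>2 * ?C" for c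
  proof -
    let ?h = "\<lambda>t. 1 * f t + c * g t"
    have h: "?h \<in> L2" using L2_add[OF L2_scale L2_scale] f g by blast
    have "l2_inner ?h ?h = l2_inner f ?h + c * l2_inner g ?h"
      using l2_inner_lincomb[OF f g h, of 1 c] by simp
    also have "l2_inner f ?h = ?A + c * ?B"
      using l2_inner_lincomb[OF f g f, of 1 c] by (simp add: l2_inner_commute)
    also have "l2_inner g ?h = ?B + c * ?C"
      using l2_inner_lincomb[OF f g g, of 1 c] by (simp add: l2_inner_commute)
    finally show ?thesis
      using l2_inner_self_nonneg[of ?h] by (simp add: power2_eq_square algebra_simps)
  qed
  have "?B\<^sup>2 \<le> ?A * ?C"
  proof (cases "?C = 0")
    case True
    have "?B = 0"
    proof (rule ccontr)
      assume "?B \<noteq> 0"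
      \<comment> \<open>With leading coefficient 0 the quadratic is affine; at this c it would take
        the value -1.\<close>
      then have "2 * (- (?A + 1) / (2 * ?B)) * ?B = - (?A + 1)" by simp
      moreover have "0 \<le> ?A + 2 * (- (?A + 1) / (2 * ?B)) * ?B"
        using quad[of "- (?A + 1) / (2 * ?B)"] unfolding True by simp
      ultimately show False by linarith
    qed
    then show ?thesis using True by simp
  next
    case False
    then have C: "?C > 0" using l2_inner_self_nonneg[of g] by simp
    have "0 \<le> (?A + 2 * (- ?B / ?C) * ?B + (- ?B / ?C)\<^sup>2 * ?C) * ?C"
      using quad[of "- ?B / ?C"] C by (intro mult_nonneg_nonneg) auto
    also have "\<dots> = ?A * ?C - ?B\<^sup>2"
      using C by (simp add: field_simps power2_eq_square)
    finally show ?thesis by simp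
  qed
  then have "sqrt (?B\<^sup>2) \<le> sqrt (?A * ?C)" by (rule real_sqrt_le_mono)
  then show ?thesis by (simp add: l2_norm_def real_sqrt_mult)
qed

lemma l2_norm_abs: "l2_norm (\<lambda>t. \<bar>f t\<bar>) = l2_norm f"
  by (simp add: l2_norm_def l2_inner_def)

lemma L2_abs: "f \<in> L2 \<Longrightarrow> (\<lambda>t. \<bar>f t\<bar>) \<in> L2"
  by (auto simp: L2_def)

lemma L2_const: "(\<lambda>t. c) \<in> L2"
  by (intro continuous_on_imp_L2 continuous_intros)

lemma l2_norm_one: "l2_norm (\<lambda>t. 1) = sqrt pi"
  by (simp add: l2_norm_def l2_inner_def measure_restrict_space)

lemma integral_eq_l2_inner: "f \<in> L2 \<Longrightarrow> integral {0..pi} f = l2_inner f (\<lambda>t. 1)"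
  unfolding l2_inner_def
  using lebesgue_integral_eq_integral[OF L2_integrable, of f] by simp

lemma integral_abs_le:
  assumes "f \<in> L2"
  shows "integral {0..pi} (\<lambda>t. \<bar>f t\<bar>) \<le> sqrt pi * l2_norm f"
  using l2_Cauchy_Schwarz[OF L2_abs[OF assms] L2_const[of 1]]
    integral_eq_l2_inner[OF L2_abs[OF assms]]
  by (simp add: l2_norm_abs l2_norm_one mult.commute)

lemma primitive_diff:
  assumes g: "g \<in> L2" and f: "\<And>t. t \<in> {0..pi} \<Longrightarrow> f t = f 0 + integral {0..t} g"
    and st: "0 \<le> s" "s \<le> t" "t \<le> pi"
  shows "f t - f s = integral {s..t} g"
proof -
  have "integral {0..s} g + integral {s..t} g = integral {0..t} g"
    using st L2_integrable_on_sub[OF g, of t]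
    by (intro Henstock_Kurzweil_Integration.integral_combine) auto
  then show ?thesis using f[of s] f[of t] st by simp
qed

lemma L2_integrable_on_Icc:
  assumes "f \<in> L2" "0 \<le> s" "t \<le> pi"
  shows "f integrable_on {s..t}"
  using integrable_on_subinterval[OF L2_integrable_on[OF assms(1)], of s t] assms by auto

lemma primitive_diff_le:
  assumes g: "g \<in> L2" and f: "\<And>t. t \<in> {0..pi} \<Longrightarrow> f t = f 0 + integral {0..t} g"
    and st: "0 \<le> s" "s \<le> t" "t \<le> pi"
  shows "\<bar>f t - f s\<bar> \<le> integral {s..t} (\<lambda>t. \<bar>g t\<bar>)"
  using primitive_diff[of g f, OF g f st] integral_norm_bound_integral[of g "{s..t}" "\<lambda>t. \<bar>g t\<bar>"]
    L2_integrable_on_Icc[OF g st(1,3)] L2_integrable_on_Icc[OF L2_abs[OF g] st(1,3)] by simp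

text \<open>One-dimensional Sobolev embedding: the oscillation of f is at most the integral of |g|,
  and some value of f is controlled by its mean. The constants come from 1 \<le> sqrt pi \<le>
  2.\<close>

lemma primitive_sup_bound:
  assumes g: "g \<in> L2" and f: "\<And>t. t \<in> {0..pi} \<Longrightarrow> f t = f 0 + integral {0..t} g"
    and t: "t \<in> {0..pi}"
  shows "\<bar>f t\<bar> \<le> l2_norm f + 2 * l2_norm g"
proof -
  let ?M = "sqrt pi * l2_norm g"
  have fL2: "f \<in> L2"
    by (rule continuous_on_imp_L2[OF primitive_continuous[OF g f]])
  have osc: "\<bar>f t\<bar> - ?M \<le> \<bar>f s\<bar>" if s: "s \<in> {0..pi}" for s
  proof -
    have "\<bar>f b - f a\<bar> \<le> ?M" if "0 \<le> a" "a \<le> b" "b \<le> pi" for a b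
    proof -
      have "\<bar>f b - f a\<bar> \<le> integral {a..b} (\<lambda>t. \<bar>g t\<bar>)"
        by (rule primitive_diff_le[OF g f that])
      also have "\<dots> \<le> integral {0..pi} (\<lambda>t. \<bar>g t\<bar>)"
        using that L2_integrable_on_Icc[OF L2_abs[OF g]] by (intro integral_subset_le) auto
      also have "\<dots> \<le> ?M" by (rule integral_abs_le[OF g])
      finally show ?thesis .
    qed
    from this[of s t] this[of t s] s t show ?thesis by (cases "s \<le> t") auto
  qed
  \<comment> \<open>Averaging the oscillation bound over s compares the value at t with the mean of
    |f|.\<close>
  have "pi * (\<bar>f t\<bar> - ?M) = integral {0..pi} (\<lambda>s. \<bar>f t\<bar> - ?M)" by simp
  also have "\<dots> \<le> integral {0..pi} (\<lambda>s. \<bar>f s\<bar>)"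
    using osc L2_integrable_on[OF L2_abs[OF fL2]] by (intro integral_le) auto
  also have "\<dots> \<le> sqrt pi * l2_norm f" by (rule integral_abs_le[OF fL2])
  finally have "sqrt pi * (sqrt pi * (\<bar>f t\<bar> - ?M)) \<le> sqrt pi * l2_norm f"
    by (simp add: mult.assoc[symmetric])
  then have *: "sqrt pi * (\<bar>f t\<bar> - ?M) \<le> l2_norm f" by simp
  have pi4: "1 \<le> sqrt pi" "sqrt pi \<le> 2"
    using pi_gt3 pi_less_4 by (auto intro: real_le_lsqrt)
  have "\<bar>f t\<bar> - ?M \<le> l2_norm f"
  proof (cases "\<bar>f t\<bar> - ?M \<le> 0")
    case True
    then show ?thesis using l2_norm_nonneg[of f] by linarith
  next
    case False
    then have "1 * (\<bar>f t\<bar> - ?M) \<le> sqrt pi * (\<bar>f t\<bar> - ?M)"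
      using pi4 by (intro mult_right_mono) auto
    then show ?thesis using * by simp
  qed
  moreover have "?M \<le> 2 * l2_norm g"
    using pi4 by (intro mult_right_mono) auto
  ultimately show ?thesis by simp
qed

section \<open>Integration by parts for primitives of square integrable functions\<close>

text \<open>As g is merely square integrable, f \<phi> need not be differentiable everywhere. The
  difference B of f \<phi> and the integral of its formal derivative has increments bounded by (t -
  s) times the increment of the integral A of |g|. Since A is continuous, B has derivative zero at
  every point and is constant.\<close>

lemma integral_by_parts_primitive:
  assumes g: "g \<in> L2" and f: "\<And>t. t \<in> {0..pi} \<Longrightarrow> f t = f 0 + integral {0..t} g"
    and \<phi>: "\<And>t. (\<phi> has_real_derivative \<phi>' t) (at t)" and \<phi>': "continuous_on UNIV \<phi>'"
  shows "l2_inner g \<phi> = f pi * \<phi> pi - f 0 * \<phi> 0 - l2_inner f \<phi>'"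
proof -
  have cf: "continuous_on {0..pi} f" by (rule primitive_continuous[OF g f])
  have c\<phi>: "continuous_on {0..pi} \<phi>"
    by (intro DERIV_continuous_on[where D = \<phi>'] has_field_derivative_at_within[OF \<phi>])
  have c\<phi>': "continuous_on {0..pi} \<phi>'" by (rule continuous_on_subset[OF \<phi>']) simp
  note L2s = continuous_on_imp_L2[OF cf] continuous_on_imp_L2[OF c\<phi>] continuous_on_imp_L2[OF c\<phi>']
  have int1: "(\<lambda>s. f s * \<phi>' s) integrable_on {0..pi}" "(\<lambda>s. g s * \<phi> s) integrable_on {0..pi}"
    by (intro integrable_on_lebesgue_on L2_mult_integrable L2s g; simp)+
  define h where "h s = f s * \<phi>' s + g s * \<phi> s" for s
  have h: "h integrable_on {0..pi}"
    unfolding h_def by (intro integrable_add int1)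
  define A where "A t = integral {0..t} (\<lambda>s. \<bar>g s\<bar>)" for t
  define B where "B t = f t * \<phi> t - integral {0..t} h" for t
  obtain C where C: "C > 0" "\<And>t. t \<in> {0..pi} \<Longrightarrow> \<bar>\<phi>' t\<bar> \<le> C"
    using compact_imp_bounded[OF compact_continuous_image[OF c\<phi>' compact_Icc]]
    unfolding bounded_pos by auto
  have lip: "\<bar>\<phi> t - \<phi> s\<bar> \<le> C * \<bar>t - s\<bar>" if "s \<in> {0..pi}" "t \<in> {0..pi}" for s t
    using field_differentiable_bound[of "{0..pi}" \<phi> \<phi>' C t s] that C
      has_field_derivative_at_within[OF \<phi>] by auto
  have step: "\<bar>B t - B s\<bar> \<le> 2 * C * (t - s) * (A t - A s)"
    if st: "0 \<le> s" "s \<le> t" "t \<le> pi" for s t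
  proof -
    have sub: "{s..t} \<subseteq> {0..pi}" using st by auto
    have A: "A t - A s = integral {s..t} (\<lambda>s. \<bar>g s\<bar>)"
      using primitive_diff[OF L2_abs[OF g], of A, OF _ st] by (simp add: A_def)
    have A_int: "(\<lambda>s. \<bar>g s\<bar>) integrable_on {s..t}"
      by (rule L2_integrable_on_Icc[OF L2_abs[OF g] st(1,3)])
    have gi: "g integrable_on {s..t}" by (rule L2_integrable_on_Icc[OF g st(1,3)])
    have hi: "h integrable_on {s..t}" by (rule integrable_on_subinterval[OF h sub])
    have \<phi>i: "(\<phi>' has_integral (\<phi> t - \<phi> s)) {s..t}"
      using st \<phi> by (intro fundamental_theorem_of_calculus)
        (auto simp: has_real_derivative_iff_has_vector_derivative[symmetric]
          intro: has_field_derivative_at_within)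
    have "integral {0..s} h + integral {s..t} h = integral {0..t} h"
      using st integrable_on_subinterval[OF h, of 0 t]
      by (intro Henstock_Kurzweil_Integration.integral_combine) auto
    then have "B t - B s = \<phi> t * (f t - f s) + f s * (\<phi> t - \<phi> s) - integral {s..t} h"
      by (simp add: B_def algebra_simps)
    also have "\<dots> = integral {s..t} (\<lambda>r. \<phi> t * g r + f s * \<phi>' r - h r)"
    proof (rule integral_unique[symmetric], intro has_integral_diff has_integral_add
        has_integral_mult_right)
      show "(g has_integral f t - f s) {s..t}"
        using primitive_diff[OF g f st] gi by (simp add: has_integral_integral)
      show "(h has_integral integral {s..t} h) {s..t}" using hi by blast
    qed (rule \<phi>i)
    finally have eq: "B t - B s = integral {s..t} (\<lambda>r. \<phi> t * g r + f s * \<phi>' r - h r)" .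
    have "norm (integral {s..t} (\<lambda>r. \<phi> t * g r + f s * \<phi>' r - h r))
        \<le> integral {s..t} (\<lambda>r. C * (t - s) * \<bar>g r\<bar> + C * (A t - A s))"
    proof (rule integral_norm_bound_integral)
      show "(\<lambda>r. \<phi> t * g r + f s * \<phi>' r - h r) integrable_on {s..t}"
        using gi hi \<phi>i by (intro integrable_diff integrable_add integrable_on_mult_right) auto
      show "(\<lambda>r. C * (t - s) * \<bar>g r\<bar> + C * (A t - A s)) integrable_on {s..t}"
        using A_int by (intro integrable_add integrable_on_mult_right) auto
      fix r assume r: "r \<in> {s..t}"
      \<comment> \<open>Each product pairs the derivative of one factor with an increment of the
        other, so integration over [s, t] gives the length of the interval times an increment of
        A.\<close>
      have "\<phi> t * g r + f s * \<phi>' r - h r = g r * (\<phi> t - \<phi> r) - \<phi>' r * (f r - f s)"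
        by (simp add: h_def algebra_simps)
      then have "\<bar>\<phi> t * g r + f s * \<phi>' r - h r\<bar>
          \<le> \<bar>g r\<bar> * \<bar>\<phi> t - \<phi> r\<bar> + \<bar>\<phi>' r\<bar> * \<bar>f r - f s\<bar>"
        by (metis abs_mult abs_triangle_ineq4)
      also have "\<dots> \<le> \<bar>g r\<bar> * (C * (t - s)) + C * (A t - A s)"
      proof (intro add_mono mult_mono mult_left_mono)
        have "C * \<bar>t - r\<bar> \<le> C * (t - s)" using r C(1) by (intro mult_left_mono) auto
        then show "\<bar>\<phi> t - \<phi> r\<bar> \<le> C * (t - s)" using lip[of r t] r st by auto
        have "\<bar>f r - f s\<bar> \<le> integral {s..r} (\<lambda>t. \<bar>g t\<bar>)"
          using r st by (intro primitive_diff_le[OF g f]) auto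
        also have "\<dots> \<le> integral {s..t} (\<lambda>t. \<bar>g t\<bar>)"
          using r st L2_integrable_on_Icc[OF L2_abs[OF g]] by (intro integral_subset_le) auto
        finally show "\<bar>f r - f s\<bar> \<le> A t - A s" by (simp add: A)
        show "\<bar>\<phi>' r\<bar> \<le> C" using C(2)[of r] r st by auto
      qed (use C in auto)
      finally show "norm (\<phi> t * g r + f s * \<phi>' r - h r) \<le> C * (t - s) * \<bar>g r\<bar> + C * (A t - A s)"
        by (simp add: mult_ac)
    qed
    also have "\<dots> = C * (t - s) * (A t - A s) + C * (A t - A s) * (t - s)"
      using A_int st A
      by (subst Henstock_Kurzweil_Integration.integral_add)
        (auto intro!: integrable_on_mult_right)
    finally show ?thesis by (simp add: eq algebra_simps)
  qed
  have step': "\<bar>B t - B s\<bar> \<le> 2 * C * \<bar>t - s\<bar> * \<bar>A t - A s\<bar>"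
    if "s \<in> {0..pi}" "t \<in> {0..pi}" for s t
  proof -
    have *: "2 * C * (t - s) * (A t - A s) \<le> 2 * C * \<bar>t - s\<bar> * \<bar>A t - A s\<bar>"
      if "s \<le> t" for s t
    proof -
      have "2 * C * (t - s) * (A t - A s) \<le> 2 * C * (t - s) * \<bar>A t - A s\<bar>"
        using that C(1) by (intro mult_left_mono) auto
      then show ?thesis using that by simp
    qed
    show ?thesis
    proof (cases "s \<le> t")
      case True
      then show ?thesis using step[of s t] *[of s t] that by auto
    next
      case False
      then show ?thesis using step[of t s] *[of t s] that
        by (auto simp: abs_minus_commute)
    qed
  qed
  have cA: "continuous_on {0..pi} A"
    unfolding A_def by (intro indefinite_integral_continuous_1 L2_integrable_on L2_abs g)
  have "(B has_derivative (\<lambda>h. 0)) (at t within {0..pi})" if t: "t \<in> {0..pi}" for t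
    unfolding has_derivative_within_alt
  proof (intro conjI allI impI)
    fix e :: real assume e: "0 < e"
    then have "0 < e / (2 * C)" using C by simp
    with cA t obtain d where d: "d > 0"
      "\<And>s. s \<in> {0..pi} \<Longrightarrow> dist s t < d \<Longrightarrow> dist (A s) (A t) < e / (2 * C)"
      unfolding continuous_on_iff by blast
    show "\<exists>d>0. \<forall>s\<in>{0..pi}. norm (s - t) < d \<longrightarrow> norm (B s - B t - 0) \<le> e * norm (s - t)"
    proof (intro exI[of _ d] conjI ballI impI)
      fix s assume s: "s \<in> {0..pi}" "norm (s - t) < d"
      have "\<bar>B s - B t\<bar> \<le> 2 * C * \<bar>s - t\<bar> * \<bar>A s - A t\<bar>" by (rule step'[OF t s(1)])
      also have "\<dots> \<le> 2 * C * \<bar>s - t\<bar> * (e / (2 * C))"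
        using d(2)[OF s(1)] s C by (intro mult_left_mono) (auto simp: dist_norm)
      finally show "norm (B s - B t - 0) \<le> e * norm (s - t)" using C by (simp add: mult.commute)
    qed (rule d)
  qed simp
  then obtain c where "\<And>t. t \<in> {0..pi} \<Longrightarrow> B t = c"
    using has_derivative_zero_constant[of "{0..pi}" B] by auto
  then have "B pi = B 0" by simp
  then have "integral {0..pi} h = f pi * \<phi> pi - f 0 * \<phi> 0" by (simp add: B_def)
  moreover have "integral {0..pi} h = l2_inner f \<phi>' + l2_inner g \<phi>"
    unfolding h_def l2_inner_def using int1
    by (simp add: Henstock_Kurzweil_Integration.integral_add
        lebesgue_integral_eq_integral[OF L2_mult_integrable] L2s g)
  ultimately show ?thesis by simp
qed


section \<open>The Sobolev space on the circle\<close>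

lemma inner_h2_l2:
  "inner u v = l2_inner (h2_fun u) (h2_fun v) + l2_inner (h2_D 1 u) (h2_D 1 v)
    + l2_inner (h2_D 2 u) (h2_D 2 v)"
proof -
  have set: "{..2::nat} = {0, 1, 2}" by auto
  show ?thesis unfolding inner_h2_def l2_inner_def set
    by (subst sum.insert, simp, simp)+ (simp only: sum.empty h2_D_0 add_0_right add.assoc)
qed

lemma l2_norm_h2_D_le:
  "l2_norm (h2_fun u) \<le> norm u" "l2_norm (h2_D 1 u) \<le> norm u" "l2_norm (h2_D 2 u) \<le> norm u"
  unfolding l2_norm_def norm_h2_def inner_h2_l2
  using l2_inner_self_nonneg[of "h2_fun u"] l2_inner_self_nonneg[of "h2_D 1 u"]
    l2_inner_self_nonneg[of "h2_D 2 u"]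
  by (intro real_sqrt_le_mono; linarith)+

lemma h2_fun_L2: "h2_fun u \<in> L2"
  using h2_D_L2[of 0 u] by simp

lemma h2_fun_continuous: "continuous_on {0..pi} (h2_fun u)"
  by (rule H2_derivsD(4)[OF h2_derivs])

lemma h2_fun_primitive: "t \<in> {0..pi} \<Longrightarrow> h2_fun u t = h2_fun u 0 + integral {0..t} (h2_D 1 u)"
  by (rule H2_derivsD(7)[OF h2_derivs])

lemma h2_D1_primitive: "t \<in> {0..pi} \<Longrightarrow> h2_D 1 u t = h2_D 1 u 0 + integral {0..t} (h2_D 2 u)"
  by (rule H2_derivsD(8)[OF h2_derivs])

text \<open>The embedding of H^2 into C^1. Its constant 3 reappears in the cubic estimates and, as
  the tolerance 1/3, in the count of zeros.\<close>

lemma h2_sup_bound: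
  assumes "t \<in> {0..pi}"
  shows "\<bar>h2_fun u t\<bar> \<le> 3 * norm u" "\<bar>h2_D 1 u t\<bar> \<le> 3 * norm u"
proof -
  have "\<bar>h2_fun u t\<bar> \<le> l2_norm (h2_fun u) + 2 * l2_norm (h2_D 1 u)"
    by (rule primitive_sup_bound[OF h2_D_L2 h2_fun_primitive assms]) auto
  then show "\<bar>h2_fun u t\<bar> \<le> 3 * norm u"
    using l2_norm_h2_D_le[of u] by linarith
  have "\<bar>h2_D 1 u t\<bar> \<le> l2_norm (h2_D 1 u) + 2 * l2_norm (h2_D 2 u)"
    by (rule primitive_sup_bound[OF h2_D_L2 h2_D1_primitive assms]) auto
  then show "\<bar>h2_D 1 u t\<bar> \<le> 3 * norm u"
    using l2_norm_h2_D_le[of u] by linarith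
qed

lemma primitive_has_derivative:
  assumes "continuous_on {0..pi} g" "\<And>t. t \<in> {0..pi} \<Longrightarrow> f t = f 0 + integral {0..t} g"
    "t \<in> {0..pi}"
  shows "(f has_real_derivative g t) (at t within {0..pi})"
proof -
  have "((\<lambda>t. f 0 + integral {0..t} g) has_vector_derivative g t) (at t within {0..pi})"
    using has_vector_derivative_add[OF has_vector_derivative_const
        integral_has_vector_derivative[OF assms(1,3)], of "f 0"] by simp
  then have "(f has_vector_derivative g t) (at t within {0..pi})"
    using has_vector_derivative_transform[OF assms(3), of f "\<lambda>t. f 0 + integral {0..t} g"] assms(2)
    by blast
  then show ?thesis by (simp only: has_real_derivative_iff_has_vector_derivative)
qed

lemma h2_fun_has_derivative:
  "t \<in> {0..pi} \<Longrightarrow> (h2_fun u has_real_derivative h2_D 1 u t) (at t within {0..pi})"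
  by (rule primitive_has_derivative[OF H2_derivsD(5)[OF h2_derivs] h2_fun_primitive])

lemma h2_fun_0_pi: "h2_fun u 0 = h2_fun u pi"
  using h2_fun_periodic[of u 0] by simp

lemma phi_deriv:
  "(phi_cos k has_real_derivative - (2 * real k) * phi_sin k t) (at t)"
  "(phi_sin k has_real_derivative 2 * real k * phi_cos k t) (at t)"
  unfolding phi_cos_def[abs_def] phi_sin_def[abs_def]
  by (auto intro!: derivative_eq_intros)

lemma phi_continuous: "continuous_on S (phi_cos k)" "continuous_on S (phi_sin k)"
  unfolding phi_cos_def[abs_def] phi_sin_def[abs_def] by (auto intro!: continuous_intros)

lemma phi_L2: "phi_cos k \<in> L2" "phi_sin k \<in> L2"
  by (intro continuous_on_imp_L2 phi_continuous)+

lemma phi_0_pi: "phi_cos k pi = phi_cos k 0" "phi_sin k pi = 0" "phi_sin k 0 = 0"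
proof -
  have "cos (2 * real k * pi) = 1" "sin (2 * real k * pi) = 0"
    using cos_2npi[of k] sin_2npi[of k] by (simp_all add: mult_ac)
  then show "phi_cos k pi = phi_cos k 0" "phi_sin k pi = 0" "phi_sin k 0 = 0"
    by (simp_all add: phi_cos_def phi_sin_def)
qed

lemma l2_inner_D1_phi:
  "l2_inner (h2_D 1 u) (phi_cos k) = 2 * real k * l2_inner (h2_fun u) (phi_sin k)"
  "l2_inner (h2_D 1 u) (phi_sin k) = - (2 * real k) * l2_inner (h2_fun u) (phi_cos k)"
proof -
  have "l2_inner (h2_D 1 u) (phi_cos k) = h2_fun u pi * phi_cos k pi - h2_fun u 0 * phi_cos k 0
      - l2_inner (h2_fun u) (\<lambda>t. - (2 * real k) * phi_sin k t)"
    by (rule integral_by_parts_primitive[OF h2_D_L2 h2_fun_primitive phi_deriv(1)])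
      (auto intro!: continuous_intros phi_continuous)
  then show "l2_inner (h2_D 1 u) (phi_cos k) = 2 * real k * l2_inner (h2_fun u) (phi_sin k)"
    using l2_inner_scale[of "- (2 * real k)" "phi_sin k" "h2_fun u"]
    by (simp add: l2_inner_commute[of "h2_fun u"] h2_fun_0_pi phi_0_pi)
  have "l2_inner (h2_D 1 u) (phi_sin k) = h2_fun u pi * phi_sin k pi - h2_fun u 0 * phi_sin k 0
      - l2_inner (h2_fun u) (\<lambda>t. 2 * real k * phi_cos k t)"
    by (rule integral_by_parts_primitive[OF h2_D_L2 h2_fun_primitive phi_deriv(2)])
      (auto intro!: continuous_intros phi_continuous)
  then show "l2_inner (h2_D 1 u) (phi_sin k) = - (2 * real k) * l2_inner (h2_fun u) (phi_cos k)"
    using l2_inner_scale[of "2 * real k" "phi_cos k" "h2_fun u"]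
    by (simp add: l2_inner_commute[of "h2_fun u"] phi_0_pi)
qed

text \<open>Two integrations by parts, whose boundary terms vanish because u and u' are periodic.
  Consequently u'' + \<sigma> u is orthogonal to the kernel for every u.\<close>

lemma l2_inner_D2_phi:
  "l2_inner (h2_D 2 u) (phi_cos k) = - sigma k * l2_inner (h2_fun u) (phi_cos k)"
  "l2_inner (h2_D 2 u) (phi_sin k) = - sigma k * l2_inner (h2_fun u) (phi_sin k)"
proof -
  have "l2_inner (h2_D 2 u) (phi_cos k) = h2_D 1 u pi * phi_cos k pi - h2_D 1 u 0 * phi_cos k 0
      - l2_inner (h2_D 1 u) (\<lambda>t. - (2 * real k) * phi_sin k t)"
    by (rule integral_by_parts_primitive[OF h2_D_L2 h2_D1_primitive phi_deriv(1)])
      (auto intro!: continuous_intros phi_continuous)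
  then show "l2_inner (h2_D 2 u) (phi_cos k) = - sigma k * l2_inner (h2_fun u) (phi_cos k)"
    using l2_inner_scale[of "- (2 * real k)" "phi_sin k" "h2_D 1 u"] l2_inner_D1_phi(2)[of u k]
    by (simp add: l2_inner_commute[of "h2_D 1 u"] h2_D_boundary phi_0_pi sigma_def power2_eq_square
        del: One_nat_def)
  have "l2_inner (h2_D 2 u) (phi_sin k) = h2_D 1 u pi * phi_sin k pi - h2_D 1 u 0 * phi_sin k 0
      - l2_inner (h2_D 1 u) (\<lambda>t. 2 * real k * phi_cos k t)"
    by (rule integral_by_parts_primitive[OF h2_D_L2 h2_D1_primitive phi_deriv(2)])
      (auto intro!: continuous_intros phi_continuous)
  then show "l2_inner (h2_D 2 u) (phi_sin k) = - sigma k * l2_inner (h2_fun u) (phi_sin k)"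
    using l2_inner_scale[of "2 * real k" "phi_cos k" "h2_D 1 u"] l2_inner_D1_phi(1)[of u k]
    by (simp add: l2_inner_commute[of "h2_D 1 u"] phi_0_pi sigma_def power2_eq_square
        del: One_nat_def)
qed

lemma h2_fun_Abs_phi: "h2_fun (Abs_h2 (phi_cos k)) = phi_cos k" "h2_fun (Abs_h2 (phi_sin k)) = phi_sin k"
  by (simp_all add: Abs_h2_inverse phi_in_H2_periodic)

lemma h2_D_Abs_phi:
  "AE t in dom_measure. h2_D 1 (Abs_h2 (phi_cos k)) t = - (2 * real k) * phi_sin k t"
  "AE t in dom_measure. h2_D 2 (Abs_h2 (phi_cos k)) t = - sigma k * phi_cos k t"
  "AE t in dom_measure. h2_D 1 (Abs_h2 (phi_sin k)) t = 2 * real k * phi_cos k t"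
  "AE t in dom_measure. h2_D 2 (Abs_h2 (phi_sin k)) t = - sigma k * phi_sin k t"
proof -
  have per: "phi_cos k (t + pi) = phi_cos k t" "phi_sin k (t + pi) = phi_sin k t" for t
    using h2_fun_periodic[of "Abs_h2 (phi_cos k)" t] h2_fun_periodic[of "Abs_h2 (phi_sin k)" t]
    by (simp_all add: h2_fun_Abs_phi)
  have c: "H2_derivs (phi_cos k) (\<lambda>\<alpha>. if \<alpha> = 0 then phi_cos k else
      if \<alpha> = 1 then (\<lambda>t. - (2 * real k) * phi_sin k t) else (\<lambda>t. - sigma k * phi_cos k t))"
    by (rule C2_imp_H2_periodic(2))
      (auto intro!: derivative_eq_intros DERIV_cong[OF phi_deriv(1)] DERIV_cong[OF phi_deriv(2)]
        continuous_intros phi_continuous simp: per phi_0_pi sigma_def power2_eq_square)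
  have s: "H2_derivs (phi_sin k) (\<lambda>\<alpha>. if \<alpha> = 0 then phi_sin k else
      if \<alpha> = 1 then (\<lambda>t. 2 * real k * phi_cos k t) else (\<lambda>t. - sigma k * phi_sin k t))"
    by (rule C2_imp_H2_periodic(2))
      (auto intro!: derivative_eq_intros DERIV_cong[OF phi_deriv(1)] DERIV_cong[OF phi_deriv(2)]
        continuous_intros phi_continuous simp: per phi_0_pi sigma_def power2_eq_square)
  show "AE t in dom_measure. h2_D 1 (Abs_h2 (phi_cos k)) t = - (2 * real k) * phi_sin k t"
    using h2_D_AE_eq[of "Abs_h2 (phi_cos k)", unfolded h2_fun_Abs_phi, OF c, of 1] by simp
  show "AE t in dom_measure. h2_D 2 (Abs_h2 (phi_cos k)) t = - sigma k * phi_cos k t"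
    using h2_D_AE_eq[of "Abs_h2 (phi_cos k)", unfolded h2_fun_Abs_phi, OF c, of 2] by simp
  show "AE t in dom_measure. h2_D 1 (Abs_h2 (phi_sin k)) t = 2 * real k * phi_cos k t"
    using h2_D_AE_eq[of "Abs_h2 (phi_sin k)", unfolded h2_fun_Abs_phi, OF s, of 1] by simp
  show "AE t in dom_measure. h2_D 2 (Abs_h2 (phi_sin k)) t = - sigma k * phi_sin k t"
    using h2_D_AE_eq[of "Abs_h2 (phi_sin k)", unfolded h2_fun_Abs_phi, OF s, of 2] by simp
qed

text \<open>The derivatives of orders 0, 1, 2 contribute the factors 1, \<sigma> and \<sigma>^2. The
  total is a positive constant, so orthogonality to the kernel means the same in H^2 and in
  L^2.\<close>

lemma inner_h2_phi:
  "inner (Abs_h2 (phi_cos k)) u = (1 + sigma k + (sigma k)\<^sup>2) * l2_inner (h2_fun u) (phi_cos k)"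
  "inner (Abs_h2 (phi_sin k)) u = (1 + sigma k + (sigma k)\<^sup>2) * l2_inner (h2_fun u) (phi_sin k)"
proof -
  have L2s: "(\<lambda>t. c * phi_cos k t) \<in> L2" "(\<lambda>t. c * phi_sin k t) \<in> L2" for c
    by (intro L2_scale phi_L2)+
  have eqs: "l2_inner (h2_D 1 (Abs_h2 (phi_cos k))) (h2_D 1 u) = - (2 * real k) * l2_inner (phi_sin k) (h2_D 1 u)"
    "l2_inner (h2_D 2 (Abs_h2 (phi_cos k))) (h2_D 2 u) = - sigma k * l2_inner (phi_cos k) (h2_D 2 u)"
    "l2_inner (h2_D 1 (Abs_h2 (phi_sin k))) (h2_D 1 u) = 2 * real k * l2_inner (phi_cos k) (h2_D 1 u)"
    "l2_inner (h2_D 2 (Abs_h2 (phi_sin k))) (h2_D 2 u) = - sigma k * l2_inner (phi_sin k) (h2_D 2 u)"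
    unfolding l2_inner_scale[symmetric]
    by (intro l2_inner_cong_AE h2_D_Abs_phi h2_D_L2 L2s; simp)+
  show "inner (Abs_h2 (phi_cos k)) u = (1 + sigma k + (sigma k)\<^sup>2) * l2_inner (h2_fun u) (phi_cos k)"
    unfolding inner_h2_l2 eqs h2_fun_Abs_phi
    using l2_inner_D1_phi(2)[of u k] l2_inner_D2_phi(1)[of u k]
    by (simp add: l2_inner_commute[of _ "h2_D _ u"] l2_inner_commute[of _ "h2_fun u"]
        sigma_def algebra_simps power2_eq_square)
  show "inner (Abs_h2 (phi_sin k)) u = (1 + sigma k + (sigma k)\<^sup>2) * l2_inner (h2_fun u) (phi_sin k)"
    unfolding inner_h2_l2 eqs h2_fun_Abs_phi
    using l2_inner_D1_phi(1)[of u k] l2_inner_D2_phi(2)[of u k]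
    by (simp add: l2_inner_commute[of _ "h2_D _ u"] l2_inner_commute[of _ "h2_fun u"]
        sigma_def algebra_simps power2_eq_square)
qed

lemma sigma_nonneg: "0 \<le> sigma k"
  by (simp add: sigma_def)

lemma orthogonal_comp_ker_iff:
  "u \<in> orthogonal_comp (ker k) \<longleftrightarrow>
     l2_inner (h2_fun u) (phi_cos k) = 0 \<and> l2_inner (h2_fun u) (phi_sin k) = 0"
proof -
  have pos: "1 + sigma k + (sigma k)\<^sup>2 \<noteq> 0"
    using sigma_nonneg[of k] zero_le_power2[of "sigma k"] by linarith
  have "u \<in> orthogonal_comp (ker k) \<longleftrightarrow>
      inner (Abs_h2 (phi_cos k)) u = 0 \<and> inner (Abs_h2 (phi_sin k)) u = 0"
  proof
    assume "u \<in> orthogonal_comp (ker k)"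
    then show "inner (Abs_h2 (phi_cos k)) u = 0 \<and> inner (Abs_h2 (phi_sin k)) u = 0"
      unfolding orthogonal_comp_def ker_def orthogonal_def by (auto intro: span_base)
  next
    assume *: "inner (Abs_h2 (phi_cos k)) u = 0 \<and> inner (Abs_h2 (phi_sin k)) u = 0"
    have "inner x u = 0" if "x \<in> ker k" for x
      using that unfolding ker_def
      by (induction rule: span_induct_alt)
        (use * in \<open>auto simp only: inner_add_left inner_scaleR_left inner_zero_left insert_iff empty_iff\<close>)
    then show "u \<in> orthogonal_comp (ker k)"
      unfolding orthogonal_comp_def orthogonal_def by blast
  qed
  then show ?thesis using pos by (simp add: inner_h2_phi)
qed

lemma l2_inner_eq_integral: "f \<in> L2 \<Longrightarrow> g \<in> L2 \<Longrightarrow> l2_inner f g = integral {0..pi} (\<lambda>t. f t * g t)"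
  unfolding l2_inner_def by (rule lebesgue_integral_eq_integral) (auto intro: L2_mult_integrable)

lemma phi_orthonormal:
  assumes "k \<ge> 1"
  shows "l2_inner (phi_cos k) (phi_cos k) = 1" "l2_inner (phi_sin k) (phi_sin k) = 1"
    "l2_inner (phi_cos k) (phi_sin k) = 0" "l2_inner (phi_sin k) (phi_cos k) = 0"
proof -
  define m where "m = 2 * real k"
  have m: "m > 0" using assms by (simp add: m_def)
  have per: "cos (m * pi) = 1" "sin (m * pi) = 0"
    using cos_2npi[of k] sin_2npi[of k] by (simp_all add: mult_ac m_def)
  have sq: "sqrt (2 / pi) * (sqrt (2 / pi) * x) = 2 / pi * x" for x
    by (simp flip: mult.assoc)
  have pyth: "sin x * sin x = 1 - cos x * cos x" for x :: real
    using sin_cos_squared_add[of x] by (simp add: power2_eq_square)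
  have phi: "phi_cos k t * phi_cos k t = 2 / pi * (cos (m * t) * cos (m * t))"
    "phi_sin k t * phi_sin k t = 2 / pi * (sin (m * t) * sin (m * t))"
    "phi_cos k t * phi_sin k t = 2 / pi * (cos (m * t) * sin (m * t))" for t
    by (simp_all add: phi_cos_def phi_sin_def m_def mult_ac sq)
  have FTC: "integral {0..pi} f = F pi - F 0"
    if "\<And>t. (F has_real_derivative f t) (at t)" for f F :: "real \<Rightarrow> real"
    by (intro integral_unique fundamental_theorem_of_calculus)
      (use that in \<open>auto simp: has_real_derivative_iff_has_vector_derivative[symmetric]
        intro: has_field_derivative_at_within\<close>)
  have d1: "((\<lambda>t. (t + sin (m * t) * cos (m * t) / m) / pi) has_real_derivative
      phi_cos k t * phi_cos k t) (at t)" for t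
  proof -
    have "((\<lambda>t. (t + sin (m * t) * cos (m * t) / m) / pi) has_real_derivative
        (1 + (cos (m * t) * m * cos (m * t) - sin (m * t) * (sin (m * t) * m)) / m) / pi) (at t)"
      using m by (auto intro!: derivative_eq_intros)
    also have "(cos (m * t) * m * cos (m * t) - sin (m * t) * (sin (m * t) * m)) / m
        = cos (m * t) * cos (m * t) - sin (m * t) * sin (m * t)"
      using m by (simp add: field_simps)
    finally show ?thesis by (simp add: phi pyth)
  qed
  have d2: "((\<lambda>t. (t - sin (m * t) * cos (m * t) / m) / pi) has_real_derivative
      phi_sin k t * phi_sin k t) (at t)" for t
  proof -
    have "((\<lambda>t. (t - sin (m * t) * cos (m * t) / m) / pi) has_real_derivative
        (1 - (cos (m * t) * m * cos (m * t) - sin (m * t) * (sin (m * t) * m)) / m) / pi) (at t)"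
      using m by (auto intro!: derivative_eq_intros)
    also have "(cos (m * t) * m * cos (m * t) - sin (m * t) * (sin (m * t) * m)) / m
        = cos (m * t) * cos (m * t) - sin (m * t) * sin (m * t)"
      using m by (simp add: field_simps)
    finally show ?thesis by (simp add: phi pyth)
  qed
  have d3: "((\<lambda>t. sin (m * t) * sin (m * t) / (m * pi)) has_real_derivative
      phi_cos k t * phi_sin k t) (at t)" for t
  proof -
    have "((\<lambda>t. sin (m * t) * sin (m * t) / (m * pi)) has_real_derivative
        (cos (m * t) * m * sin (m * t) + sin (m * t) * (cos (m * t) * m)) / (m * pi)) (at t)"
      using m by (auto intro!: derivative_eq_intros simp: algebra_simps)
    also have "(cos (m * t) * m * sin (m * t) + sin (m * t) * (cos (m * t) * m)) / (m * pi)
        = phi_cos k t * phi_sin k t"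
      using m by (simp add: phi field_simps)
    finally show ?thesis .
  qed
  show "l2_inner (phi_cos k) (phi_cos k) = 1"
    using FTC[OF d1] by (simp add: l2_inner_eq_integral[OF phi_L2(1) phi_L2(1)] per)
  show "l2_inner (phi_sin k) (phi_sin k) = 1"
    using FTC[OF d2] by (simp add: l2_inner_eq_integral[OF phi_L2(2) phi_L2(2)] per)
  show "l2_inner (phi_cos k) (phi_sin k) = 0"
    using FTC[OF d3] by (simp add: l2_inner_eq_integral[OF phi_L2(1) phi_L2(2)] per)
  then show "l2_inner (phi_sin k) (phi_cos k) = 0" by (simp add: l2_inner_commute)
qed


section \<open>The cubic form and the Lyapunov--Schmidt splitting\<close>

lemma weight_bounds: "0 \<le> weight t" "weight t \<le> 1" "\<bar>weight t\<bar> \<le> 1"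
  by (simp_all add: weight_def indicator_def)

lemma weight_mult_L2:
  assumes "f \<in> L2"
  shows "(\<lambda>t. weight t * f t) \<in> L2"
proof -
  have m: "(\<lambda>t. weight t * f t) \<in> borel_measurable dom_measure"
  proof -
    have "weight \<in> borel_measurable dom_measure"
      unfolding weight_def
      by (intro borel_measurable_indicator) (auto simp: sets_restrict_space)
    then show ?thesis using assms by (auto simp: L2_def)
  qed
  have "integrable dom_measure (\<lambda>t. (weight t * f t)\<^sup>2)"
  proof (rule Bochner_Integration.integrable_bound)
    show "integrable dom_measure (\<lambda>t. (f t)\<^sup>2)" using assms by (simp add: L2_def)
    have "(weight t * f t)\<^sup>2 \<le> (f t)\<^sup>2" for t
      by (simp add: weight_def indicator_def)
    then show "AE t in dom_measure. norm ((weight t * f t)\<^sup>2) \<le> norm ((f t)\<^sup>2)" by simp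
  qed (use m in simp)
  then show ?thesis using m by (simp add: L2_def)
qed

lemma l2_norm_le_sup:
  assumes f: "f \<in> L2" and M: "\<And>t. t \<in> {0..pi} \<Longrightarrow> \<bar>f t\<bar> \<le> M"
  shows "l2_norm f \<le> 2 * M"
proof -
  have M0: "0 \<le> M" using M[of 0] by simp
  have "l2_inner f f \<le> (LINT t|dom_measure. M * M)"
    unfolding l2_inner_def
  proof (rule integral_mono)
    show "f t * f t \<le> M * M" if "t \<in> space dom_measure" for t
      using M[of t] that M0 abs_le_square_iff[of "f t" M] by (simp add: power2_eq_square)
  qed (use L2_mult_integrable[OF f f] L2_mult_integrable[OF L2_const L2_const] in auto)
  also have "\<dots> = pi * M\<^sup>2" by (simp add: measure_restrict_space power2_eq_square)
  also have "\<dots> \<le> 4 * M\<^sup>2" using pi_less_4 by (intro mult_right_mono) auto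
  finally have "l2_norm f \<le> sqrt ((2 * M)\<^sup>2)"
    unfolding l2_norm_def by (intro real_sqrt_le_mono) (simp add: power_mult_distrib)
  then have "l2_norm f \<le> \<bar>2 * M\<bar>" by (simp only: real_sqrt_abs)
  then show ?thesis using M0 by simp
qed

text \<open>The polarised cubic nonlinearity tested against \<phi>. With three separate slots,
  differences and derivatives of the cubic follow from multilinearity and one bound.\<close>

definition trilin :: "(real \<Rightarrow> real) \<Rightarrow> h2 \<Rightarrow> h2 \<Rightarrow> h2 \<Rightarrow> real" where
  "trilin \<phi> u v w = l2_inner (\<lambda>t. weight t * (h2_fun u t * h2_fun v t * h2_fun w t)) \<phi>"

lemma trilin_L2: "(\<lambda>t. weight t * (h2_fun u t * h2_fun v t * h2_fun w t)) \<in> L2"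
  by (intro weight_mult_L2 continuous_on_imp_L2 continuous_intros h2_fun_continuous)

lemma trilin_sym: "trilin \<phi> u v w = trilin \<phi> v u w" "trilin \<phi> u v w = trilin \<phi> u w v"
  by (simp_all add: trilin_def mult_ac)

lemma trilin_add: "\<phi> \<in> L2 \<Longrightarrow> trilin \<phi> (u + u') v w = trilin \<phi> u v w + trilin \<phi> u' v w"
  unfolding trilin_def
  using l2_inner_add[OF trilin_L2[of u v w] trilin_L2[of u' v w], of \<phi>]
  by (simp add: h2_fun_add algebra_simps)

lemma trilin_scale: "trilin \<phi> (c *\<^sub>R u) v w = c * trilin \<phi> u v w"
  unfolding trilin_def
  using l2_inner_scale[of c "\<lambda>t. weight t * (h2_fun u t * h2_fun v t * h2_fun w t)" \<phi>]
  by (simp add: h2_fun_scaleR mult_ac)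

text \<open>The constant is 2 * 3^3: three sup bounds from \<open>h2_sup_bound\<close>, and a factor
  2 from passing from the sup norm to the L^2 norm.\<close>

lemma trilin_bound:
  assumes "\<phi> \<in> L2"
  shows "\<bar>trilin \<phi> u v w\<bar> \<le> 54 * l2_norm \<phi> * (norm u * norm v * norm w)"
proof -
  have "l2_norm (\<lambda>t. weight t * (h2_fun u t * h2_fun v t * h2_fun w t))
      \<le> 2 * (27 * (norm u * norm v * norm w))"
  proof (rule l2_norm_le_sup[OF trilin_L2])
    fix t assume t: "t \<in> {0..pi}"
    have "\<bar>weight t * (h2_fun u t * h2_fun v t * h2_fun w t)\<bar>
        \<le> 1 * ((3 * norm u) * (3 * norm v) * (3 * norm w))"
      unfolding abs_mult by (intro mult_mono h2_sup_bound[OF t] weight_bounds) auto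
    then show "\<bar>weight t * (h2_fun u t * h2_fun v t * h2_fun w t)\<bar>
        \<le> 27 * (norm u * norm v * norm w)"
      by simp
  qed
  then have "l2_norm (\<lambda>t. weight t * (h2_fun u t * h2_fun v t * h2_fun w t)) * l2_norm \<phi>
      \<le> 2 * (27 * (norm u * norm v * norm w)) * l2_norm \<phi>"
    by (intro mult_right_mono) auto
  with l2_Cauchy_Schwarz[OF trilin_L2[of u v w] assms] show ?thesis
    unfolding trilin_def by (simp add: mult_ac)
qed

definition cubic :: "nat \<Rightarrow> h2 \<Rightarrow> h2 \<Rightarrow> h2 \<Rightarrow> real \<times> real" where
  "cubic k u v w = (trilin (phi_cos k) u v w, trilin (phi_sin k) u v w)"

lemma cubic_sym: "cubic k u v w = cubic k v u w" "cubic k u v w = cubic k u w v"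
  using trilin_sym(1)[of _ u v w] trilin_sym(2)[of _ u v w] unfolding cubic_def by metis+

lemma cubic_add: "cubic k (u + u') v w = cubic k u v w + cubic k u' v w"
    "cubic k u (v + v') w = cubic k u v w + cubic k u v' w"
    "cubic k u v (w + w') = cubic k u v w + cubic k u v w'"
proof -
  show 1: "cubic k (u + u') v w = cubic k u v w + cubic k u' v w" for u u' v w
    by (simp add: cubic_def trilin_add phi_L2)
  show 2: "cubic k u (v + v') w = cubic k u v w + cubic k u v' w" for u v v' w
    using 1[of v v' u w] by (simp only: cubic_sym(1)[of k u])
  show "cubic k u v (w + w') = cubic k u v w + cubic k u v w'"
    using 2[of u w w' v] by (simp only: cubic_sym(2)[of k u v])
qed

lemma cubic_scale: "cubic k (c *\<^sub>R u) v w = c *\<^sub>R cubic k u v w"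
    "cubic k u (c *\<^sub>R v) w = c *\<^sub>R cubic k u v w"
    "cubic k u v (c *\<^sub>R w) = c *\<^sub>R cubic k u v w"
proof -
  show 1: "cubic k (c *\<^sub>R u) v w = c *\<^sub>R cubic k u v w" for u v w
    by (simp add: cubic_def trilin_scale)
  show 2: "cubic k u (c *\<^sub>R v) w = c *\<^sub>R cubic k u v w" for u v w
    using 1[of v u w] by (simp only: cubic_sym(1)[of k u])
  show "cubic k u v (c *\<^sub>R w) = c *\<^sub>R cubic k u v w"
    using 2[of u w v] by (simp only: cubic_sym(2)[of k u v])
qed

lemma cubic_diff: "cubic k (u - u') v w = cubic k u v w - cubic k u' v w"
    "cubic k u (v - v') w = cubic k u v w - cubic k u v' w"
    "cubic k u v (w - w') = cubic k u v w - cubic k u v w'"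
  by (simp_all only: eq_diff_eq cubic_add[symmetric] diff_add_cancel)

lemma cubic_bound:
  assumes "k \<ge> 1"
  shows "norm (cubic k u v w) \<le> 108 * (norm u * norm v * norm w)"
proof -
  have one: "l2_norm (phi_cos k) = 1" "l2_norm (phi_sin k) = 1"
    using phi_orthonormal[OF assms] by (simp_all add: l2_norm_def)
  have "norm (cubic k u v w) \<le> \<bar>trilin (phi_cos k) u v w\<bar> + \<bar>trilin (phi_sin k) u v w\<bar>"
    unfolding cubic_def using norm_Pair_le[of "trilin (phi_cos k) u v w" "trilin (phi_sin k) u v w"] by simp
  also have "\<dots> \<le> 108 * (norm u * norm v * norm w)"
    using trilin_bound[OF phi_L2(1), of k u v w] trilin_bound[OF phi_L2(2), of k u v w] one by simp
  finally show ?thesis .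
qed

text \<open>The three slots are changed one at a time, each difference being controlled by
  \<open>cubic_bound\<close>.\<close>

lemma tendsto_cubic:
  assumes k: "k \<ge> 1" and u: "(u \<longlongrightarrow> u0) F" and v: "(v \<longlongrightarrow> v0) F" and w: "(w \<longlongrightarrow> w0) F"
  shows "((\<lambda>x. cubic k (u x) (v x) (w x)) \<longlongrightarrow> cubic k u0 v0 w0) F"
proof -
  have *: "((\<lambda>x. cubic k (f x) (g x) (h x)) \<longlongrightarrow> 0) F"
    if "((\<lambda>x. norm (f x) * norm (g x) * norm (h x)) \<longlongrightarrow> 0) F" for f g h
  proof (rule Lim_null_comparison)
    show "\<forall>\<^sub>F x in F. norm (cubic k (f x) (g x) (h x)) \<le> 108 * (norm (f x) * norm (g x) * norm (h x))"
      using cubic_bound[OF k] by simp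
    show "((\<lambda>x. 108 * (norm (f x) * norm (g x) * norm (h x))) \<longlongrightarrow> 0) F"
      using tendsto_mult_left[OF that, of 108] by simp
  qed
  have 1: "((\<lambda>x. norm (u x - u0) * norm (v x) * norm (w x)) \<longlongrightarrow> norm (u0 - u0) * norm v0 * norm w0) F"
    by (intro tendsto_intros u v w)
  have 2: "((\<lambda>x. norm u0 * norm (v x - v0) * norm (w x)) \<longlongrightarrow> norm u0 * norm (v0 - v0) * norm w0) F"
    by (intro tendsto_intros u v w)
  have 3: "((\<lambda>x. norm u0 * norm v0 * norm (w x - w0)) \<longlongrightarrow> norm u0 * norm v0 * norm (w0 - w0)) F"
    by (intro tendsto_intros u v w)
  have "((\<lambda>x. cubic k (u x - u0) (v x) (w x) + cubic k u0 (v x - v0) (w x) + cubic k u0 v0 (w x - w0)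
      + cubic k u0 v0 w0) \<longlongrightarrow> 0 + 0 + 0 + cubic k u0 v0 w0) F"
    by (intro tendsto_add * tendsto_const) (use 1 2 3 in auto)
  then show ?thesis by (simp add: cubic_diff)
qed

text \<open>By symmetry the linear part of the expansion around v is three equal terms, and the
  remainder 3 C(v, h, h) + C(h, h, h) is quadratic in h.\<close>

lemma has_derivative_cubic:
  assumes k: "k \<ge> 1"
  shows "((\<lambda>v. cubic k v v v) has_derivative (\<lambda>h. 3 *\<^sub>R cubic k v v h)) (at v)"
  unfolding has_derivative_at_alt
proof (intro conjI allI impI)
  show "bounded_linear (\<lambda>h. 3 *\<^sub>R cubic k v v h)"
  proof (rule bounded_linear_intro[of _ "324 * (norm v * norm v)"])
    show "norm (3 *\<^sub>R cubic k v v h) \<le> norm h * (324 * (norm v * norm v))" for h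
      using cubic_bound[OF k, of v v h] by (simp add: mult_ac)
  qed (simp_all add: cubic_add cubic_scale scaleR_add_right)
  fix e :: real assume e: "0 < e"
  \<comment> \<open>Here 324 = 3 * 108 bounds the term quadratic in h, and 108 the cubic one once
    |h| \<le> 1.\<close>
  define C where "C = 324 * norm v + 108"
  have C: "C > 0" by (simp add: C_def add_nonneg_pos)
  show "\<exists>d>0. \<forall>y. norm (y - v) < d \<longrightarrow>
      norm (cubic k y y y - cubic k v v v - 3 *\<^sub>R cubic k v v (y - v)) \<le> e * norm (y - v)"
  proof (intro exI[of _ "min 1 (e / C)"] conjI allI impI)
    show "0 < min 1 (e / C)" using e C by simp
    fix y assume y: "norm (y - v) < min 1 (e / C)"
    define h where "h = y - v"
    have yh: "y = v + h" by (simp add: h_def)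
    have h1: "norm h \<le> 1" and hC: "C * norm h \<le> e"
      using y C by (auto simp: h_def field_simps)
    have three: "3 *\<^sub>R x = x + x + x" for x :: "real \<times> real" by (simp add: prod_eq_iff)
    have s1: "cubic k v h v = cubic k v v h" "cubic k h v v = cubic k v v h"
      "cubic k h v h = cubic k v h h" "cubic k h h v = cubic k v h h"
      by (metis cubic_sym)+
    have "cubic k y y y - cubic k v v v - 3 *\<^sub>R cubic k v v (y - v)
        = 3 *\<^sub>R cubic k v h h + cubic k h h h"
      unfolding h_def[symmetric] yh by (simp add: cubic_add s1 three)
    then have "norm (cubic k y y y - cubic k v v v - 3 *\<^sub>R cubic k v v (y - v))
        \<le> 3 * norm (cubic k v h h) + norm (cubic k h h h)"
      by (metis norm_triangle_ineq norm_scaleR abs_numeral)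
    also have "\<dots> \<le> 3 * (108 * (norm v * norm h * norm h)) + 108 * (norm h * norm h * norm h)"
      using cubic_bound[OF k] by (intro add_mono mult_left_mono) auto
    also have "\<dots> = (324 * norm v + 108 * norm h) * norm h * norm h"
      by (simp add: algebra_simps)
    also have "\<dots> \<le> C * norm h * norm h"
      using h1 by (intro mult_right_mono) (auto simp: C_def)
    also have "\<dots> \<le> e * norm h"
      using hC by (intro mult_right_mono) auto
    finally show "norm (cubic k y y y - cubic k v v v - 3 *\<^sub>R cubic k v v (y - v)) \<le> e * norm (y - v)"
      by (simp add: h_def)
  qed
qed

section \<open>Kernel coordinates and the projected equation\<close>

text \<open>A left inverse of \<open>LL k\<close> (for k \<ge> 1) whose null space is the orthogonal
  complement of the kernel. It splits any u as \<open>LL k (coords k u)\<close> plus an orthogonal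
  part.\<close>

definition coords :: "nat \<Rightarrow> h2 \<Rightarrow> real \<times> real" where
  "coords k u = (l2_inner (h2_fun u) (phi_cos k), l2_inner (h2_fun u) (phi_sin k))"

lemma linear_coords: "linear (coords k)"
  by (rule linearI)
    (simp_all add: coords_def h2_fun_add h2_fun_scaleR l2_inner_add h2_fun_L2 phi_L2 l2_inner_scale)

lemma norm_coords_le:
  assumes "k \<ge> 1"
  shows "norm (coords k u) \<le> 2 * norm u"
proof -
  have one: "l2_norm (phi_cos k) = 1" "l2_norm (phi_sin k) = 1"
    using phi_orthonormal[OF assms] by (simp_all add: l2_norm_def)
  have "norm (coords k u) \<le> \<bar>l2_inner (h2_fun u) (phi_cos k)\<bar> + \<bar>l2_inner (h2_fun u) (phi_sin k)\<bar>"
    unfolding coords_def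
    using norm_Pair_le[of "l2_inner (h2_fun u) (phi_cos k)" "l2_inner (h2_fun u) (phi_sin k)"] by simp
  also have "\<dots> \<le> 2 * norm u"
    using l2_Cauchy_Schwarz[OF h2_fun_L2 phi_L2(1), of u k]
      l2_Cauchy_Schwarz[OF h2_fun_L2 phi_L2(2), of u k] one l2_norm_h2_D_le(1)[of u] by simp
  finally show ?thesis .
qed

lemma bounded_linear_coords: "k \<ge> 1 \<Longrightarrow> bounded_linear (coords k)"
  using linear_coords[of k] norm_coords_le[of k]
  by (intro bounded_linear_intro[of _ 2])
    (auto simp: linear_add linear_scale mult.commute)

lemma LL_eq: "LL k x = fst x *\<^sub>R Abs_h2 (phi_cos k) + snd x *\<^sub>R Abs_h2 (phi_sin k)"
  by (simp add: LL_def split_beta)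

lemma linear_LL: "linear (LL k)"
  by (rule linearI) (simp_all add: LL_eq algebra_simps)

lemma bounded_linear_LL: "bounded_linear (LL k)"
  using linear_LL linear_conv_bounded_linear by blast

lemma coords_LL: "k \<ge> 1 \<Longrightarrow> coords k (LL k x) = x"
  using linear_coords[of k] phi_orthonormal[of k]
  by (simp add: LL_eq linear_add linear_scale) (simp add: coords_def h2_fun_Abs_phi prod_eq_iff)

lemma LL_in_ker: "LL k x \<in> ker k"
  unfolding LL_eq ker_def by (intro span_add span_scale span_base) auto

lemma orthogonal_comp_ker_coords: "u \<in> orthogonal_comp (ker k) \<longleftrightarrow> coords k u = 0"
  by (simp add: orthogonal_comp_ker_iff coords_def prod_eq_iff)

lemma FF_L2: "FF lam u \<in> L2"
proof -
  have "(\<lambda>t. h2_D 2 u t + lam * h2_fun u t) \<in> L2"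
    by (intro L2_add L2_scale h2_D_L2 h2_fun_L2) simp
  moreover have "(\<lambda>t. weight t * (h2_fun u t) ^ 3) \<in> L2"
    by (intro weight_mult_L2 continuous_on_imp_L2 continuous_intros h2_fun_continuous)
  ultimately show ?thesis unfolding FF_def by (rule L2_add)
qed

lemma l2_inner_FF:
  assumes "\<phi> \<in> L2"
  shows "l2_inner (FF lam u) \<phi> = l2_inner (h2_D 2 u) \<phi> + lam * l2_inner (h2_fun u) \<phi> + trilin \<phi> u u u"
proof -
  have D2: "h2_D 2 u \<in> L2" by (intro h2_D_L2) simp
  have *: "(\<lambda>t. h2_D 2 u t + lam * h2_fun u t) \<in> L2"
    by (intro L2_add L2_scale D2 h2_fun_L2)
  have "FF lam u = (\<lambda>t. (h2_D 2 u t + lam * h2_fun u t)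
      + weight t * (h2_fun u t * h2_fun u t * h2_fun u t))"
    by (simp add: FF_def power3_eq_cube)
  then show ?thesis
    using l2_inner_add[OF * trilin_L2[of u u u] assms]
      l2_inner_lincomb[OF D2 h2_fun_L2 assms, of 1 lam u]
    by (simp add: trilin_def)
qed

text \<open>On the kernel components the second derivative acts as multiplication by -\<sigma>,
  whatever u is, so the linear part reduces to (\<lambda> - \<sigma>) times the coordinates. This
  makes the reduced equation explicit.\<close>

lemma l2_inner_FF_phi:
  "(l2_inner (FF lam u) (phi_cos k), l2_inner (FF lam u) (phi_sin k))
    = (lam - sigma k) *\<^sub>R coords k u + cubic k u u u"
  by (simp add: l2_inner_FF phi_L2 l2_inner_D2_phi coords_def cubic_def algebra_simps)

lemma is_solution_iff: "is_solution lam u \<longleftrightarrow> (AE t in dom_measure. FF lam u t = 0)"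
  unfolding is_solution_def FF_def by (rule AE_cong) (auto simp: algebra_simps)

lemma l2_inner_QQ:
  assumes "k \<ge> 1"
  shows "l2_inner (QQ k f) (phi_cos k) = l2_inner f (phi_cos k)"
    "l2_inner (QQ k f) (phi_sin k) = l2_inner f (phi_sin k)"
  unfolding QQ_def using l2_inner_lincomb[OF phi_L2(1) phi_L2(2)] phi_L2 phi_orthonormal[OF assms]
  by simp_all

lemma QQ_L2: "QQ k f \<in> L2"
  unfolding QQ_def by (intro L2_add L2_scale phi_L2)


section \<open>Trigonometric integrals and counting of zeros\<close>

lemma trilin_eq_integral:
  assumes "continuous_on {0..pi} \<phi>"
  shows "trilin \<phi> u v w = integral {0..pi/4} (\<lambda>t. h2_fun u t * h2_fun v t * h2_fun w t * \<phi> t)"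
proof -
  have "trilin \<phi> u v w
      = integral {0..pi} (\<lambda>t. weight t * (h2_fun u t * h2_fun v t * h2_fun w t) * \<phi> t)"
    unfolding trilin_def by (intro l2_inner_eq_integral trilin_L2 continuous_on_imp_L2 assms)
  also have "\<dots> = integral {0..pi} (\<lambda>t. if t \<in> {0..pi/4}
      then h2_fun u t * h2_fun v t * h2_fun w t * \<phi> t else 0)"
    by (rule Henstock_Kurzweil_Integration.integral_cong) (simp add: weight_def indicator_def)
  also have "\<dots> = integral ({0..pi/4} \<inter> {0..pi}) (\<lambda>t. h2_fun u t * h2_fun v t * h2_fun w t * \<phi> t)"
    by (simp only: integral_restrict_Int)
  also have "{0..pi/4} \<inter> {0..pi} = {0..pi/4}" by auto
  finally show ?thesis .
qed

text \<open>The trigonometric input from the parity of k: at the end pi/4 of the weight the phase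
  2kt is an odd multiple of pi/2.\<close>

lemma cos_odd_pi_half:
  assumes "odd k"
  shows "cos (real k * pi / 2) = 0" "(sin (real k * pi / 2))\<^sup>2 = 1"
proof -
  obtain j where j: "k = 2 * j + 1" using assms by (auto elim: oddE)
  have "real k * pi / 2 = real j * pi + pi / 2" by (simp add: j field_simps)
  then show c: "cos (real k * pi / 2) = 0" by (simp only: cos_add) simp
  show "(sin (real k * pi / 2))\<^sup>2 = 1" using sin_squared_eq[of "real k * pi / 2"] c by simp
qed

text \<open>At the right end the cosine vanishes and the squared sine is 1, so every primitive has
  an elementary value there. The moments are unchanged when cosine and sine are exchanged.\<close>

lemma quartic_trig_integrals:
  fixes k :: nat
  assumes "odd k"
  defines "m \<equiv> 2 * real k"
  shows "((\<lambda>t. cos (m * t) ^ 4) has_integral 3 * pi / 32) {0..pi/4}"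
    "((\<lambda>t. cos (m * t) ^ 3 * sin (m * t)) has_integral 1 / (8 * real k)) {0..pi/4}"
    "((\<lambda>t. cos (m * t) ^ 2 * sin (m * t) ^ 2) has_integral pi / 32) {0..pi/4}"
    "((\<lambda>t. cos (m * t) * sin (m * t) ^ 3) has_integral 1 / (8 * real k)) {0..pi/4}"
    "((\<lambda>t. sin (m * t) ^ 4) has_integral 3 * pi / 32) {0..pi/4}"
proof -
  have k: "real k > 0" using assms by (cases k) auto
  then have m: "m > 0" by (simp add: m_def)
  have mpi: "m * (pi / 4) = real k * pi / 2" by (simp add: m_def)
  have end_vals: "cos (m * (pi / 4)) = 0" "(sin (m * (pi / 4)))\<^sup>2 = 1"
    unfolding mpi by (rule cos_odd_pi_half[OF assms(1)])+
  then have end4: "sin (m * (pi / 4)) ^ 4 = 1"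
    using power_mult[of "sin (m * (pi / 4))" 2 2] by simp
  note end_simps = end_vals end4 end_vals[unfolded times_divide_eq_right] end4[unfolded times_divide_eq_right]
  have FTC: "(f has_integral F (m * (pi / 4)) / m - F (m * 0) / m) {0..pi/4}"
    if F: "\<And>x. (F has_real_derivative F' x) (at x)" and f: "\<And>t. F' (m * t) = f t"
    for F F' f :: "real \<Rightarrow> real"
  proof (rule fundamental_theorem_of_calculus[where f = "\<lambda>t. F (m * t) / m"])
    fix t :: real
    have "((\<lambda>t. m * t) has_real_derivative m) (at t)" by (auto intro!: derivative_eq_intros)
    from DERIV_cdivide[OF DERIV_chain2[OF F this], of m]
    have "((\<lambda>t. F (m * t) / m) has_real_derivative f t) (at t)" using m by (simp add: f)
    then show "((\<lambda>t. F (m * t) / m) has_vector_derivative f t) (at t within {0..pi/4})"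
      by (simp add: has_real_derivative_iff_has_vector_derivative[symmetric]
          has_field_derivative_at_within)
  qed simp
  have pyth: "sin x * sin x = 1 - cos x * cos x" for x :: real
    using sin_cos_squared_add[of x] by (simp add: power2_eq_square)
  \<comment> \<open>Primitives in the phase variable x = mt; the Pythagorean identity turns each
    formal derivative into the required monomial.\<close>
  have d: "((\<lambda>x. (3 * x + sin x * cos x * (2 * (cos x)\<^sup>2 + 3)) / 8) has_real_derivative cos x ^ 4) (at x)"
    "((\<lambda>x. - (cos x ^ 4) / 4) has_real_derivative cos x ^ 3 * sin x) (at x)"
    "((\<lambda>x. (x - sin x * cos x * (2 * (cos x)\<^sup>2 - 1)) / 8) has_real_derivative (cos x)\<^sup>2 * (sin x)\<^sup>2) (at x)"
    "((\<lambda>x. sin x ^ 4 / 4) has_real_derivative cos x * sin x ^ 3) (at x)"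
    "((\<lambda>x. (3 * x - sin x * cos x * (2 * (sin x)\<^sup>2 + 3)) / 8) has_real_derivative sin x ^ 4) (at x)"
    for x :: real
  proof -
    define c s where "c = cos x" and "s = sin x"
    have cs: "s * s = 1 - c * c" using pyth[of x] by (simp add: c_def s_def)
    have "((\<lambda>x. 3 * x + sin x * cos x * (2 * (cos x)\<^sup>2 + 3)) has_real_derivative
        3 + ((c * c - s * s) * (2 * (c * c) + 3) - 4 * (c * c) * (s * s))) (at x)"
      by (auto intro!: derivative_eq_intros simp: c_def s_def algebra_simps power2_eq_square)
    also have "3 + ((c * c - s * s) * (2 * (c * c) + 3) - 4 * (c * c) * (s * s)) = cos x ^ 4 * 8"
      unfolding cs by (simp add: power4_eq_xxxx algebra_simps c_def)
    finally show "((\<lambda>x. (3 * x + sin x * cos x * (2 * (cos x)\<^sup>2 + 3)) / 8) has_real_derivative cos x ^ 4) (at x)"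
      using DERIV_cdivide[of _ "cos x ^ 4 * 8" x UNIV 8] by simp
    show "((\<lambda>x. - (cos x ^ 4) / 4) has_real_derivative cos x ^ 3 * sin x) (at x)"
      by (auto intro!: derivative_eq_intros simp: power3_eq_cube)
    have "((\<lambda>x. x - sin x * cos x * (2 * (cos x)\<^sup>2 - 1)) has_real_derivative
        1 - ((c * c - s * s) * (2 * (c * c) - 1) - 4 * (c * c) * (s * s))) (at x)"
      by (auto intro!: derivative_eq_intros simp: c_def s_def algebra_simps power2_eq_square)
    also have "1 - ((c * c - s * s) * (2 * (c * c) - 1) - 4 * (c * c) * (s * s)) = c * c * (s * s) * 8"
      unfolding cs by (simp add: algebra_simps)
    finally show "((\<lambda>x. (x - sin x * cos x * (2 * (cos x)\<^sup>2 - 1)) / 8) has_real_derivative (cos x)\<^sup>2 * (sin x)\<^sup>2) (at x)"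
      using DERIV_cdivide[of _ "c * c * (s * s) * 8" x UNIV 8] by (simp add: c_def s_def power2_eq_square)
    show "((\<lambda>x. sin x ^ 4 / 4) has_real_derivative cos x * sin x ^ 3) (at x)"
      by (auto intro!: derivative_eq_intros simp: power3_eq_cube)
    have "((\<lambda>x. 3 * x - sin x * cos x * (2 * (sin x)\<^sup>2 + 3)) has_real_derivative
        3 - ((c * c - s * s) * (2 * (s * s) + 3) + 4 * (c * c) * (s * s))) (at x)"
      by (auto intro!: derivative_eq_intros simp: c_def s_def algebra_simps power2_eq_square)
    also have "3 - ((c * c - s * s) * (2 * (s * s) + 3) + 4 * (c * c) * (s * s)) = s * s * (s * s) * 8"
      unfolding cs by (simp add: algebra_simps)
    finally show "((\<lambda>x. (3 * x - sin x * cos x * (2 * (sin x)\<^sup>2 + 3)) / 8) has_real_derivative sin x ^ 4) (at x)"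
      using DERIV_cdivide[of _ "s * s * (s * s) * 8" x UNIV 8] by (simp add: s_def power4_eq_xxxx mult.assoc)
  qed
  show "((\<lambda>t. cos (m * t) ^ 4) has_integral 3 * pi / 32) {0..pi/4}"
    using FTC[OF d(1) refl] m by (simp add: end_simps)
  show "((\<lambda>t. cos (m * t) ^ 3 * sin (m * t)) has_integral 1 / (8 * real k)) {0..pi/4}"
    using FTC[OF d(2) refl] by (simp add: end_simps) (simp add: m_def)
  show "((\<lambda>t. cos (m * t) ^ 2 * sin (m * t) ^ 2) has_integral pi / 32) {0..pi/4}"
    using FTC[OF d(3) refl] m by (simp add: end_simps)
  show "((\<lambda>t. cos (m * t) * sin (m * t) ^ 3) has_integral 1 / (8 * real k)) {0..pi/4}"
    using FTC[OF d(4) refl] by (simp add: end_simps) (simp add: m_def)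
  show "((\<lambda>t. sin (m * t) ^ 4) has_integral 3 * pi / 32) {0..pi/4}"
    using FTC[OF d(5) refl] m by (simp add: end_simps)
qed

text \<open>The factor 4/pi^2 is the fourth power of the normalisation sqrt (2/pi), and \<alpha>/3
  is the moment of cos^2 sin^2. The third slot is free so that the formula also yields the
  derivative of the cubic.\<close>

lemma cubic_LL:
  assumes k: "odd k"
  defines "\<alpha> \<equiv> 3 * pi / 32" and "\<beta> \<equiv> 1 / (8 * real k)"
  shows "cubic k (LL k (x1, x2)) (LL k (x1, x2)) (LL k (y1, y2)) = (4 / pi\<^sup>2) *\<^sub>R
      (y1 * (\<alpha> * x1\<^sup>2 + 2 * \<beta> * x1 * x2 + \<alpha> / 3 * x2\<^sup>2)
         + y2 * (\<beta> * x1\<^sup>2 + 2 * \<alpha> / 3 * x1 * x2 + \<beta> * x2\<^sup>2),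
       y1 * (\<beta> * x1\<^sup>2 + 2 * \<alpha> / 3 * x1 * x2 + \<beta> * x2\<^sup>2)
         + y2 * (\<alpha> / 3 * x1\<^sup>2 + 2 * \<beta> * x1 * x2 + \<alpha> * x2\<^sup>2))"
proof -
  define m where "m = 2 * real k"
  define r where "r = sqrt (2 / pi)"
  have r2: "r\<^sup>2 = 2 / pi" by (simp add: r_def)
  have r4: "r ^ 4 = 4 / pi\<^sup>2"
    using power_mult[of r 2 2] by (simp add: r2 power_divide)
  note I = quartic_trig_integrals[OF k, folded m_def \<alpha>_def \<beta>_def]
  have I22: "((\<lambda>t. cos (m * t) ^ 2 * sin (m * t) ^ 2) has_integral \<alpha> / 3) {0..pi/4}"
    using I(3) by (simp add: \<alpha>_def)
  \<comment> \<open>One computation for both components: (z1, z2) is later set to (1, 0) and (0,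
    1).\<close>
  have comb: "integral {0..pi/4} (\<lambda>t. h2_fun (LL k (x1, x2)) t * h2_fun (LL k (x1, x2)) t
        * h2_fun (LL k (y1, y2)) t * (z1 * phi_cos k t + z2 * phi_sin k t))
      = r ^ 4 * (x1\<^sup>2 * y1 * z1 * \<alpha>
        + (x1\<^sup>2 * y1 * z2 + x1\<^sup>2 * y2 * z1 + 2 * x1 * x2 * y1 * z1) * \<beta>
        + (x1\<^sup>2 * y2 * z2 + 2 * x1 * x2 * y1 * z2 + 2 * x1 * x2 * y2 * z1 + x2\<^sup>2 * y1 * z1) * (\<alpha> / 3)
        + (x2\<^sup>2 * y1 * z2 + x2\<^sup>2 * y2 * z1 + 2 * x1 * x2 * y2 * z2) * \<beta>
        + x2\<^sup>2 * y2 * z2 * \<alpha>)" (is "integral _ ?f = r ^ 4 * ?v") for z1 z2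
  proof (rule integral_unique)
    have "((\<lambda>t. r ^ 4 * (x1\<^sup>2 * y1 * z1 * cos (m * t) ^ 4
        + (x1\<^sup>2 * y1 * z2 + x1\<^sup>2 * y2 * z1 + 2 * x1 * x2 * y1 * z1) * (cos (m * t) ^ 3 * sin (m * t))
        + (x1\<^sup>2 * y2 * z2 + 2 * x1 * x2 * y1 * z2 + 2 * x1 * x2 * y2 * z1 + x2\<^sup>2 * y1 * z1)
            * (cos (m * t) ^ 2 * sin (m * t) ^ 2)
        + (x2\<^sup>2 * y1 * z2 + x2\<^sup>2 * y2 * z1 + 2 * x1 * x2 * y2 * z2) * (cos (m * t) * sin (m * t) ^ 3)
        + x2\<^sup>2 * y2 * z2 * sin (m * t) ^ 4)) has_integral r ^ 4 * ?v) {0..pi/4}" (is "(?g has_integral _) _")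
      by (intro has_integral_mult_right has_integral_add I I22)
    moreover have "?g = ?f"
    proof
      fix t
      have "phi_cos k t = r * cos (m * t)" "phi_sin k t = r * sin (m * t)"
        by (simp_all add: phi_cos_def phi_sin_def r_def m_def)
      then show "?g t = ?f t"
        unfolding h2_fun_LL
        by (simp add: power2_eq_square power3_eq_cube power4_eq_xxxx algebra_simps)
    qed
    ultimately show "(?f has_integral r ^ 4 * ?v) {0..pi/4}" by simp
  qed
  show ?thesis
    unfolding cubic_def trilin_eq_integral[OF phi_continuous(1)] trilin_eq_integral[OF phi_continuous(2)]
    using comb[of 1 0] comb[of 0 1] by (simp add: r4 algebra_simps)
qed

section \<open>Zeros of functions close to cos + sin or cos - sin\<close>

lemma decreasing_unique_zero:
  fixes g g' :: "real \<Rightarrow> real"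
  assumes "a < b" and der: "\<And>t. t \<in> {a..b} \<Longrightarrow> (g has_real_derivative g' t) (at t within {a..b})"
    and neg: "\<And>t. t \<in> {a..b} \<Longrightarrow> g' t < 0" and "g a > 0" "g b < 0"
  shows "\<exists>t\<in>{a..b}. g t = 0 \<and> (\<forall>s\<in>{a..b}. g s = 0 \<longrightarrow> s = t)"
proof -
  have "continuous_on {a..b} g" by (rule DERIV_continuous_on[OF der])
  then obtain t where t: "t \<in> {a..b}" "g t = 0"
    using IVT2'[of g b 0 a] assms by auto
  have strict: "g t < g s" if "a \<le> s" "s < t" "t \<le> b" for s t
  proof -
    have "\<exists>x\<in>{s<..<t}. g t - g s = (\<lambda>h. h * g' x) (t - s)"
    proof (rule mvt_simple[OF \<open>s < t\<close>])
      fix x assume x: "s \<le> x" "x \<le> t"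
      have "(g has_real_derivative g' x) (at x within {s..t})"
        by (rule has_field_derivative_subset[OF der]) (use x that in auto)
      then show "(g has_derivative (\<lambda>h. h * g' x)) (at x within {s..t})"
        by (simp add: has_field_derivative_def mult.commute[of _ "g' x"])
    qed
    then obtain x where x: "x \<in> {s<..<t}" "g t - g s = (t - s) * g' x" by auto
    then have "(t - s) * g' x < 0" using neg[of x] that by (intro mult_pos_neg) auto
    then show ?thesis using x by simp
  qed
  show ?thesis
  proof (intro bexI[OF _ t(1)] conjI ballI impI t(2))
    fix s assume "s \<in> {a..b}" "g s = 0"
    then show "s = t" using strict[of s t] strict[of t s] t by (cases s t rule: linorder_cases) auto
  qed
qed

text \<open>On the first quarter period both values lie in [0, 1] and dominate their squares. The
  bound 1 is the margin that the zero count can afford to lose.\<close>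

lemma cos_plus_sin_ge_1:
  assumes "0 \<le> x" "x \<le> pi / 2"
  shows "cos x + sin x \<ge> 1"
proof -
  have c: "0 \<le> cos x" "0 \<le> sin x" using assms by (auto intro: cos_ge_zero sin_ge_zero)
  then have "cos x * cos x \<le> cos x * 1" "sin x * sin x \<le> sin x * 1"
    by (simp_all add: mult_left_le)
  then show ?thesis using sin_cos_squared_add[of x] by (simp add: power2_eq_square)
qed

text \<open>There is exactly one zero in each of 2k half periods of length pi/m. On one half of such
  an interval the comparison function has modulus at least 1, so f cannot vanish there; on the other
  half its derivative has modulus at least m with fixed sign, so f is strictly monotone. The
  tolerances 1 and m are exactly these margins.\<close>

lemma card_zeros_near_cos_sin:
  fixes f f' :: "real \<Rightarrow> real" and k :: nat and e :: real
  defines "m \<equiv> 2 * real k"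
  assumes k: "k \<ge> 1" and e: "e = 1 \<or> e = -1"
    and der: "\<And>t. t \<in> {0..pi} \<Longrightarrow> (f has_real_derivative f' t) (at t within {0..pi})"
    and near: "\<And>t. t \<in> {0..pi} \<Longrightarrow> \<bar>f t - (cos (m * t) + e * sin (m * t))\<bar> < 1"
    and near': "\<And>t. t \<in> {0..pi} \<Longrightarrow> \<bar>f' t - m * (e * cos (m * t) - sin (m * t))\<bar> < m"
  shows "card {t \<in> {0..<pi}. f t = 0} = 2 * k"
proof -
  have m: "m > 0" using k by (simp add: m_def)
  define T where "T j = real j * pi / m" for j :: nat
  have T_Suc: "T (Suc j) = T j + pi / m" for j by (simp add: T_def field_simps add_divide_distrib)
  have T_0: "T 0 = 0" and T_2k: "T (2 * k) = pi" using m by (simp_all add: T_def m_def)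
  have T_mono: "T i \<le> T j" if "i \<le> j" for i j
    using that m by (simp add: T_def divide_right_mono mult_right_mono)
  have T_in: "T j \<ge> 0" "T (Suc j) \<le> pi" if "j < 2 * k" for j
    using T_mono[of 0 j] T_mono[of "Suc j" "2 * k"] that T_0 T_2k by auto
  \<comment> \<open>Half-open intervals make the pieces disjoint and let them cover [0, pi)
    exactly.\<close>
  have ex1: "\<exists>!t. t \<in> {T j..<T (Suc j)} \<and> f t = 0" if j: "j < 2 * k" for j
  proof -
    \<comment> \<open>Shifting by j half periods multiplies cosine and sine by (-1)^j. Removing this
      sign and the shift reduces every piece to the first one.\<close>
    define S :: real where "S = (-1) ^ j"
    define x where "x t = m * (t - T j)" for t
    have S: "S * S = 1" "\<bar>S\<bar> = 1" by (simp_all add: S_def flip: power_mult_distrib)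
    have mt: "m * t = x t + real j * pi" for t
      using m by (simp add: x_def T_def algebra_simps)
    have cs: "S * cos (m * t) = cos (x t)" "S * sin (m * t) = sin (x t)" for t
      unfolding mt using S(1) by (simp_all add: cos_add sin_add S_def[symmetric] mult.assoc[symmetric])
    define h h' where "h t = S * f t" and "h' t = S * f' t" for t
    note h_defs = h_def h'_def
    have sub: "{T j..T (Suc j)} \<subseteq> {0..pi}" using T_in[OF j] by auto
    have g: "\<bar>h t - (cos (x t) + e * sin (x t))\<bar> < 1"
      "\<bar>h' t - m * (e * cos (x t) - sin (x t))\<bar> < m" if "t \<in> {T j..T (Suc j)}" for t
    proof -
      have t: "t \<in> {0..pi}" using that sub by auto
      have "h t - (cos (x t) + e * sin (x t)) = S * (f t - (cos (m * t) + e * sin (m * t)))"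
        unfolding cs[symmetric] h_defs by (simp add: algebra_simps)
      then show "\<bar>h t - (cos (x t) + e * sin (x t))\<bar> < 1"
        using near[OF t] S(2) by (simp add: abs_mult)
      have "h' t - m * (e * cos (x t) - sin (x t)) = S * (f' t - m * (e * cos (m * t) - sin (m * t)))"
        unfolding cs[symmetric] h_defs by (simp add: algebra_simps)
      then show "\<bar>h' t - m * (e * cos (x t) - sin (x t))\<bar> < m"
        using near'[OF t] S(2) by (simp add: abs_mult)
    qed
    define c where "c = T j + pi / (2 * m)"
    have c: "T j < c" "c < T (Suc j)" using m by (auto simp: c_def T_Suc field_simps)
    have x_end: "x (T j) = 0" "x c = pi / 2" "x (T (Suc j)) = pi"
      using m by (simp_all add: x_def c_def T_Suc)
    have x_mono: "x s \<le> x t" if "s \<le> t" for s t using that m by (simp add: x_def)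
    have dg: "(h has_real_derivative h' t) (at t within {a..b})"
      if "t \<in> {a..b}" "T j \<le> a" "b \<le> T (Suc j)" for t a b
      unfolding h_def[abs_def] h'_def by (intro DERIV_cmult has_field_derivative_subset[OF der])
        (use that sub in auto)
    have zero_iff: "h t = 0 \<longleftrightarrow> f t = 0" for t using S(2) by (auto simp: h_def)
    have "\<exists>!t. t \<in> {T j..<T (Suc j)} \<and> h t = 0"
      using e
    proof
      \<comment> \<open>Here cos + sin \<ge> 1 keeps h positive on the left half, and on the right
        half h decreases to a negative value at phase pi, so the excluded right endpoint is not a
        zero.\<close>
      assume e1: "e = 1"
      have pos: "h t > 0" if "t \<in> {T j..c}" for t
        using g(1)[of t] cos_plus_sin_ge_1[of "x t"] x_mono[of "T j" t] x_mono[of t c] x_end that c e1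
        by auto
      have end_neg: "h (T (Suc j)) < 0"
        using g(1)[of "T (Suc j)"] c e1 x_end by auto
      have ends: "h c > 0" "h (T (Suc j)) < 0" using pos[of c] c end_neg by auto
      have prem: "(h has_real_derivative h' t) (at t within {c..T (Suc j)})" "h' t < 0" if t: "t \<in> {c..T (Suc j)}" for t
      proof -
        show "(h has_real_derivative h' t) (at t within {c..T (Suc j)})"
          using c t by (intro dg) auto
        have "cos (x t - pi / 2) + sin (x t - pi / 2) \<ge> 1"
          using x_mono[of c t] x_mono[of t "T (Suc j)"] x_end t by (intro cos_plus_sin_ge_1) auto
        then have "sin (x t) - cos (x t) \<ge> 1" by (simp add: cos_diff sin_diff)
        then have "m * (sin (x t) - cos (x t)) \<ge> m * 1" using m by (intro mult_left_mono) auto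
        then show "h' t < 0" using g(2)[of t] t c e1 by (auto simp: algebra_simps)
      qed
      have "\<exists>t\<in>{c..T (Suc j)}. h t = 0 \<and> (\<forall>s\<in>{c..T (Suc j)}. h s = 0 \<longrightarrow> s = t)"
        by (rule decreasing_unique_zero[of c "T (Suc j)" h h']) (rule c(2) | erule prem | rule ends)+
      then obtain t where t: "t \<in> {c..T (Suc j)}" "h t = 0"
        "\<forall>s\<in>{c..T (Suc j)}. h s = 0 \<longrightarrow> s = t"
        by (elim bexE conjE)
      show ?thesis
      proof (intro ex1I[of _ t] conjI)
        show "t \<in> {T j..<T (Suc j)}" using t(1,2) end_neg c by (cases "t = T (Suc j)") auto
        fix s assume s: "s \<in> {T j..<T (Suc j)} \<and> h s = 0"
        then show "s = t" using bspec[OF t(3), of s] pos[of s] by (cases "s \<le> c") auto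
      qed (rule t(2))
    next
      \<comment> \<open>The roles of the halves are exchanged: h is negative on the right half and
        decreases on the left half from a positive value at phase 0.\<close>
      assume e1: "e = -1"
      have neg: "h t < 0" if t: "t \<in> {c..T (Suc j)}" for t
      proof -
        have "cos (x t - pi / 2) + sin (x t - pi / 2) \<ge> 1"
          using x_mono[of c t] x_mono[of t "T (Suc j)"] x_end t by (intro cos_plus_sin_ge_1) auto
        then have "sin (x t) - cos (x t) \<ge> 1" by (simp add: cos_diff sin_diff)
        then show ?thesis using g(1)[of t] t c e1 by auto
      qed
      have ends: "h (T j) > 0" "h c < 0" using g(1)[of "T j"] neg[of c] c x_end e1 by auto
      have prem: "(h has_real_derivative h' t) (at t within {T j..c})" "h' t < 0" if t: "t \<in> {T j..c}" for t
      proof -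
        show "(h has_real_derivative h' t) (at t within {T j..c})"
          using c t by (intro dg) auto
        have "cos (x t) + sin (x t) \<ge> 1"
          using x_mono[of "T j" t] x_mono[of t c] x_end t by (intro cos_plus_sin_ge_1) auto
        then have "m * (cos (x t) + sin (x t)) \<ge> m * 1" using m by (intro mult_left_mono) auto
        then show "h' t < 0" using g(2)[of t] t c e1 by (auto simp: algebra_simps)
      qed
      have "\<exists>t\<in>{T j..c}. h t = 0 \<and> (\<forall>s\<in>{T j..c}. h s = 0 \<longrightarrow> s = t)"
        by (rule decreasing_unique_zero[of "T j" c h h']) (rule c(1) | erule prem | rule ends)+
      then obtain t where t: "t \<in> {T j..c}" "h t = 0"
        "\<forall>s\<in>{T j..c}. h s = 0 \<longrightarrow> s = t"
        by (elim bexE conjE)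
      show ?thesis
      proof (intro ex1I[of _ t] conjI)
        show "t \<in> {T j..<T (Suc j)}" using t(1) c by auto
        fix s assume s: "s \<in> {T j..<T (Suc j)} \<and> h s = 0"
        then show "s = t" using bspec[OF t(3), of s] neg[of s] by (cases "s \<le> c") auto
      qed (rule t(2))
    qed
    then show ?thesis by (simp only: zero_iff)
  qed
  define Z where "Z j = (THE t. t \<in> {T j..<T (Suc j)} \<and> f t = 0)" for j
  have Z: "Z j \<in> {T j..<T (Suc j)}" "f (Z j) = 0" if "j < 2 * k" for j
    using theI'[OF ex1[OF that]] unfolding Z_def by auto
  have "{t \<in> {0..<pi}. f t = 0} = Z ` {..<2 * k}"
  proof (intro equalityI subsetI)
    fix t assume "t \<in> {t \<in> {0..<pi}. f t = 0}"
    then have t: "0 \<le> t" "t < pi" "f t = 0" by auto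
    define j where "j = nat \<lfloor>t * m / pi\<rfloor>"
    have jr: "real j \<le> t * m / pi" "t * m / pi < real j + 1"
      using t m by (auto simp: j_def)
    then have Tj: "T j \<le> t" "t < T (Suc j)" using m by (auto simp: T_def field_simps)
    have j: "j < 2 * k"
    proof (rule ccontr)
      assume "\<not> j < 2 * k"
      then show False using T_mono[of "2 * k" j] T_2k \<open>T j \<le> t\<close> t by auto
    qed
    have "Z j = t"
      unfolding Z_def using t Tj by (intro the1_equality[OF ex1[OF j]]) auto
    with j show "t \<in> Z ` {..<2 * k}" by blast
  next
    fix t assume "t \<in> Z ` {..<2 * k}"
    then obtain j where j: "j < 2 * k" "t = Z j" by auto
    then show "t \<in> {t \<in> {0..<pi}. f t = 0}" using Z[OF j(1)] T_in[OF j(1)] by auto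
  qed
  moreover have "inj_on Z {..<2 * k}"
  proof (rule linorder_inj_onI)
    fix i j assume "i < j" "i \<in> {..<2 * k}" "j \<in> {..<2 * k}"
    then show "Z i \<noteq> Z j" using Z(1)[of i] Z(1)[of j] T_mono[of "Suc i" j] by auto
  qed auto
  ultimately show ?thesis by (simp add: card_image)
qed


section \<open>The limiting equation\<close>

text \<open>The modulus of either coordinate of a nonzero solution of the limit system on the
  diagonal y2 = e y1.\<close>

definition bif_radius :: "nat \<Rightarrow> real \<Rightarrow> real" where
  "bif_radius k e = 2 * sqrt (real k) * pi / sqrt (3 * real k * pi + 8 * e)"

definition lim_map :: "nat \<Rightarrow> real \<times> real \<Rightarrow> real \<times> real" where
  "lim_map k y = - y + cubic k (LL k y) (LL k y) (LL k y)"

text \<open>The comparison of \<alpha> with 2\<beta> is 3k pi > 8 in disguise. The last identity is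
  the limit equation restricted to the diagonal with sign e, after division by the
  coordinate.\<close>

lemma bif_params:
  assumes k: "odd k"
  defines "\<alpha> \<equiv> 3 * pi / 32" and "\<beta> \<equiv> 1 / (8 * real k)"
  shows "\<beta> > 0" "\<alpha> > 2 * \<beta>"
    "e = 1 \<or> e = -1 \<Longrightarrow> bif_radius k e > 0"
    "e = 1 \<or> e = -1 \<Longrightarrow> 4 / pi\<^sup>2 * (bif_radius k e)\<^sup>2 * (2 * \<alpha> + 4 * e * \<beta>) = 1"
proof -
  have k1: "real k \<ge> 1" using k by (cases k) auto
  have kpi: "3 * real k * pi > 8"
  proof -
    have "1 * 3 < real k * pi" using k1 pi_gt3 by (intro mult_le_less_imp_less) auto
    then show ?thesis by linarith
  qed
  show "\<beta> > 0" using k1 by (simp add: \<beta>_def)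
  show "\<alpha> > 2 * \<beta>" using k1 kpi by (simp add: \<alpha>_def \<beta>_def field_simps)
  assume e: "e = 1 \<or> e = -1"
  have pos: "3 * real k * pi + 8 * e > 0" using kpi e by auto
  then show "bif_radius k e > 0" using k1 by (simp add: bif_radius_def)
  have "(bif_radius k e)\<^sup>2 = 4 * real k * pi\<^sup>2 / (3 * real k * pi + 8 * e)"
    using pos k1 by (simp add: bif_radius_def power_divide power_mult_distrib)
  moreover have "4 / pi\<^sup>2 * (4 * real k * pi\<^sup>2 / (3 * real k * pi + 8 * e)) = 16 * real k / (3 * real k * pi + 8 * e)"
    by simp
  moreover have "2 * \<alpha> + 4 * e * \<beta> = (3 * real k * pi + 8 * e) / (16 * real k)"
    using k1 by (simp add: \<alpha>_def \<beta>_def field_simps)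
  ultimately show "4 / pi\<^sup>2 * (bif_radius k e)\<^sup>2 * (2 * \<alpha> + 4 * e * \<beta>) = 1"
    using pos k1 by simp
qed

text \<open>At a solution, y is a multiple of the cubic vector (A, B), so the determinant y1 B - y2
  A vanishes. It factors as \<beta> |y|^2 (y1^2 - y2^2), which leaves only the two diagonals; on
  each the equation becomes a scalar one for y1^2.\<close>

lemma lim_map_zero_cases:
  assumes k: "odd k" and z: "lim_map k y = 0" and y: "y \<noteq> 0"
  shows "\<exists>e\<in>{1, -1}. \<exists>t\<in>{1, -1}. y = (t * bif_radius k e, t * e * bif_radius k e)"
proof -
  obtain y1 y2 where y12: "y = (y1, y2)" by (cases y)
  define \<alpha> \<beta> c where "\<alpha> = 3 * pi / 32" and "\<beta> = 1 / (8 * real k)" and "c = 4 / pi\<^sup>2"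
  note P = bif_params[OF k, folded \<alpha>_def \<beta>_def c_def]
  have c: "c > 0" by (simp add: c_def)
  define A where "A = \<alpha> * y1 ^ 3 + 3 * \<beta> * y1\<^sup>2 * y2 + \<alpha> * y1 * y2\<^sup>2 + \<beta> * y2 ^ 3"
  define B where "B = \<beta> * y1 ^ 3 + \<alpha> * y1\<^sup>2 * y2 + 3 * \<beta> * y1 * y2\<^sup>2 + \<alpha> * y2 ^ 3"
  have "lim_map k y = (- y1 + c * A, - y2 + c * B)"
    unfolding lim_map_def y12 cubic_LL[OF k, folded \<alpha>_def \<beta>_def c_def] A_def B_def
    by (simp add: power2_eq_square power3_eq_cube algebra_simps)
  then have AB: "y1 = c * A" "y2 = c * B" using z by (simp_all add: prod_eq_iff)
  have "c * (y1 * B - y2 * A) = y1 * (c * B) - y2 * (c * A)" by (simp add: algebra_simps)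
  then have "c * (y1 * B - y2 * A) = 0" unfolding AB[symmetric] by simp
  moreover have "y1 * B - y2 * A = \<beta> * (y1\<^sup>2 + y2\<^sup>2) * (y1\<^sup>2 - y2\<^sup>2)"
    by (simp add: A_def B_def power2_eq_square power3_eq_cube algebra_simps)
  moreover have "y1\<^sup>2 + y2\<^sup>2 \<noteq> 0" using y y12 by (simp add: sum_power2_eq_zero_iff zero_prod_def)
  ultimately have "y1\<^sup>2 = y2\<^sup>2" using c P(1) by auto
  then have "y2 = y1 \<or> y2 = - y1" by (metis power2_eq_iff)
  then obtain e where e: "e = 1 \<or> e = -1" and y2: "y2 = e * y1" by fastforce
  have y1: "y1 \<noteq> 0" using y y12 y2 by (auto simp: zero_prod_def)
  have ee: "e\<^sup>2 = 1" "e ^ 3 = e" using e by auto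
  have "A = y1 * (y1\<^sup>2 * (2 * \<alpha> + 4 * e * \<beta>))"
    unfolding A_def y2 power_mult_distrib ee
    by (simp add: power2_eq_square power3_eq_cube algebra_simps)
  then have "c * A = y1 * (c * y1\<^sup>2 * (2 * \<alpha> + 4 * e * \<beta>))" by (simp only: mult_ac)
  then have "y1 * 1 = y1 * (c * y1\<^sup>2 * (2 * \<alpha> + 4 * e * \<beta>))" unfolding AB(1)[symmetric] by simp
  then have 1: "c * y1\<^sup>2 * (2 * \<alpha> + 4 * e * \<beta>) = 1" using y1 by (simp only: mult_cancel_left) auto
  with P(4)[OF e] have "c * y1\<^sup>2 * (2 * \<alpha> + 4 * e * \<beta>) = c * (bif_radius k e)\<^sup>2 * (2 * \<alpha> + 4 * e * \<beta>)"
    by simp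
  moreover have "2 * \<alpha> + 4 * e * \<beta> \<noteq> 0" using 1 by auto
  ultimately have "y1\<^sup>2 = (bif_radius k e)\<^sup>2" using c by simp
  then have "y1 = bif_radius k e \<or> y1 = - bif_radius k e" by (metis power2_eq_iff)
  then obtain t where "t \<in> {1, -1}" "y1 = t * bif_radius k e" by fastforce
  then show ?thesis using e y2 y12 by (intro bexI[of _ e] bexI[of _ t]) auto
qed

text \<open>At a diagonal point the linearisation is a symmetric 2x2 matrix with equal diagonal
  entries, so d1 + e d2 and d1 - e d2 decouple.\<close>

lemma lim_map_bif_point:
  assumes k: "odd k" and e: "e = 1 \<or> e = -1" and t: "t = 1 \<or> t = -1"
  shows "lim_map k (t * bif_radius k e, t * e * bif_radius k e) = 0"
    and "- d + 3 *\<^sub>R cubic k (LL k (t * bif_radius k e, t * e * bif_radius k e))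
        (LL k (t * bif_radius k e, t * e * bif_radius k e)) (LL k d) = 0 \<Longrightarrow> d = 0"
proof -
  define \<alpha> \<beta> c where "\<alpha> = 3 * pi / 32" and "\<beta> = 1 / (8 * real k)" and "c = 4 / pi\<^sup>2"
  note P = bif_params[OF k, folded \<alpha>_def \<beta>_def c_def]
  define r where "r = bif_radius k e"
  have c: "c > 0" by (simp add: c_def)
  have r: "r > 0" "c * r\<^sup>2 * (2 * \<alpha> + 4 * e * \<beta>) = 1" using P(3,4)[OF e] by (simp_all add: r_def)
  define q where "q = c * r\<^sup>2"
  have q: "q > 0" "q * (2 * \<alpha> + 4 * e * \<beta>) = 1" using c r by (simp_all add: q_def)
  have ee: "e * e = 1" "t * t = 1" using e t by auto
  have sq: "(t * r)\<^sup>2 = r\<^sup>2" "(t * e * r)\<^sup>2 = r\<^sup>2" "2 * \<beta> * (t * r) * (t * e * r) = 2 * e * \<beta> * r\<^sup>2"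
    "2 * \<alpha> / 3 * (t * r) * (t * e * r) = 2 * e * \<alpha> / 3 * r\<^sup>2"
    using e t by (auto simp: power2_eq_square)
  have cub: "cubic k (LL k (t * r, t * e * r)) (LL k (t * r, t * e * r)) (LL k (d1, d2)) =
      (q * (d1 * (4 / 3 * \<alpha> + 2 * e * \<beta>) + d2 * (2 * \<beta> + 2 * e * \<alpha> / 3)),
       q * (d1 * (2 * \<beta> + 2 * e * \<alpha> / 3) + d2 * (4 / 3 * \<alpha> + 2 * e * \<beta>)))" for d1 d2
    unfolding cubic_LL[OF k, folded \<alpha>_def \<beta>_def c_def] sq q_def
    by (simp add: algebra_simps)
  have "(t * r) * (4 / 3 * \<alpha> + 2 * e * \<beta>) + (t * e * r) * (2 * \<beta> + 2 * e * \<alpha> / 3)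
      = (t * r) * (2 * \<alpha> + 4 * e * \<beta>)"
    "(t * r) * (2 * \<beta> + 2 * e * \<alpha> / 3) + (t * e * r) * (4 / 3 * \<alpha> + 2 * e * \<beta>)
      = (t * e * r) * (2 * \<alpha> + 4 * e * \<beta>)"
    using e by (auto simp: algebra_simps)
  then have "cubic k (LL k (t * r, t * e * r)) (LL k (t * r, t * e * r)) (LL k (t * r, t * e * r))
      = (t * r * (q * (2 * \<alpha> + 4 * e * \<beta>)), t * e * r * (q * (2 * \<alpha> + 4 * e * \<beta>)))"
    unfolding cub by (simp only: mult.left_commute mult.assoc)
  then show "lim_map k (t * bif_radius k e, t * e * bif_radius k e) = 0"
    unfolding lim_map_def r_def[symmetric] q(2) by (simp add: zero_prod_def)
  assume z: "- d + 3 *\<^sub>R cubic k (LL k (t * bif_radius k e, t * e * bif_radius k e))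
        (LL k (t * bif_radius k e, t * e * bif_radius k e)) (LL k d) = 0"
  obtain d1 d2 where d: "d = (d1, d2)" by (cases d)
  have z1: "- d1 + q * (d1 * (4 * \<alpha> + 6 * e * \<beta>) + d2 * (6 * \<beta> + 2 * e * \<alpha>)) = 0"
    and z2: "- d2 + q * (d1 * (6 * \<beta> + 2 * e * \<alpha>) + d2 * (4 * \<alpha> + 6 * e * \<beta>)) = 0"
    using z unfolding d r_def[symmetric] cub by (simp_all add: prod_eq_iff algebra_simps)
  \<comment> \<open>The eigenvalue for d1 + e d2 is 3 - 1 = 2, as for any homogeneous cubic along a
    ray of solutions. The one for d1 - e d2, computed next, is -4 e \<beta> q, nonzero because
    \<beta> > 0.\<close>
  have "(- d1 + q * (d1 * (4 * \<alpha> + 6 * e * \<beta>) + d2 * (6 * \<beta> + 2 * e * \<alpha>)))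
      + e * (- d2 + q * (d1 * (6 * \<beta> + 2 * e * \<alpha>) + d2 * (4 * \<alpha> + 6 * e * \<beta>)))
      = (d1 + e * d2) * (3 * (q * (2 * \<alpha> + 4 * e * \<beta>)) - 1)"
    using e by (auto simp: algebra_simps)
  then have s1: "d1 + e * d2 = 0" unfolding z1 z2 q(2) by simp
  have "(- d1 + q * (d1 * (4 * \<alpha> + 6 * e * \<beta>) + d2 * (6 * \<beta> + 2 * e * \<alpha>)))
      - e * (- d2 + q * (d1 * (6 * \<beta> + 2 * e * \<alpha>) + d2 * (4 * \<alpha> + 6 * e * \<beta>)))
      = (d1 - e * d2) * ((q * (2 * \<alpha> + 4 * e * \<beta>)) - 1 - 4 * e * \<beta> * q)"
    using e by (auto simp: algebra_simps)
  then have "(d1 - e * d2) * (4 * e * \<beta> * q) = 0" unfolding z1 z2 q(2) by simp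
  then have s2: "d1 - e * d2 = 0" using q(1) P(1) e by auto
  from s1 s2 e show "d = 0" by (auto simp: d zero_prod_def)
qed

text \<open>The inner product is the weighted integral of (L y)^4. In closed form it equals a
  constant times (\<alpha> |y|^2 + 4 \<beta> y1 y2) |y|^2, and 2 y1 y2 \<ge> -|y|^2 leaves the
  positive coefficient \<alpha> - 2\<beta>.\<close>

lemma cubic_coercive:
  assumes k: "odd k"
  obtains c0 where "c0 > 0" "\<And>y. c0 * norm y ^ 4 \<le> inner y (cubic k (LL k y) (LL k y) (LL k y))"
proof
  define \<alpha> \<beta> c where "\<alpha> = 3 * pi / 32" and "\<beta> = 1 / (8 * real k)" and "c = 4 / pi\<^sup>2"
  note P = bif_params[OF k, folded \<alpha>_def \<beta>_def c_def]
  have c: "c > 0" by (simp add: c_def)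
  show "c * (\<alpha> - 2 * \<beta>) > 0" using c P(2) by simp
  fix y :: "real \<times> real"
  obtain y1 y2 where y: "y = (y1, y2)" by (cases y)
  define n where "n = y1\<^sup>2 + y2\<^sup>2"
  have n: "n \<ge> 0" by (simp add: n_def)
  have "(norm y)\<^sup>2 = n" by (simp add: y norm_Pair n_def)
  then have "norm y ^ 4 = n\<^sup>2" using power_mult[of "norm y" 2 2] by simp
  have "inner y (cubic k (LL k y) (LL k y) (LL k y)) = c * (\<alpha> * n + 4 * \<beta> * (y1 * y2)) * n"
    unfolding y cubic_LL[OF k, folded \<alpha>_def \<beta>_def c_def] n_def
    by (simp add: power2_eq_square algebra_simps)
  moreover have "4 * \<beta> * (y1 * y2) \<ge> - (2 * \<beta> * n)"
  proof -
    have "0 \<le> 2 * \<beta> * (y1 + y2)\<^sup>2" using P(1) by simp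
    then show ?thesis by (simp add: n_def power2_sum algebra_simps)
  qed
  then have "c * (\<alpha> * n + 4 * \<beta> * (y1 * y2)) * n \<ge> c * (\<alpha> * n - 2 * \<beta> * n) * n"
    using c n by (intro mult_right_mono mult_left_mono) auto
  ultimately show "c * (\<alpha> - 2 * \<beta>) * norm y ^ 4 \<le> inner y (cubic k (LL k y) (LL k y) (LL k y))"
    using \<open>norm y ^ 4 = n\<^sup>2\<close> by (simp add: power2_eq_square algebra_simps)
qed


section \<open>Directional derivatives of smooth maps\<close>

text \<open>The direction comes first so that \<open>pd v ^^ n\<close> is the n-th derivative along
  v.\<close>

definition pd :: "'a::euclidean_space \<Rightarrow> ('a \<Rightarrow> 'b::real_normed_vector) \<Rightarrow> 'a \<Rightarrow> 'b" where
  "pd v f p = frechet_derivative f (at p) v"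

lemma smooth_on_continuous: "smooth_on S f \<Longrightarrow> continuous_on S f"
  unfolding smooth_on_def by (metis Ck_on.simps(1))

lemma smooth_on_has_derivative:
  assumes "smooth_on S f" "p \<in> S"
  shows "(f has_derivative (\<lambda>v. pd v f p)) (at p)"
proof -
  have "Ck_on (Suc 0) S f" using assms by (simp add: smooth_on_def)
  then have "f differentiable (at p)" using assms(2) by simp
  then show ?thesis unfolding pd_def by (simp add: frechet_derivative_works)
qed

lemma smooth_on_pd:
  assumes "smooth_on S f"
  shows "smooth_on S (pd v f)"
  unfolding smooth_on_def
proof
  fix n
  have "Ck_on (Suc n) S f" using assms by (simp add: smooth_on_def)
  then show "Ck_on n S (pd v f)" by (simp add: pd_def[abs_def])
qed

lemma smooth_on_pd_funpow: "smooth_on S f \<Longrightarrow> smooth_on S ((pd v ^^ n) f)"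
  by (induction n) (auto intro: smooth_on_pd)

lemma linear_pd: "smooth_on S f \<Longrightarrow> p \<in> S \<Longrightarrow> linear (\<lambda>v. pd v f p)"
  using smooth_on_has_derivative has_derivative_linear by blast

lemma pd_lincomb_on:
  assumes S: "open S" and g: "\<And>p. p \<in> S \<Longrightarrow> g p = a *\<^sub>R g1 p + b *\<^sub>R g2 p"
    and s: "smooth_on S g1" "smooth_on S g2" and p: "p \<in> S"
  shows "pd v g p = a *\<^sub>R pd v g1 p + b *\<^sub>R pd v g2 p"
proof -
  have "((\<lambda>p. a *\<^sub>R g1 p + b *\<^sub>R g2 p) has_derivative (\<lambda>v. a *\<^sub>R pd v g1 p + b *\<^sub>R pd v g2 p)) (at p)"
    by (auto intro!: derivative_eq_intros smooth_on_has_derivative s p)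
  then have "(g has_derivative (\<lambda>v. a *\<^sub>R pd v g1 p + b *\<^sub>R pd v g2 p)) (at p)"
    by (rule has_derivative_transform_within_open[OF _ S p]) (simp add: g)
  from frechet_derivative_at[OF this] show ?thesis
    unfolding pd_def[of v g] by (metis (no_types, lifting))
qed

lemma pd_funpow_lincomb_on:
  assumes S: "open S"
  shows "(\<And>p. p \<in> S \<Longrightarrow> g p = a *\<^sub>R g1 p + b *\<^sub>R g2 p) \<Longrightarrow> smooth_on S g1 \<Longrightarrow> smooth_on S g2 \<Longrightarrow> p \<in> S \<Longrightarrow>
    (pd v ^^ n) g p = a *\<^sub>R (pd v ^^ n) g1 p + b *\<^sub>R (pd v ^^ n) g2 p"
proof (induction n arbitrary: p)
  case (Suc n)
  show ?case
    unfolding funpow.simps o_def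
    by (rule pd_lincomb_on[OF S Suc.IH[OF Suc.prems(1-3)] smooth_on_pd_funpow smooth_on_pd_funpow])
      (use Suc.prems in auto)
qed auto

lemma pd_snd_expand:
  fixes f :: "real \<times> real \<times> real \<Rightarrow> 'b::real_normed_vector"
  assumes "smooth_on S f" "p \<in> S"
  shows "pd (h, y) f p = h *\<^sub>R pd (1, 0) f p + pd (0, y) f p"
    "pd (0, y) f p = fst y *\<^sub>R pd (0, 1, 0) f p + snd y *\<^sub>R pd (0, 0, 1) f p"
proof -
  note L = linear_pd[OF assms]
  have "(h, y) = h *\<^sub>R (1, 0) + (0, y)" by (simp add: prod_eq_iff)
  then show "pd (h, y) f p = h *\<^sub>R pd (1, 0) f p + pd (0, y) f p"
    using linear_add[OF L] linear_scale[OF L] by metis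
  have "(0::real, y) = fst y *\<^sub>R (0, 1, 0) + snd y *\<^sub>R (0, 0, 1)" by (simp add: prod_eq_iff)
  then show "pd (0, y) f p = fst y *\<^sub>R pd (0, 1, 0) f p + snd y *\<^sub>R pd (0, 0, 1) f p"
    using linear_add[OF L] linear_scale[OF L] by metis
qed

text \<open>Continuity is needed jointly in direction and point, because along a branch the
  direction Y \<lambda> moves with \<lambda>. Linearity in the direction expands one derivative
  along y into the two coordinate derivatives with continuous coefficients; the induction is
  therefore over all smooth f.\<close>

lemma continuous_on_pd_funpow:
  fixes f :: "real \<times> real \<times> real \<Rightarrow> 'b::real_normed_vector"
  assumes S: "open S"
  shows "smooth_on S f \<Longrightarrow> continuous_on (UNIV \<times> S) (\<lambda>(y, p). (pd (0, y) ^^ n) f p)"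
proof (induction n arbitrary: f)
  case 0
  then show ?case
    unfolding split_beta
    by (auto intro!: continuous_on_compose2[OF smooth_on_continuous] continuous_intros)
next
  case (Suc n)
  have *: "(pd (0, y) ^^ Suc n) f p
      = fst y *\<^sub>R (pd (0, y) ^^ n) (pd (0, 1, 0) f) p + snd y *\<^sub>R (pd (0, y) ^^ n) (pd (0, 0, 1) f) p"
    if "p \<in> S" for y p
    unfolding funpow_Suc_right o_def
    by (rule pd_funpow_lincomb_on[OF S pd_snd_expand(2)[OF Suc.prems]])
      (use that Suc.prems in \<open>auto intro: smooth_on_pd\<close>)
  have "continuous_on (UNIV \<times> S) (\<lambda>q. fst (fst q) *\<^sub>R (\<lambda>(y, p). (pd (0, y) ^^ n) (pd (0, 1, 0) f) p) q
      + snd (fst q) *\<^sub>R (\<lambda>(y, p). (pd (0, y) ^^ n) (pd (0, 0, 1) f) p) q)"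
    by (intro continuous_intros Suc.IH smooth_on_pd Suc.prems)
  then show ?case
    by (rule continuous_on_eq) (auto simp: * simp del: funpow.simps)
qed

lemma pd_line:
  fixes f :: "real \<times> real \<times> real \<Rightarrow> 'b::real_normed_vector"
  assumes "smooth_on S f" "(l, \<tau> *\<^sub>R y) \<in> S"
  shows "((\<lambda>\<tau>. f (l, \<tau> *\<^sub>R y)) has_vector_derivative pd (0, y) f (l, \<tau> *\<^sub>R y)) (at \<tau>)"
proof -
  have "((\<lambda>\<tau>. (l, \<tau> *\<^sub>R y)) has_derivative (\<lambda>h. (0, h *\<^sub>R y))) (at \<tau>)"
    by (auto intro!: derivative_eq_intros)
  from has_derivative_compose[OF this smooth_on_has_derivative[OF assms]]
  have "((\<lambda>\<tau>. f (l, \<tau> *\<^sub>R y)) has_derivative (\<lambda>h. pd (0, h *\<^sub>R y) f (l, \<tau> *\<^sub>R y))) (at \<tau>)" .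
  moreover have "pd (0, h *\<^sub>R y) f (l, \<tau> *\<^sub>R y) = h *\<^sub>R pd (0, y) f (l, \<tau> *\<^sub>R y)" for h
    using linear_scale[OF linear_pd[OF assms], of h "(0, y)"] by simp
  ultimately show ?thesis by (simp add: has_vector_derivative_def)
qed

text \<open>The derivative of an odd function is even, and the derivative of an even function
  vanishes at 0.\<close>

lemma odd_second_derivative_zero:
  fixes T :: "real \<Rightarrow> 'b::real_normed_vector"
  assumes r: "r > 0" and T: "\<And>\<tau>. \<bar>\<tau>\<bar> < r \<Longrightarrow> (T has_vector_derivative T1 \<tau>) (at \<tau>)"
    and T1: "(T1 has_vector_derivative T2) (at 0)"
    and odd: "\<And>\<tau>. \<bar>\<tau>\<bar> < r \<Longrightarrow> T (- \<tau>) = - T \<tau>"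
  shows "T2 = 0"
proof -
  have even: "T1 (- \<tau>) = T1 \<tau>" if \<tau>: "\<bar>\<tau>\<bar> < r" for \<tau>
  proof -
    have m: "((\<lambda>x. - x) has_real_derivative - 1) (at \<tau>)" by (auto intro!: derivative_eq_intros)
    have "((\<lambda>x. - T (- x)) has_vector_derivative - ((- 1) *\<^sub>R T1 (- \<tau>))) (at \<tau>)"
      using vector_diff_chain_at[OF m[unfolded has_real_derivative_iff_has_vector_derivative] T[of "- \<tau>"]] \<tau>
      by (intro has_vector_derivative_minus) (simp_all add: o_def)
    then have "((\<lambda>x. - T (- x)) has_vector_derivative T1 (- \<tau>)) (at \<tau>)" by simp
    then have "(T has_vector_derivative T1 (- \<tau>)) (at \<tau>)"
    proof (rule has_vector_derivative_transform_within_open[where S = "{- r<..<r}"])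
      show "- T (- x) = T x" if "x \<in> {- r<..<r}" for x using odd[of x] that by (simp add: abs_less_iff)
    qed (use \<tau> in auto)
    then show ?thesis using T[OF \<tau>] vector_derivative_unique_at by blast
  qed
  have m: "((\<lambda>x. - x) has_real_derivative - 1) (at 0)" by (auto intro!: derivative_eq_intros)
  have "((\<lambda>x. T1 (- x)) has_vector_derivative (- 1) *\<^sub>R T2) (at 0)"
    using vector_diff_chain_at[OF m[unfolded has_real_derivative_iff_has_vector_derivative], of T1 T2] T1
    by (simp add: o_def)
  then have "(T1 has_vector_derivative (- 1) *\<^sub>R T2) (at 0)"
  proof (rule has_vector_derivative_transform_within_open[where S = "{- r<..<r}"])
    show "T1 (- x) = T1 x" if "x \<in> {- r<..<r}" for x using even[of x] that by (simp add: abs_less_iff)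
  qed (use r in auto)
  then have "T2 = (- 1) *\<^sub>R T2" using T1 vector_derivative_unique_at by blast
  then have "2 *\<^sub>R T2 = 0" by (metis scaleR_minus1_left scaleR_2 add.right_inverse)
  then show ?thesis by simp
qed


section \<open>The reduced equation\<close>

lemma h2_eq_0I:
  assumes "\<And>t. t \<in> {0..pi} \<Longrightarrow> h2_fun u t = 0"
  shows "u = 0"
proof -
  note Z = H2_derivs_zero[OF h2_derivs[of u] assms]
  have zero: "l2_inner f f = 0" if "AE t in dom_measure. f t = 0" for f
    unfolding l2_inner_def by (rule integral_eq_zero_AE) (use that in \<open>auto elim!: eventually_mono\<close>)
  have "l2_inner (h2_fun u) (h2_fun u) = 0" "l2_inner (h2_D 1 u) (h2_D 1 u) = 0"
    by (rule zero, rule AE_I2, use assms Z(1) in simp)+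
  moreover have "l2_inner (h2_D 2 u) (h2_D 2 u) = 0" by (rule zero[OF Z(2)])
  ultimately have "inner u u = 0" unfolding inner_h2_l2 by simp
  then show ?thesis by simp
qed

lemma l2_inner_cong:
  assumes "\<And>t. t \<in> {0..pi} \<Longrightarrow> f t = g t" "f \<in> L2" "g \<in> L2" "h \<in> L2"
  shows "l2_inner f h = l2_inner g h"
  by (rule l2_inner_cong_AE[OF AE_I2]) (use assms in auto)

text \<open>The Wronskians of \<open>u\<close> with the two trigonometric solutions are constant.\<close>

lemma linearized_kernel:
  assumes k: "k \<ge> 1" and ode: "AE t in dom_measure. h2_D 2 u t = - sigma k * h2_fun u t"
    and orth: "coords k u = 0"
  shows "u = 0"
proof -
  let ?m = "2 * real k" and ?I = "{0..pi}"
  have m: "?m > 0" using k by simp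
  let ?g = "h2_D 1 u"
  have cont: "continuous_on ?I (\<lambda>t. - sigma k * h2_fun u t)"
    by (intro continuous_intros h2_fun_continuous)
  \<comment> \<open>The equation holds only almost everywhere, but a primitive ignores null sets.
    Thus u' is a primitive of a continuous function and the Wronskians can be differentiated at
    every point.\<close>
  have g_prim: "?g t = ?g 0 + integral {0..t} (\<lambda>t. - sigma k * h2_fun u t)" if t: "t \<in> ?I" for t
  proof -
    have "integral {0..t} (h2_D 2 u) = integral {0..t} (\<lambda>t. - sigma k * h2_fun u t)"
    proof -
      have "AE x in lebesgue. x \<in> ?I \<longrightarrow> h2_D 2 u x = - sigma k * h2_fun u x"
        using ode by (subst (asm) AE_restrict_space_iff) auto
      then obtain N where N: "N \<in> null_sets lebesgue"
        "\<And>x. x \<notin> N \<Longrightarrow> x \<in> ?I \<Longrightarrow> h2_D 2 u x = - sigma k * h2_fun u x"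
        by (rule AE_E3) auto
      have "negligible N" using N(1) by (simp add: negligible_iff_null_sets)
      then show ?thesis
        by (rule integral_spike) (use N(2) t in auto)
    qed
    then show ?thesis using h2_D1_primitive[OF t] by simp
  qed
  have dg: "(?g has_real_derivative - sigma k * h2_fun u t) (at t within ?I)" if "t \<in> ?I" for t
    by (rule primitive_has_derivative[OF cont g_prim that])
  have du: "(h2_fun u has_real_derivative ?g t) (at t within ?I)" if "t \<in> ?I" for t
    by (rule h2_fun_has_derivative[OF that])
  have dc: "(phi_cos k has_real_derivative - ?m * phi_sin k t) (at t within ?I)"
    "(phi_sin k has_real_derivative ?m * phi_cos k t) (at t within ?I)" for t
    by (rule has_field_derivative_at_within, rule phi_deriv)+
  have const: "\<exists>c. \<forall>t\<in>?I. W t = c"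
    if "\<And>t. t \<in> ?I \<Longrightarrow> (W has_real_derivative 0) (at t within ?I)" for W
  proof -
    have "(W has_derivative (\<lambda>h. 0)) (at t within ?I)" if "t \<in> ?I" for t
      using \<open>\<And>t. t \<in> ?I \<Longrightarrow> (W has_real_derivative 0) (at t within ?I)\<close>[OF that]
      by (simp add: has_field_derivative_def lambda_zero)
    then show ?thesis using has_derivative_zero_constant[of ?I W] by blast
  qed
  have "\<exists>A. \<forall>t\<in>?I. ?m * h2_fun u t * phi_cos k t - ?g t * phi_sin k t = A"
  proof (rule const)
    fix t assume t: "t \<in> ?I"
    have "((\<lambda>t. ?m * h2_fun u t * phi_cos k t - ?g t * phi_sin k t) has_real_derivative
        (?m * ?g t * phi_cos k t + (- ?m * phi_sin k t) * (?m * h2_fun u t))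
        - (- sigma k * h2_fun u t * phi_sin k t + (?m * phi_cos k t) * ?g t)) (at t within ?I)"
      by (intro DERIV_diff DERIV_mult DERIV_cmult du[OF t] dg[OF t] dc)
    then show "((\<lambda>t. ?m * h2_fun u t * phi_cos k t - ?g t * phi_sin k t) has_real_derivative 0) (at t within ?I)"
      by (rule DERIV_cong) (simp add: sigma_def power2_eq_square)
  qed
  then obtain A where A: "\<And>t. t \<in> ?I \<Longrightarrow> ?m * h2_fun u t * phi_cos k t - ?g t * phi_sin k t = A" by blast
  have "\<exists>B. \<forall>t\<in>?I. ?m * h2_fun u t * phi_sin k t + ?g t * phi_cos k t = B"
  proof (rule const)
    fix t assume t: "t \<in> ?I"
    have "((\<lambda>t. ?m * h2_fun u t * phi_sin k t + ?g t * phi_cos k t) has_real_derivative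
        (?m * ?g t * phi_sin k t + (?m * phi_cos k t) * (?m * h2_fun u t))
        + (- sigma k * h2_fun u t * phi_cos k t + (- ?m * phi_sin k t) * ?g t)) (at t within ?I)"
      by (intro DERIV_add DERIV_mult DERIV_cmult du[OF t] dg[OF t] dc)
    then show "((\<lambda>t. ?m * h2_fun u t * phi_sin k t + ?g t * phi_cos k t) has_real_derivative 0) (at t within ?I)"
      by (rule DERIV_cong) (simp add: sigma_def power2_eq_square)
  qed
  then obtain B where B: "\<And>t. t \<in> ?I \<Longrightarrow> ?m * h2_fun u t * phi_sin k t + ?g t * phi_cos k t = B" by blast
  \<comment> \<open>Solving the two Wronskian identities for u; the factor pi/2 comes from
    \<open>phi_cos\<close>^2 + \<open>phi_sin\<close>^2 = 2/pi.\<close>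
  define a b where "a = A * pi / (2 * ?m)" and "b = B * pi / (2 * ?m)"
  have u: "h2_fun u t = a * phi_cos k t + b * phi_sin k t" if t: "t \<in> ?I" for t
  proof -
    have "phi_cos k t * phi_cos k t + phi_sin k t * phi_sin k t
        = sqrt (2 / pi) * sqrt (2 / pi) * ((cos (2 * real k * t))\<^sup>2 + (sin (2 * real k * t))\<^sup>2)"
      by (simp only: phi_cos_def phi_sin_def power2_eq_square) (simp only: algebra_simps)
    then have pyth: "phi_cos k t * phi_cos k t + phi_sin k t * phi_sin k t = 2 / pi" by simp
    have "A * phi_cos k t + B * phi_sin k t
        = ?m * h2_fun u t * (phi_cos k t * phi_cos k t + phi_sin k t * phi_sin k t)"
      unfolding A[OF t, symmetric] B[OF t, symmetric] by (simp only: algebra_simps)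
    then show ?thesis using m unfolding pyth a_def b_def by (simp add: field_simps)
  qed
  have L2u: "(\<lambda>t. a * phi_cos k t + b * phi_sin k t) \<in> L2"
    by (intro L2_add L2_scale phi_L2)
  have "coords k u = (a, b)"
    using l2_inner_cong[OF u h2_fun_L2 L2u phi_L2(1)] l2_inner_cong[OF u h2_fun_L2 L2u phi_L2(2)]
      l2_inner_lincomb[OF phi_L2(1) phi_L2(2) phi_L2(1), of a k b k k]
      l2_inner_lincomb[OF phi_L2(1) phi_L2(2) phi_L2(2), of a k b k k]
    by (simp add: coords_def phi_orthonormal[OF k])
  then have "a = 0" "b = 0" using orth by (simp_all add: zero_prod_def)
  then show ?thesis using u by (intro h2_eq_0I) simp
qed

lemma open_rectangle_around:
  fixes x0 :: "'a::real_normed_vector" and l0 :: real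
  assumes "open W" "(l0, x0) \<in> W"
  obtains \<rho> where "\<rho> > 0" "\<And>l x. \<bar>l - l0\<bar> < \<rho> \<Longrightarrow> norm (x - x0) < \<rho> \<Longrightarrow> (l, x) \<in> W"
proof -
  obtain A B where AB: "open A" "open B" "l0 \<in> A" "x0 \<in> B" "A \<times> B \<subseteq> W"
    using open_prod_elim[OF assms] by (metis mem_Sigma_iff)
  obtain a b where "a > 0" "ball l0 a \<subseteq> A" "b > 0" "ball x0 b \<subseteq> B"
    using AB open_contains_ball by metis
  then show ?thesis using AB(5)
    by (intro that[of "min a b"]) (auto simp: subset_iff dist_norm norm_minus_commute abs_minus_commute)
qed

section \<open>The reduction in coordinates and the oddness of \<psi>\<close>

locale lyapunov_schmidt =
  fixes k :: nat and I :: "real set" and \<N> :: "h2 set" and \<O> :: "(real \<times> h2) set"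
    and \<psi> :: "real \<times> h2 \<Rightarrow> h2"
  assumes odd_k: "odd k" and LS: "LS_data k I \<N> \<O> \<psi>"
begin

abbreviation \<sigma> :: real where "\<sigma> \<equiv> sigma k"

definition S :: "(real \<times> real \<times> real) set" where
  "S = I \<times> (LL k -` \<N>)"

definition psiL :: "real \<times> real \<times> real \<Rightarrow> h2" where
  "psiL p = \<psi> (fst p, LL k (snd p))"

definition sol :: "real \<times> real \<times> real \<Rightarrow> h2" where
  "sol p = LL k (snd p) + psiL p"

text \<open>The reduced map with its linear part evaluated; it agrees with
  \<open>reduced_map\<close> on S, where the coordinates of \<open>sol p\<close> are known.\<close>

definition red :: "real \<times> real \<times> real \<Rightarrow> real \<times> real" where
  "red p = (fst p - \<sigma>) *\<^sub>R snd p + cubic k (sol p) (sol p) (sol p)"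

lemma k1: "k \<ge> 1"
  using odd_k by (cases k) auto

lemma LS_D:
  "open I" "\<sigma> \<in> I" "openin (top_of_set (ker k)) \<N>" "0 \<in> \<N>" "open \<O>" "(\<sigma>, 0) \<in> \<O>"
  "\<And>p. p \<in> S \<Longrightarrow> psiL p \<in> orthogonal_comp (ker k)"
  "smooth_on S psiL" "\<psi> (\<sigma>, 0) = 0"
  "\<And>lam x y. x \<in> ker k \<Longrightarrow> y \<in> orthogonal_comp (ker k) \<Longrightarrow>
      ((lam, x + y) \<in> \<O> \<and> (AE t in dom_measure. FF lam (x + y) t - QQ k (FF lam (x + y)) t = 0))
        \<longleftrightarrow> ((lam, x) \<in> I \<times> \<N> \<and> y = \<psi> (lam, x))"
proof -
  have eq: "psiL = (\<lambda>(lam, x). \<psi> (lam, LL k x))" by (auto simp: psiL_def)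
  note L = LS[unfolded LS_data_def]
  from L show "open I" "\<sigma> \<in> I" "openin (top_of_set (ker k)) \<N>" "0 \<in> \<N>" "open \<O>" "(\<sigma>, 0) \<in> \<O>"
    "smooth_on S psiL" "\<psi> (\<sigma>, 0) = 0" unfolding eq S_def by simp_all
  from L show "psiL p \<in> orthogonal_comp (ker k)" if "p \<in> S" for p
    using that by (auto simp: S_def psiL_def)
  from L show "((lam, x + y) \<in> \<O> \<and> (AE t in dom_measure. FF lam (x + y) t - QQ k (FF lam (x + y)) t = 0))
        \<longleftrightarrow> ((lam, x) \<in> I \<times> \<N> \<and> y = \<psi> (lam, x))"
    if "x \<in> ker k" "y \<in> orthogonal_comp (ker k)" for lam x y
    using that by blast
qed

lemma open_S: "open S"
proof -
  obtain T where T: "open T" "\<N> = ker k \<inter> T" using LS_D(3) by (auto simp: openin_open)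
  then have "LL k -` \<N> = LL k -` T" by (auto simp: LL_in_ker)
  moreover have "open (LL k -` T)"
    using T(1) by (intro continuous_open_vimage linear_continuous_at bounded_linear_LL)
  ultimately show ?thesis using LS_D(1) by (simp add: S_def open_Times)
qed

lemma LL_0: "LL k 0 = 0"
  using linear_0[OF linear_LL] .

lemma base_in_S: "(\<sigma>, 0) \<in> S"
  using LS_D(2,4) LL_0 by (simp add: S_def)

lemma psiL_base: "psiL (\<sigma>, 0) = 0"
  using LS_D(9) LL_0 by (simp add: psiL_def)

lemma coords_psiL: "p \<in> S \<Longrightarrow> coords k (psiL p) = 0"
  using LS_D(7) orthogonal_comp_ker_coords by blast

lemma coords_sol: "p \<in> S \<Longrightarrow> coords k (sol p) = snd p"
  using coords_psiL linear_add[OF linear_coords] by (simp add: sol_def coords_LL[OF k1])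

lemma sol_equation:
  assumes "p \<in> S"
  shows "(fst p, sol p) \<in> \<O>"
    "AE t in dom_measure. FF (fst p) (sol p) t = QQ k (FF (fst p) (sol p)) t"
proof -
  have "(fst p, LL k (snd p)) \<in> I \<times> \<N>" "psiL p = \<psi> (fst p, LL k (snd p))"
    using assms by (auto simp: S_def psiL_def)
  then have "(fst p, sol p) \<in> \<O> \<and> (AE t in dom_measure. FF (fst p) (sol p) t - QQ k (FF (fst p) (sol p)) t = 0)"
    unfolding sol_def using LS_D(10)[OF LL_in_ker LS_D(7)[OF assms]] by blast
  then show "(fst p, sol p) \<in> \<O>"
    "AE t in dom_measure. FF (fst p) (sol p) t = QQ k (FF (fst p) (sol p)) t" by simp_all
qed

text \<open>The uniqueness half of the reduction for an arbitrary v: its kernel part and orthogonal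
  part are produced by \<open>coords\<close>. Both the oddness of \<psi> and the exhaustion of all
  solutions rest on it.\<close>

lemma sol_unique:
  assumes "(lam, v) \<in> \<O>" "AE t in dom_measure. FF lam v t = QQ k (FF lam v) t"
  shows "(lam, coords k v) \<in> S" "v = sol (lam, coords k v)"
proof -
  define x y where "x = LL k (coords k v)" and "y = v - x"
  have v: "v = x + y" by (simp add: y_def)
  have "coords k y = 0"
    using linear_diff[OF linear_coords] by (simp add: y_def x_def coords_LL[OF k1])
  then have y: "y \<in> orthogonal_comp (ker k)" by (simp add: orthogonal_comp_ker_coords)
  have x: "x \<in> ker k" by (simp add: x_def LL_in_ker)
  have "(lam, v) \<in> \<O> \<and> (AE t in dom_measure. FF lam v t - QQ k (FF lam v) t = 0)"
    using assms by simp
  then have "(lam, x) \<in> I \<times> \<N> \<and> y = \<psi> (lam, x)"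
    unfolding v by (rule iffD1[OF LS_D(10)[OF x y]])
  then have *: "lam \<in> I" "LL k (coords k v) \<in> \<N>" "v - LL k (coords k v) = \<psi> (lam, LL k (coords k v))"
    by (simp_all add: x_def y_def)
  then show "(lam, coords k v) \<in> S" by (simp add: S_def)
  show "v = sol (lam, coords k v)" by (simp add: sol_def psiL_def flip: *(3))
qed

lemma FF_components: "p \<in> S \<Longrightarrow>
  (l2_inner (FF (fst p) (sol p)) (phi_cos k), l2_inner (FF (fst p) (sol p)) (phi_sin k)) = red p"
  by (simp only: l2_inner_FF_phi coords_sol red_def)

lemma reduced_map_eq:
  assumes "p \<in> S"
  shows "reduced_map k \<psi> p = red p"
  unfolding FF_components[OF assms, symmetric] reduced_map_def split_beta
  by (simp add: l2_inner_QQ[OF k1] sol_def psiL_def)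

lemma reduced_zeros_eq: "reduced_zeros k I \<N> \<psi> = {p \<in> S. red p = 0}"
  unfolding reduced_zeros_def S_def[symmetric] using reduced_map_eq by auto

lemma Psi_eq: "Psi k \<psi> p = (fst p, sol p)"
  by (simp add: Psi_def split_beta sol_def psiL_def)

text \<open>By construction \<open>sol p\<close> solves the equation up to its projection on the
  kernel, so only the two kernel components remain, and these are \<open>red p\<close>.\<close>

lemma is_solution_sol_iff:
  assumes "p \<in> S"
  shows "is_solution (fst p) (sol p) \<longleftrightarrow> red p = 0"
proof
  assume "is_solution (fst p) (sol p)"
  then have AE0: "AE t in dom_measure. FF (fst p) (sol p) t = 0 * phi_cos k t"
    by (simp add: is_solution_iff)
  have "l2_inner (FF (fst p) (sol p)) h = 0" if "h \<in> L2" for h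
    using l2_inner_cong_AE[OF AE0 FF_L2 L2_scale[OF phi_L2(1)] that]
      l2_inner_scale[of 0 "phi_cos k" h] by simp
  then show "red p = 0"
    unfolding FF_components[OF assms, symmetric] by (simp add: phi_L2 zero_prod_def)
next
  assume "red p = 0"
  then have "QQ k (FF (fst p) (sol p)) = (\<lambda>t. 0)"
    unfolding FF_components[OF assms, symmetric] QQ_def by (simp add: zero_prod_def)
  then show "is_solution (fst p) (sol p)"
    using sol_equation(2)[OF assms] by (simp add: is_solution_iff)
qed

lemma solution_in_O:
  assumes "(lam, v) \<in> \<O>" "is_solution lam v"
  shows "(lam, coords k v) \<in> S" "v = sol (lam, coords k v)" "red (lam, coords k v) = 0"
proof -
  have AE0: "AE t in dom_measure. FF lam v t = 0 * phi_cos k t"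
    using assms(2) by (simp add: is_solution_iff)
  have "l2_inner (FF lam v) h = 0" if "h \<in> L2" for h
    using l2_inner_cong_AE[OF AE0 FF_L2 L2_scale[OF phi_L2(1)] that]
      l2_inner_scale[of 0 "phi_cos k" h] by simp
  then have "QQ k (FF lam v) = (\<lambda>t. 0)" by (simp add: QQ_def phi_L2)
  then have "AE t in dom_measure. FF lam v t = QQ k (FF lam v) t" using AE0 by simp
  from sol_unique[OF assms(1) this] show p: "(lam, coords k v) \<in> S" "v = sol (lam, coords k v)" .
  show "red (lam, coords k v) = 0"
    using is_solution_sol_iff[OF p(1)] p(2) assms(2) by simp
qed

lemma continuous_on_psiL: "continuous_on S psiL"
  by (rule smooth_on_continuous[OF LS_D(8)])

lemma continuous_on_sol: "continuous_on S sol"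
  unfolding sol_def[abs_def]
  by (intro continuous_intros continuous_on_psiL
      bounded_linear.continuous_on[OF bounded_linear_LL])

lemma isCont_on_S: "continuous_on S f \<Longrightarrow> p \<in> S \<Longrightarrow> isCont f p"
  using open_S continuous_on_eq_continuous_at by blast

lemma FF_minus: "AE t in dom_measure. FF lam (- u) t = - 1 * FF lam u t"
proof -
  have "AE t in dom_measure. h2_D 2 (- u) t = - h2_D 2 u t"
    using h2_D_scaleR[of 2 "-1" u] by simp
  then show ?thesis
    by (rule eventually_mono) (simp add: FF_def h2_fun_uminus algebra_simps)
qed

text \<open>The negative of \<open>sol (lam, x)\<close> solves the same projected equation, because
  the nonlinearity is odd, and has coordinates -x. Uniqueness identifies it with
  \<open>sol (lam, - x)\<close>.\<close>

lemma psiL_odd_near_base: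
  obtains r where "r > 0"
    "\<And>lam x. \<bar>lam - \<sigma>\<bar> < r \<Longrightarrow> norm x < r \<Longrightarrow> (lam, x) \<in> S \<and> psiL (lam, - x) = - psiL (lam, x)"
proof -
  \<comment> \<open>The set \<O> is not assumed symmetric; on W the negative still belongs to
    it.\<close>
  define W where "W = {p \<in> S. (fst p, - sol p) \<in> \<O>}"
  have "open W"
  proof -
    have "continuous_on S (\<lambda>p. (fst p, - sol p))"
      by (intro continuous_intros continuous_on_sol)
    then have "open (S \<inter> (\<lambda>p. (fst p, - sol p)) -` \<O>)"
      using open_S LS_D(5) by (simp add: continuous_on_open_vimage Int_commute)
    then show ?thesis by (simp add: W_def vimage_def Int_def)
  qed
  moreover have "(\<sigma>, 0) \<in> W"
    using base_in_S LS_D(6) psiL_base LL_0 by (simp add: W_def sol_def)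
  ultimately obtain r where r: "r > 0"
    "\<And>l x. \<bar>l - \<sigma>\<bar> < r \<Longrightarrow> norm (x - 0) < r \<Longrightarrow> (l, x) \<in> W"
    by (rule open_rectangle_around) blast
  show ?thesis
  proof (rule that[OF r(1)])
    fix lam x assume "\<bar>lam - \<sigma>\<bar> < r" "norm (x :: real \<times> real) < r"
    then have W: "(lam, x) \<in> S" "(lam, - sol (lam, x)) \<in> \<O>"
      using r(2)[of lam x] by (auto simp: W_def)
    let ?u = "sol (lam, x)"
    have QQ: "QQ k (FF lam (- ?u)) t = - QQ k (FF lam ?u) t" for t
      using l2_inner_cong_AE[OF FF_minus FF_L2 L2_scale[OF FF_L2], of _ lam ?u]
        l2_inner_scale[of "-1" "FF lam ?u"] by (simp add: QQ_def phi_L2)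
    have "AE t in dom_measure. FF lam (- ?u) t = QQ k (FF lam (- ?u)) t"
      using FF_minus[of lam ?u] sol_equation(2)[OF W(1)] by eventually_elim (simp add: QQ)
    from sol_unique(2)[OF W(2) this]
    have "- ?u = sol (lam, - x)"
      using coords_sol[OF W(1)] linear_neg[OF linear_coords] by simp
    then have "psiL (lam, - x) = - psiL (lam, x)"
      using linear_neg[OF linear_LL, of k x] by (simp add: sol_def)
    then show "(lam, x) \<in> S \<and> psiL (lam, - x) = - psiL (lam, x)" using W(1) by simp
  qed
qed

end

text \<open>The operator u'' + \<lambda> u tested against f. For f in \<open>L2\<close> it is a
  bounded functional on H^2, hence passes to limits of difference quotients.\<close>

definition lin_form :: "(real \<Rightarrow> real) \<Rightarrow> real \<Rightarrow> h2 \<Rightarrow> real" where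
  "lin_form f lam u = l2_inner (h2_D 2 u) f + lam * l2_inner (h2_fun u) f"

lemma bounded_linear_lin_form:
  assumes f: "f \<in> L2"
  shows "bounded_linear (lin_form f lam)"
proof (rule bounded_linear_intro[of _ "(1 + \<bar>lam\<bar>) * l2_norm f"])
  have D2: "h2_D 2 u \<in> L2" for u by (intro h2_D_L2) simp
  show "lin_form f lam (u + v) = lin_form f lam u + lin_form f lam v" for u v
    using l2_inner_cong_AE[OF h2_D_add[of 2 u v] D2 L2_add[OF D2 D2] f]
    by (simp add: lin_form_def l2_inner_add[OF D2 D2 f] l2_inner_add[OF h2_fun_L2 h2_fun_L2 f]
        h2_fun_add algebra_simps)
  show "lin_form f lam (c *\<^sub>R u) = c *\<^sub>R lin_form f lam u" for c u
    using l2_inner_cong_AE[OF h2_D_scaleR[of 2 c u] D2 L2_scale[OF D2] f]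
    by (simp add: lin_form_def l2_inner_scale h2_fun_scaleR algebra_simps)
  fix u
  have "\<bar>lin_form f lam u\<bar> \<le> \<bar>l2_inner (h2_D 2 u) f\<bar> + \<bar>lam\<bar> * \<bar>l2_inner (h2_fun u) f\<bar>"
    unfolding lin_form_def by (metis abs_mult abs_triangle_ineq)
  also have "\<dots> \<le> norm u * l2_norm f + \<bar>lam\<bar> * (norm u * l2_norm f)"
  proof (intro add_mono mult_left_mono)
    show "\<bar>l2_inner (h2_D 2 u) f\<bar> \<le> norm u * l2_norm f"
      using l2_Cauchy_Schwarz[OF D2 f] mult_right_mono[OF l2_norm_h2_D_le(3)[of u] l2_norm_nonneg[of f]]
      by (rule order_trans)
    show "\<bar>l2_inner (h2_fun u) f\<bar> \<le> norm u * l2_norm f"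
      using l2_Cauchy_Schwarz[OF h2_fun_L2 f] mult_right_mono[OF l2_norm_h2_D_le(1)[of u] l2_norm_nonneg[of f]]
      by (rule order_trans)
  qed simp
  finally show "norm (lin_form f lam u) \<le> norm u * ((1 + \<bar>lam\<bar>) * l2_norm f)"
    by (simp add: algebra_simps)
qed

lemma l2_inner_self_eq_0:
  assumes "f \<in> L2" "l2_inner f f = 0"
  shows "AE t in dom_measure. f t = 0"
proof -
  have "AE t in dom_measure. f t * f t = 0"
    using integral_nonneg_eq_0_iff_AE[OF L2_mult_integrable[OF assms(1,1)]] assms(2)
    by (simp add: l2_inner_def)
  then show ?thesis by simp
qed

context lyapunov_schmidt
begin

text \<open>The difference quotients q of \<psi> along e converge to v in H^2. Dividing the
  projected equation by \<tau> leaves a cubic term of order \<tau>^2, so v'' + \<sigma> v is zero in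
  the limit. Thus v solves the linear equation with zero kernel coordinates, and
  \<open>linearized_kernel\<close> applies.\<close>

lemma pd_base_zero: "pd (0, e) psiL (\<sigma>, 0) = 0"
proof -
  define v where "v = pd (0, e) psiL (\<sigma>, 0)"
  define q where "q \<tau> = (1 / \<tau>) *\<^sub>R psiL (\<sigma>, \<tau> *\<^sub>R e)" for \<tau> :: real
  have der: "((\<lambda>\<tau>. psiL (\<sigma>, \<tau> *\<^sub>R e)) has_vector_derivative v) (at 0)"
    unfolding v_def using pd_line[OF LS_D(8), of \<sigma> 0 e] base_in_S by simp
  have q_lim: "(q \<longlongrightarrow> v) (at 0)"
  proof (rule Lim_null[THEN iffD2], rule tendsto_norm_zero_cancel)
    have "((\<lambda>h. norm (psiL (\<sigma>, (0 + h) *\<^sub>R e) - psiL (\<sigma>, 0 *\<^sub>R e) - h *\<^sub>R v) / norm h) \<longlongrightarrow> 0) (at 0)"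
      using der unfolding has_vector_derivative_def has_derivative_at by blast
    moreover have "\<forall>\<^sub>F h in at 0. norm (psiL (\<sigma>, (0 + h) *\<^sub>R e) - psiL (\<sigma>, 0 *\<^sub>R e) - h *\<^sub>R v) / norm h
        = norm (q h - v)"
      unfolding eventually_at_filter
    proof (intro always_eventually allI impI)
      fix h :: real assume h: "h \<noteq> 0"
      have "q h - v = (1 / h) *\<^sub>R (psiL (\<sigma>, h *\<^sub>R e) - h *\<^sub>R v)"
        using h by (simp add: q_def scaleR_diff_right)
      then show "norm (psiL (\<sigma>, (0 + h) *\<^sub>R e) - psiL (\<sigma>, 0 *\<^sub>R e) - h *\<^sub>R v) / norm h = norm (q h - v)"
        by (simp add: psiL_base)
    qed
    ultimately show "((\<lambda>h. norm (q h - v)) \<longlongrightarrow> 0) (at 0)"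
      by (rule Lim_transform_eventually)
  qed
  obtain \<rho> where \<rho>: "\<rho> > 0" "\<And>l x. \<bar>l - \<sigma>\<bar> < \<rho> \<Longrightarrow> norm (x - 0) < \<rho> \<Longrightarrow> (l, x) \<in> S"
    by (rule open_rectangle_around[OF open_S base_in_S]) blast
  have ev_S: "\<forall>\<^sub>F \<tau> in at 0. (\<sigma>, \<tau> *\<^sub>R e) \<in> S"
  proof -
    have "((\<lambda>\<tau>. norm (\<tau> *\<^sub>R e)) \<longlongrightarrow> norm (0 *\<^sub>R e)) (at (0::real))"
      by (intro tendsto_intros)
    then have "\<forall>\<^sub>F \<tau> in at (0::real). norm (\<tau> *\<^sub>R e) < \<rho>"
      using \<rho>(1) by (intro order_tendstoD) auto
    then show ?thesis
      by (rule eventually_mono) (use \<rho> in auto)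
  qed
  have coords_v: "coords k v = 0"
  proof -
    have "((\<lambda>\<tau>. coords k (q \<tau>)) \<longlongrightarrow> coords k v) (at 0)"
      by (intro bounded_linear.tendsto[OF bounded_linear_coords[OF k1]] q_lim)
    moreover have "\<forall>\<^sub>F \<tau> in at 0. coords k (q \<tau>) = 0"
      using ev_S by (rule eventually_mono)
        (use coords_psiL linear_scale[OF linear_coords] in \<open>simp add: q_def\<close>)
    then have "((\<lambda>\<tau>. coords k (q \<tau>)) \<longlongrightarrow> 0) (at 0)" by (rule tendsto_eventually)
    ultimately show ?thesis by (rule tendsto_unique[rotated]) simp
  qed
  \<comment> \<open>The test function is the expression to be shown zero. Being orthogonal to the
    kernel, it removes the unknown projection \<open>QQ\<close> from the equation.\<close>
  define f where "f t = h2_D 2 v t + \<sigma> * h2_fun v t" for t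
  have D2: "h2_D 2 u \<in> L2" for u by (intro h2_D_L2) simp
  have f: "f \<in> L2"
    unfolding f_def[abs_def] by (intro L2_add L2_scale D2 h2_fun_L2)
  have f_inner: "l2_inner f h = l2_inner (h2_D 2 v) h + \<sigma> * l2_inner (h2_fun v) h" if "h \<in> L2" for h
    using l2_inner_lincomb[OF D2 h2_fun_L2 that, of 1 v \<sigma> v] by (simp add: f_def[abs_def])
  have f_orth: "l2_inner (phi_cos k) f = 0" "l2_inner (phi_sin k) f = 0"
    using f_inner[OF phi_L2(1)] f_inner[OF phi_L2(2)]
    by (simp_all add: l2_inner_D2_phi l2_inner_commute[of _ f])
  let ?B = "lin_form f \<sigma>"
  note B = bounded_linear_lin_form[OF f, of \<sigma>]
  have B_LL: "?B (LL k x) = 0" for x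
  proof -
    have "?B (Abs_h2 (phi_cos k)) = 0" "?B (Abs_h2 (phi_sin k)) = 0"
      using l2_inner_cong_AE[OF h2_D_Abs_phi(2) D2 L2_scale[OF phi_L2(1)] f]
        l2_inner_cong_AE[OF h2_D_Abs_phi(4) D2 L2_scale[OF phi_L2(2)] f]
        l2_inner_scale[of "- \<sigma>" "phi_cos k" f] l2_inner_scale[of "- \<sigma>" "phi_sin k" f]
      by (simp_all add: lin_form_def h2_fun_Abs_phi f_orth)
    then show ?thesis
      using bounded_linear.linear[OF B] by (simp add: LL_eq linear_add linear_scale)
  qed
  define w where "w \<tau> = LL k e + q \<tau>" for \<tau>
  \<comment> \<open>The kernel part of the solution is annihilated by the form, so only q remains on
    the left; the three factors \<tau> of the cubic term are reduced to two by the division.\<close>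
  have B_q: "?B (q \<tau>) = - \<tau>\<^sup>2 * trilin f (w \<tau>) (w \<tau>) (w \<tau>)"
    if \<tau>: "\<tau> \<noteq> 0" "(\<sigma>, \<tau> *\<^sub>R e) \<in> S" for \<tau>
  proof -
    let ?u = "sol (\<sigma>, \<tau> *\<^sub>R e)"
    have u: "?u = \<tau> *\<^sub>R w \<tau>"
      using \<tau>(1) linear_scale[OF linear_LL] by (simp add: sol_def w_def q_def scaleR_add_right)
    have "l2_inner (FF \<sigma> ?u) f = l2_inner (QQ k (FF \<sigma> ?u)) f"
      using sol_equation(2)[OF \<tau>(2)] by (intro l2_inner_cong_AE FF_L2 QQ_L2 f) simp
    also have "\<dots> = 0"
      unfolding QQ_def using l2_inner_lincomb[OF phi_L2(1) phi_L2(2) f] by (simp add: f_orth)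
    finally have "?B ?u = - trilin f ?u ?u ?u"
      by (simp add: l2_inner_FF[OF f] lin_form_def)
    moreover have "trilin f ?u ?u ?u = \<tau> * \<tau> * \<tau> * trilin f (w \<tau>) (w \<tau>) (w \<tau>)"
      unfolding u by (simp only: trilin_scale trilin_sym(1)[of f "w \<tau>" "\<tau> *\<^sub>R w \<tau>"]
          trilin_sym(2)[of f "w \<tau>" "w \<tau>" "\<tau> *\<^sub>R w \<tau>"] mult.assoc)
    moreover have "?B ?u = \<tau> * ?B (q \<tau>)"
      unfolding u using bounded_linear.linear[OF B]
      by (simp add: w_def linear_add linear_scale B_LL)
    ultimately have "\<tau> * ?B (q \<tau>) = \<tau> * (- \<tau>\<^sup>2 * trilin f (w \<tau>) (w \<tau>) (w \<tau>))"
      by (simp add: power2_eq_square mult_ac)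
    then show ?thesis using \<tau>(1) by (simp only: mult_cancel_left simp_thms)
  qed
  have "((?B \<circ> q) \<longlongrightarrow> 0) (at 0)"
  proof (rule Lim_null_comparison)
    have "\<forall>\<^sub>F \<tau> in at 0. \<tau> \<noteq> (0::real)" by (simp add: eventually_at_filter)
    then show "\<forall>\<^sub>F \<tau> in at 0. norm ((?B \<circ> q) \<tau>)
        \<le> \<tau>\<^sup>2 * (54 * l2_norm f * (norm (w \<tau>) * norm (w \<tau>) * norm (w \<tau>)))"
      using ev_S
      by eventually_elim
        (auto simp: B_q abs_mult intro!: mult_left_mono order_trans[OF trilin_bound[OF f]])
    have "((\<lambda>\<tau>. \<tau>\<^sup>2 * (54 * l2_norm f * (norm (w \<tau>) * norm (w \<tau>) * norm (w \<tau>)))) \<longlongrightarrow>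
        0\<^sup>2 * (54 * l2_norm f * (norm (LL k e + v) * norm (LL k e + v) * norm (LL k e + v)))) (at 0)"
      unfolding w_def by (intro tendsto_intros q_lim)
    then show "((\<lambda>\<tau>. \<tau>\<^sup>2 * (54 * l2_norm f * (norm (w \<tau>) * norm (w \<tau>) * norm (w \<tau>)))) \<longlongrightarrow> 0) (at 0)"
      by simp
  qed
  moreover have "((?B \<circ> q) \<longlongrightarrow> ?B v) (at 0)"
    unfolding o_def by (intro bounded_linear.tendsto[OF B] q_lim)
  ultimately have "?B v = 0" by (intro tendsto_unique[of "at 0"]) auto
  then have "l2_inner f f = 0" using f_inner[OF f] by (simp add: lin_form_def)
  then have "AE t in dom_measure. f t = 0" by (rule l2_inner_self_eq_0[OF f])
  then have "AE t in dom_measure. h2_D 2 v t = - \<sigma> * h2_fun v t"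
    by (rule eventually_mono) (simp add: f_def)
  then show ?thesis
    using linearized_kernel[OF k1 _ coords_v] by (simp add: v_def)
qed

lemma continuous_on_pd_psiL: "continuous_on S (pd v psiL)"
  by (intro smooth_on_continuous smooth_on_pd LS_D(8))

text \<open>Oddness at x = 0 gives \<open>psiL (lam, 0) = 0\<close> for every \<lambda> near
  \<sigma>. The x-derivative vanishes at the base point, so it is at most \<epsilon> nearby, and the
  mean value inequality along the ray to x gives the last bound.\<close>

lemma psiL_small:
  assumes \<epsilon>: "\<epsilon> > 0"
  obtains \<rho> where "\<rho> > 0"
    "\<And>lam x. \<bar>lam - \<sigma>\<bar> < \<rho> \<Longrightarrow> norm x < \<rho> \<Longrightarrow> (lam, x) \<in> S"
    "\<And>lam x y. \<bar>lam - \<sigma>\<bar> < \<rho> \<Longrightarrow> norm x < \<rho> \<Longrightarrow> norm (pd (0, y) psiL (lam, x)) \<le> \<epsilon> * norm y"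
    "\<And>lam x. \<bar>lam - \<sigma>\<bar> < \<rho> \<Longrightarrow> norm x < \<rho> \<Longrightarrow> norm (psiL (lam, x)) \<le> \<epsilon> * norm x"
proof -
  obtain r where r: "r > 0"
    "\<And>lam x. \<bar>lam - \<sigma>\<bar> < r \<Longrightarrow> norm x < r \<Longrightarrow> (lam, x) \<in> S \<and> psiL (lam, - x) = - psiL (lam, x)"
    by (rule psiL_odd_near_base) blast
  have zero: "psiL (lam, 0) = 0" if "\<bar>lam - \<sigma>\<bar> < r" for lam
  proof -
    have "psiL (lam, 0) = - psiL (lam, 0)" using r(2)[of lam 0] that r(1) by simp
    then have "2 *\<^sub>R psiL (lam, 0) = 0" by (metis scaleR_2 add.right_inverse)
    then show ?thesis by simp
  qed
  define g where "g p = norm (pd (0, 1, 0) psiL p) + norm (pd (0, 0, 1) psiL p)" for p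
  have g_cont: "continuous_on S g"
    unfolding g_def[abs_def] by (intro continuous_intros continuous_on_pd_psiL)
  have g_base: "g (\<sigma>, 0) = 0" by (simp add: g_def pd_base_zero)
  define W where "W = S \<inter> g -` {..<\<epsilon>}"
  have "open W"
    unfolding W_def by (rule continuous_open_preimage[OF g_cont open_S open_lessThan])
  moreover have "(\<sigma>, 0) \<in> W" using base_in_S g_base \<epsilon> by (simp add: W_def)
  ultimately obtain \<rho> where \<rho>: "\<rho> > 0"
    "\<And>l x. \<bar>l - \<sigma>\<bar> < \<rho> \<Longrightarrow> norm (x - 0) < \<rho> \<Longrightarrow> (l, x) \<in> W"
    by (rule open_rectangle_around) blast
  have pd_le: "norm (pd (0, y) psiL (lam, x)) \<le> \<epsilon> * norm y"
    if "\<bar>lam - \<sigma>\<bar> < \<rho>" "norm x < \<rho>" for lam x y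
  proof -
    have W: "(lam, x) \<in> S" "g (lam, x) \<le> \<epsilon>"
      using \<rho>(2)[of lam x] that by (auto simp: W_def)
    have "norm (pd (0, y) psiL (lam, x))
        \<le> \<bar>fst y\<bar> * norm (pd (0, 1, 0) psiL (lam, x)) + \<bar>snd y\<bar> * norm (pd (0, 0, 1) psiL (lam, x))"
      unfolding pd_snd_expand(2)[OF LS_D(8) W(1), of y]
      by (rule norm_triangle_le) simp
    also have "\<dots> \<le> norm y * norm (pd (0, 1, 0) psiL (lam, x)) + norm y * norm (pd (0, 0, 1) psiL (lam, x))"
      using norm_fst_le[of "fst y" "snd y"] norm_snd_le[of "snd y" "fst y"]
      by (intro add_mono mult_right_mono) auto
    also have "\<dots> = norm y * g (lam, x)" by (simp add: g_def distrib_left)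
    also have "\<dots> \<le> norm y * \<epsilon>" using W(2) by (intro mult_left_mono) auto
    finally show ?thesis by (simp add: mult.commute)
  qed
  show ?thesis
  proof (rule that[of "min r \<rho>"])
    show "min r \<rho> > 0" using r(1) \<rho>(1) by simp
    show "(lam, x) \<in> S" if "\<bar>lam - \<sigma>\<bar> < min r \<rho>" "norm x < min r \<rho>" for lam x
      using r(2) that by simp
    show "norm (pd (0, y) psiL (lam, x)) \<le> \<epsilon> * norm y"
      if "\<bar>lam - \<sigma>\<bar> < min r \<rho>" "norm x < min r \<rho>" for lam x y
      using pd_le that by simp
    fix lam x assume lx: "\<bar>lam - \<sigma>\<bar> < min r \<rho>" "norm (x :: real \<times> real) < min r \<rho>"
    have in_ball: "norm (\<tau> *\<^sub>R x) < min r \<rho>" if "0 \<le> \<tau>" "\<tau> \<le> 1" for \<tau>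
      using lx(2) mult_right_mono[of \<tau> 1 "norm x"] that by simp
    have d: "((\<lambda>\<tau>. psiL (lam, \<tau> *\<^sub>R x)) has_vector_derivative pd (0, x) psiL (lam, \<tau> *\<^sub>R x)) (at \<tau>)"
      if "0 \<le> \<tau>" "\<tau> \<le> 1" for \<tau>
      using r(2) lx(1) in_ball[OF that] by (intro pd_line[OF LS_D(8)]) simp
    have "norm (psiL (lam, 1 *\<^sub>R x) - psiL (lam, 0 *\<^sub>R x)) \<le> \<epsilon> * norm x * 1 - \<epsilon> * norm x * 0"
    proof (rule differentiable_bound_general[where \<phi>' = "\<lambda>\<tau>. \<epsilon> * norm x"
          and f' = "\<lambda>\<tau>. pd (0, x) psiL (lam, \<tau> *\<^sub>R x)"])
      fix \<tau> :: real assume \<tau>: "0 < \<tau>" "\<tau> < 1"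
      show "((\<lambda>\<tau>. psiL (lam, \<tau> *\<^sub>R x)) has_vector_derivative pd (0, x) psiL (lam, \<tau> *\<^sub>R x)) (at \<tau>)"
        using \<tau> by (intro d) auto
      show "norm (pd (0, x) psiL (lam, \<tau> *\<^sub>R x)) \<le> \<epsilon> * norm x"
        using \<tau> lx(1) in_ball[of \<tau>] by (intro pd_le) auto
    next
      show "continuous_on {0..1} (\<lambda>\<tau>. psiL (lam, \<tau> *\<^sub>R x))"
        by (intro continuous_at_imp_continuous_on ballI has_vector_derivative_continuous[OF d]) auto
      show "((*) (\<epsilon> * norm x) has_vector_derivative \<epsilon> * norm x) (at \<tau>)" for \<tau>
        by (auto intro!: derivative_eq_intros)
    qed (auto intro!: continuous_intros)
    then show "norm (psiL (lam, x)) \<le> \<epsilon> * norm x" using zero[of lam] lx(1) by simp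
  qed
qed

end


section \<open>Rescaling near the bifurcation point\<close>

context lyapunov_schmidt
begin

text \<open>
  The prefix \<open>r\<close> marks objects in the rescaled variable \<open>y = x / ampl \<lambda>\<close>. They carry information
  only for \<open>\<lambda> < \<sigma>\<close>, where \<open>ampl\<close> is positive.
\<close>

definition ampl :: "real \<Rightarrow> real" where
  "ampl lam = sqrt (\<sigma> - lam)"

definition rpsi :: "real \<times> real \<times> real \<Rightarrow> h2" where
  "rpsi p = (1 / ampl (fst p)) *\<^sub>R psiL (fst p, ampl (fst p) *\<^sub>R snd p)"

definition rsol :: "real \<times> real \<times> real \<Rightarrow> h2" where
  "rsol p = LL k (snd p) + rpsi p"

definition rmap :: "real \<times> real \<times> real \<Rightarrow> real \<times> real" where
  "rmap p = - snd p + cubic k (rsol p) (rsol p) (rsol p)"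

definition rdom :: "(real \<times> real \<times> real) set" where
  "rdom = {(l, y). l < \<sigma> \<and> (l, ampl l *\<^sub>R y) \<in> S}"

text \<open>The \<lambda>-derivative of \<open>rpsi\<close>. As the derivative of
  \<open>ampl\<close> is -1/(2 \<open>ampl\<close>), differentiating the prefactor and the argument
  yields two terms of the same singular order, collected in the second bracket.\<close>

definition rpsi_lam :: "real \<times> real \<times> real \<Rightarrow> h2" where
  "rpsi_lam = (\<lambda>(l, y). (1 / ampl l) *\<^sub>R pd (1, 0) psiL (l, ampl l *\<^sub>R y)
     - (1 / (2 * ampl l ^ 3)) *\<^sub>R (pd (0, ampl l *\<^sub>R y) psiL (l, ampl l *\<^sub>R y) - psiL (l, ampl l *\<^sub>R y)))"

lemma ampl_pos: "l < \<sigma> \<Longrightarrow> ampl l > 0"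
  by (simp add: ampl_def)

lemma ampl_square: "l < \<sigma> \<Longrightarrow> ampl l * ampl l = \<sigma> - l"
  by (simp add: ampl_def)

lemma sol_rescaled:
  assumes "l < \<sigma>"
  shows "sol (l, ampl l *\<^sub>R y) = ampl l *\<^sub>R rsol (l, y)"
  using ampl_pos[OF assms] linear_scale[OF linear_LL]
  by (simp add: sol_def rsol_def rpsi_def scaleR_add_right)

lemma cubic_scale_all: "cubic k (c *\<^sub>R u) (c *\<^sub>R u) (c *\<^sub>R u) = c ^ 3 *\<^sub>R cubic k u u u"
  by (simp add: cubic_scale power3_eq_cube)

text \<open>Since \<lambda> - \<sigma> = -\<open>ampl\<close>^2, the linear and the cubic term both
  scale with the third power of \<open>ampl\<close>.\<close>

lemma red_rescaled:
  assumes "l < \<sigma>"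
  shows "red (l, ampl l *\<^sub>R y) = ampl l ^ 3 *\<^sub>R rmap (l, y)"
proof -
  have "ampl l ^ 3 = (\<sigma> - l) * ampl l"
    by (simp only: power3_eq_cube ampl_square[OF assms])
  then have "(l - \<sigma>) * ampl l = - (ampl l ^ 3)" by (simp add: algebra_simps)
  then show ?thesis
    by (simp add: red_def sol_rescaled[OF assms] cubic_scale_all rmap_def
        scaleR_add_right scaleR_diff_right)
qed

lemma red_zero_iff_rmap: "l < \<sigma> \<Longrightarrow> red (l, ampl l *\<^sub>R y) = 0 \<longleftrightarrow> rmap (l, y) = 0"
  using ampl_pos[of l] by (simp add: red_rescaled)

lemma ampl_has_derivative:
  assumes "fst p < \<sigma>"
  shows "((\<lambda>p. ampl (fst p)) has_derivative (\<lambda>h. - fst h / (2 * ampl (fst p)))) (at p)"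
  unfolding ampl_def using assms
  by (auto intro!: derivative_eq_intros simp: fun_eq_iff divide_simps)

lemma rpsi_has_derivative:
  assumes "(l, y) \<in> rdom"
  shows "(rpsi has_derivative (\<lambda>(h, d). h *\<^sub>R rpsi_lam (l, y) + pd (0, d) psiL (l, ampl l *\<^sub>R y))) (at (l, y))"
proof -
  have l: "l < \<sigma>" and inS: "(l, ampl l *\<^sub>R y) \<in> S" using assms by (auto simp: rdom_def)
  note s = ampl_pos[OF l]
  let ?q = "(l, ampl l *\<^sub>R y)"
  note L = linear_pd[OF LS_D(8) inS]
  note ds = ampl_has_derivative[of "(l, y)", simplified, OF l]
  have inner: "((\<lambda>p. (fst p, ampl (fst p) *\<^sub>R snd p)) has_derivative
      (\<lambda>h. (fst h, ampl l *\<^sub>R snd h + (- fst h / (2 * ampl l)) *\<^sub>R y))) (at (l, y))"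
    using has_derivative_Pair[OF has_derivative_fst[OF has_derivative_ident]
        has_derivative_scaleR[OF ds has_derivative_snd[OF has_derivative_ident]]]
    by simp
  have outer: "(psiL has_derivative (\<lambda>v. pd v psiL ?q)) (at (fst (l, y), ampl (fst (l, y)) *\<^sub>R snd (l, y)))"
    using smooth_on_has_derivative[OF LS_D(8) inS] by simp
  have comp: "((\<lambda>p. psiL (fst p, ampl (fst p) *\<^sub>R snd p)) has_derivative
      (\<lambda>h. pd (fst h, ampl l *\<^sub>R snd h + (- fst h / (2 * ampl l)) *\<^sub>R y) psiL ?q)) (at (l, y))"
    using has_derivative_compose[OF inner outer] by simp
  have inv: "((\<lambda>p. 1 / ampl (fst p)) has_derivative (\<lambda>h. fst h / (2 * ampl l ^ 3))) (at (l, y))"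
    by (rule has_derivative_eq_rhs[OF has_derivative_divide[OF has_derivative_const ds]])
      (use s in \<open>auto simp: fun_eq_iff power3_eq_cube field_simps\<close>)
  have "(rpsi has_derivative (\<lambda>h. (1 / ampl l) *\<^sub>R pd (fst h, ampl l *\<^sub>R snd h + (- fst h / (2 * ampl l)) *\<^sub>R y) psiL ?q
      + (fst h / (2 * ampl l ^ 3)) *\<^sub>R psiL ?q)) (at (l, y))"
    using has_derivative_scaleR[OF inv comp] by (simp add: rpsi_def[abs_def])
  then show ?thesis
  proof (rule has_derivative_eq_rhs, intro ext)
    fix hd :: "real \<times> real \<times> real"
    obtain h d where hd: "hd = (h, d)" by (cases hd)
    \<comment> \<open>The direction is written with \<open>ampl l\<close> times y as its last part,
      to match the shape of \<open>rpsi_lam\<close>; this is why the square of \<open>ampl l\<close>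
      appears in the coefficient.\<close>
    have "(h, ampl l *\<^sub>R d + (- h / (2 * ampl l)) *\<^sub>R y)
        = h *\<^sub>R (1, 0) + (ampl l *\<^sub>R (0, d) + (- h / (2 * (ampl l)\<^sup>2)) *\<^sub>R (0, ampl l *\<^sub>R y))"
      using s by (simp add: prod_eq_iff power2_eq_square)
    then have "pd (h, ampl l *\<^sub>R d + (- h / (2 * ampl l)) *\<^sub>R y) psiL ?q
        = h *\<^sub>R pd (1, 0) psiL ?q + (ampl l *\<^sub>R pd (0, d) psiL ?q
          + (- h / (2 * (ampl l)\<^sup>2)) *\<^sub>R pd (0, ampl l *\<^sub>R y) psiL ?q)"
      by (simp only: linear_add[OF L] linear_scale[OF L])
    then show "(1 / ampl l) *\<^sub>R pd (fst hd, ampl l *\<^sub>R snd hd + (- fst hd / (2 * ampl l)) *\<^sub>R y) psiL ?q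
        + (fst hd / (2 * ampl l ^ 3)) *\<^sub>R psiL ?q
        = (case hd of (h, d) \<Rightarrow> h *\<^sub>R rpsi_lam (l, y) + pd (0, d) psiL ?q)"
      using s by (simp add: hd rpsi_lam_def scaleR_add_right scaleR_diff_right power2_eq_square power3_eq_cube)
  qed
qed

definition drmap_l :: "real \<times> real \<times> real \<Rightarrow> real \<times> real" where
  "drmap_l p = 3 *\<^sub>R cubic k (rsol p) (rsol p) (rpsi_lam p)"

definition drmap_y :: "real \<times> real \<times> real \<Rightarrow> real \<times> real \<Rightarrow> real \<times> real" where
  "drmap_y p d = - d + 3 *\<^sub>R cubic k (rsol p) (rsol p)
     (LL k d + pd (0, d) psiL (fst p, ampl (fst p) *\<^sub>R snd p))"

lemma rmap_has_derivative:
  assumes "(l, y) \<in> rdom"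
  shows "(rmap has_derivative (\<lambda>(h, d). h *\<^sub>R drmap_l (l, y) + drmap_y (l, y) d)) (at (l, y))"
proof -
  have "(rsol has_derivative (\<lambda>hd. LL k (snd hd)
      + (case hd of (h, d) \<Rightarrow> h *\<^sub>R rpsi_lam (l, y) + pd (0, d) psiL (l, ampl l *\<^sub>R y)))) (at (l, y))"
    unfolding rsol_def[abs_def]
    by (intro has_derivative_add rpsi_has_derivative[OF assms]
        bounded_linear.has_derivative[OF bounded_linear_LL] has_derivative_snd has_derivative_ident)
  from has_derivative_compose[OF this has_derivative_cubic[OF k1]]
  have "((\<lambda>p. cubic k (rsol p) (rsol p) (rsol p)) has_derivative (\<lambda>hd. 3 *\<^sub>R cubic k (rsol (l, y)) (rsol (l, y)) (LL k (snd hd)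
      + (case hd of (h, d) \<Rightarrow> h *\<^sub>R rpsi_lam (l, y) + pd (0, d) psiL (l, ampl l *\<^sub>R y))))) (at (l, y))" .
  then have "(rmap has_derivative (\<lambda>hd. - snd hd + 3 *\<^sub>R cubic k (rsol (l, y)) (rsol (l, y)) (LL k (snd hd)
      + (case hd of (h, d) \<Rightarrow> h *\<^sub>R rpsi_lam (l, y) + pd (0, d) psiL (l, ampl l *\<^sub>R y))))) (at (l, y))"
    unfolding rmap_def[abs_def]
    by (intro has_derivative_add has_derivative_minus has_derivative_snd has_derivative_ident)
  then show ?thesis
    by (rule has_derivative_eq_rhs)
      (auto simp: fun_eq_iff drmap_l_def drmap_y_def cubic_add cubic_scale scaleR_add_right)
qed

lemma linear_drmap_y:
  assumes "p \<in> rdom"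
  shows "linear (drmap_y p)"
proof -
  have inS: "(fst p, ampl (fst p) *\<^sub>R snd p) \<in> S" using assms by (auto simp: rdom_def)
  note L = linear_pd[OF LS_D(8) inS]
  have "pd (0, c *\<^sub>R d) psiL (fst p, ampl (fst p) *\<^sub>R snd p) = c *\<^sub>R pd (0, d) psiL (fst p, ampl (fst p) *\<^sub>R snd p)"
    "pd (0, d + d') psiL (fst p, ampl (fst p) *\<^sub>R snd p)
      = pd (0, d) psiL (fst p, ampl (fst p) *\<^sub>R snd p) + pd (0, d') psiL (fst p, ampl (fst p) *\<^sub>R snd p)" for c d d'
    using linear_scale[OF L, of c "(0, d)"] linear_add[OF L, of "(0, d)" "(0, d')"] by simp_all
  then show ?thesis
    by (intro linearI)
      (simp_all add: drmap_y_def linear_add[OF linear_LL] linear_scale[OF linear_LL]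
        cubic_add cubic_scale algebra_simps)
qed

lemma continuous_on_rescaling: "continuous_on rdom (\<lambda>p. (fst p, ampl (fst p) *\<^sub>R snd p))"
  unfolding ampl_def by (intro continuous_intros)

lemma rescaling_image: "(\<lambda>p. (fst p, ampl (fst p) *\<^sub>R snd p)) ` rdom \<subseteq> S"
  by (auto simp: rdom_def)

lemma continuous_on_rescaled:
  "continuous_on S f \<Longrightarrow> continuous_on rdom (\<lambda>p. f (fst p, ampl (fst p) *\<^sub>R snd p))"
  by (rule continuous_on_compose2[OF _ continuous_on_rescaling rescaling_image])

lemma continuous_on_ampl: "continuous_on rdom (\<lambda>p. ampl (fst p))"
  unfolding ampl_def by (intro continuous_intros)

lemma ampl_nonzero: "p \<in> rdom \<Longrightarrow> ampl (fst p) \<noteq> 0"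
  using ampl_pos by (fastforce simp: rdom_def)

lemma continuous_on_rsol: "continuous_on rdom rsol"
  unfolding rsol_def[abs_def] rpsi_def
  by (intro continuous_intros bounded_linear.continuous_on[OF bounded_linear_LL]
      continuous_on_rescaled continuous_on_psiL continuous_on_ampl) (simp add: ampl_nonzero)

lemma continuous_on_rpsi_lam: "continuous_on rdom rpsi_lam"
proof -
  have "continuous_on (UNIV \<times> S) (\<lambda>(y, p). pd (0, y) psiL p)"
    using continuous_on_pd_funpow[OF open_S LS_D(8), of 1] by simp
  then have c: "continuous_on rdom (\<lambda>p. (\<lambda>(y, p). pd (0, y) psiL p)
      (ampl (fst p) *\<^sub>R snd p, (fst p, ampl (fst p) *\<^sub>R snd p)))"
    by (rule continuous_on_compose2)
      (use rescaling_image in \<open>auto intro!: continuous_intros continuous_on_rescaling continuous_on_ampl\<close>)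
  show ?thesis
    unfolding rpsi_lam_def split_beta
    using c unfolding split_beta fst_conv snd_conv
    by (intro continuous_intros continuous_on_rescaled continuous_on_psiL continuous_on_pd_psiL continuous_on_ampl)
      (auto simp: ampl_nonzero)
qed

lemma continuous_on_cubic:
  assumes "continuous_on A u" "continuous_on A v" "continuous_on A w"
  shows "continuous_on A (\<lambda>x. cubic k (u x) (v x) (w x))"
  using assms unfolding continuous_on_def by (auto intro!: tendsto_cubic[OF k1])

lemma continuous_on_drmap: "continuous_on rdom drmap_l" "continuous_on rdom (\<lambda>p. drmap_y p d)"
  unfolding drmap_l_def[abs_def] drmap_y_def
  by (intro continuous_intros continuous_on_cubic continuous_on_rsol continuous_on_rpsi_lam
      continuous_on_rescaled continuous_on_pd_psiL)+

text \<open>These are the cancellations that give \<open>rpsi_lam\<close> a limit. The function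
  \<psi> vanishes on the whole line x = 0, hence so does its \<lambda>-derivative, and its second
  x-derivatives there vanish by oddness.\<close>

lemma base_vanishing:
  obtains r where "r > 0" "\<And>l. \<bar>l - \<sigma>\<bar> < r \<Longrightarrow> psiL (l, 0) = 0"
    "\<And>l. \<bar>l - \<sigma>\<bar> < r \<Longrightarrow> pd (1, 0) psiL (l, 0) = 0"
    "\<And>l y. \<bar>l - \<sigma>\<bar> < r \<Longrightarrow> (pd (0, y) ^^ 2) psiL (l, 0) = 0"
proof -
  obtain r where r: "r > 0"
    "\<And>lam x. \<bar>lam - \<sigma>\<bar> < r \<Longrightarrow> norm x < r \<Longrightarrow> (lam, x) \<in> S \<and> psiL (lam, - x) = - psiL (lam, x)"
    by (rule psiL_odd_near_base) blast
  have zero: "psiL (l, 0) = 0" if "\<bar>l - \<sigma>\<bar> < r" for l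
  proof -
    have "psiL (l, 0) = - psiL (l, 0)" using r(2)[of l 0] that r(1) by simp
    then have "2 *\<^sub>R psiL (l, 0) = 0" by (metis scaleR_2 add.right_inverse)
    then show ?thesis by simp
  qed
  have S0: "(l, 0) \<in> S" if "\<bar>l - \<sigma>\<bar> < r" for l using r that by simp
  show ?thesis
  proof (rule that[OF r(1) zero])
    fix l assume l: "\<bar>l - \<sigma>\<bar> < r"
    have "((\<lambda>l. (l, 0)) has_derivative (\<lambda>h. (h, 0))) (at l)" by (auto intro!: derivative_eq_intros)
    from has_derivative_compose[OF this smooth_on_has_derivative[OF LS_D(8) S0[OF l]]]
    have d1: "((\<lambda>l. psiL (l, 0)) has_derivative (\<lambda>h. pd (h, 0) psiL (l, 0))) (at l)" .
    have "((\<lambda>l. 0) has_derivative (\<lambda>h. pd (h, 0) psiL (l, 0))) (at l)"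
      by (rule has_derivative_transform_within_open[OF d1, of "{\<sigma> - r<..<\<sigma> + r}"])
        (use l zero in \<open>auto simp: abs_less_iff\<close>)
    then have "(\<lambda>h. pd (h, 0) psiL (l, 0)) = (\<lambda>h. 0)"
      using has_derivative_unique has_derivative_const by blast
    then show "pd (1, 0) psiL (l, 0) = 0" by metis
    fix y :: "real \<times> real"
    \<comment> \<open>Adding 1 to the norm keeps the quotient meaningful for y = 0.\<close>
    define \<rho> where "\<rho> = r / (1 + norm y)"
    have ny: "1 + norm y > 0" by (simp add: add_pos_nonneg)
    have \<rho>: "\<rho> > 0" using r(1) ny by (simp add: \<rho>_def)
    have small: "norm (\<tau> *\<^sub>R y) < r" if "\<bar>\<tau>\<bar> < \<rho>" for \<tau>
    proof -
      have "\<bar>\<tau>\<bar> * norm y \<le> \<bar>\<tau>\<bar> * (1 + norm y)" by (intro mult_left_mono) auto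
      also have "\<dots> < r" using that ny by (simp add: \<rho>_def field_simps)
      finally show ?thesis by simp
    qed
    have line: "((\<lambda>\<tau>. f (l, \<tau> *\<^sub>R y)) has_vector_derivative pd (0, y) f (l, \<tau> *\<^sub>R y)) (at \<tau>)"
      if "\<bar>\<tau>\<bar> < \<rho>" "smooth_on S f" for \<tau> and f :: "real \<times> real \<times> real \<Rightarrow> h2"
      using r(2)[OF l small[OF that(1)]] by (intro pd_line[OF that(2)]) simp
    have "pd (0, y) (pd (0, y) psiL) (l, 0 *\<^sub>R y) = 0"
    proof (rule odd_second_derivative_zero[OF \<rho>])
      show "((\<lambda>\<tau>. psiL (l, \<tau> *\<^sub>R y)) has_vector_derivative pd (0, y) psiL (l, \<tau> *\<^sub>R y)) (at \<tau>)"
        if "\<bar>\<tau>\<bar> < \<rho>" for \<tau> by (rule line[OF that LS_D(8)])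
      show "((\<lambda>\<tau>. pd (0, y) psiL (l, \<tau> *\<^sub>R y)) has_vector_derivative
          pd (0, y) (pd (0, y) psiL) (l, 0 *\<^sub>R y)) (at 0)"
        using line[of 0] \<rho> smooth_on_pd[OF LS_D(8)] by simp
      show "psiL (l, - \<tau> *\<^sub>R y) = - psiL (l, \<tau> *\<^sub>R y)" if "\<bar>\<tau>\<bar> < \<rho>" for \<tau>
        using r(2)[OF l small[OF that]] by simp
    qed
    then show "(pd (0, y) ^^ 2) psiL (l, 0) = 0" by (simp add: numeral_2_eq_2)
  qed
qed

end

section \<open>Limits of the rescaled quantities as \<lambda> tends to \<sigma> from the
  left\<close>

text \<open>An arbitrary filter lets one set of limits serve three situations: curves at the left of
  \<sigma>, the joint limit in (\<lambda>, y), and convergent subsequences in the compactness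
  argument.\<close>

locale blow_up = lyapunov_schmidt +
  fixes F :: "'c filter" and l :: "'c \<Rightarrow> real" and Y :: "'c \<Rightarrow> real \<times> real" and y0 :: "real \<times> real"
  assumes lim_l: "(l \<longlongrightarrow> \<sigma>) F" and left: "\<forall>\<^sub>F c in F. l c < \<sigma>" and lim_Y: "(Y \<longlongrightarrow> y0) F"
begin

lemma near_l: "r > 0 \<Longrightarrow> \<forall>\<^sub>F c in F. \<bar>l c - \<sigma>\<bar> < r"
  using tendstoD[OF lim_l, of r] by (simp add: dist_norm)

lemma lim_ampl: "((\<lambda>c. ampl (l c)) \<longlongrightarrow> 0) F"
proof -
  have "((\<lambda>c. sqrt (\<sigma> - l c)) \<longlongrightarrow> sqrt (\<sigma> - \<sigma>)) F" by (intro tendsto_intros lim_l)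
  then show ?thesis by (simp add: ampl_def)
qed

lemma near_ampl_Y: "r > 0 \<Longrightarrow> \<forall>\<^sub>F c in F. ampl (l c) * norm (Y c) < r"
proof -
  assume r: "r > 0"
  have "((\<lambda>c. ampl (l c) * norm (Y c)) \<longlongrightarrow> 0 * norm y0) F" by (intro tendsto_intros lim_ampl lim_Y)
  then show ?thesis using r by (intro order_tendstoD) auto
qed

lemma lim_rescaled: "((\<lambda>c. (l c, ampl (l c) *\<^sub>R Y c)) \<longlongrightarrow> (\<sigma>, 0)) F"
proof -
  have "((\<lambda>c. (l c, ampl (l c) *\<^sub>R Y c)) \<longlongrightarrow> (\<sigma>, 0 *\<^sub>R y0)) F" by (intro tendsto_intros lim_l lim_ampl lim_Y)
  then show ?thesis by simp
qed

lemma ev_rdom: "\<forall>\<^sub>F c in F. (l c, Y c) \<in> rdom"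
proof -
  have "\<forall>\<^sub>F c in F. (l c, ampl (l c) *\<^sub>R Y c) \<in> S"
    by (rule topological_tendstoD[OF lim_rescaled open_S base_in_S])
  then show ?thesis using left by eventually_elim (simp add: rdom_def)
qed

text \<open>By \<open>psiL_small\<close>, \<psi> is o(|x|), so dividing by \<open>ampl\<close> still
  leaves a null quantity as long as Y stays bounded.\<close>

lemma lim_rpsi: "((\<lambda>c. rpsi (l c, Y c)) \<longlongrightarrow> 0) F"
proof (rule tendstoI)
  fix e :: real assume e: "e > 0"
  define \<epsilon> where "\<epsilon> = e / (norm y0 + 1)"
  have n: "norm y0 + 1 > 0" by (simp add: add_nonneg_pos)
  have \<epsilon>: "\<epsilon> > 0" using e n by (simp add: \<epsilon>_def)
  obtain \<rho> where \<rho>: "\<rho> > 0"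
    "\<And>lam x. \<bar>lam - \<sigma>\<bar> < \<rho> \<Longrightarrow> norm x < \<rho> \<Longrightarrow> norm (psiL (lam, x)) \<le> \<epsilon> * norm x"
    using psiL_small[OF \<epsilon>] by metis
  have "((\<lambda>c. norm (Y c)) \<longlongrightarrow> norm y0) F" by (intro tendsto_intros lim_Y)
  then have "\<forall>\<^sub>F c in F. norm (Y c) < norm y0 + 1" by (intro order_tendstoD) auto
  then show "\<forall>\<^sub>F c in F. dist (rpsi (l c, Y c)) 0 < e"
    using near_l[OF \<rho>(1)] near_ampl_Y[OF \<rho>(1)] left
  proof eventually_elim
    case (elim c)
    note s = ampl_pos[OF elim(4)]
    have "norm (psiL (l c, ampl (l c) *\<^sub>R Y c)) \<le> \<epsilon> * norm (ampl (l c) *\<^sub>R Y c)"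
      using elim s by (intro \<rho>(2)) auto
    then have "norm (psiL (l c, ampl (l c) *\<^sub>R Y c)) / ampl (l c) \<le> \<epsilon> * (ampl (l c) * norm (Y c)) / ampl (l c)"
      using s by (intro divide_right_mono) auto
    then have "norm (rpsi (l c, Y c)) \<le> \<epsilon> * norm (Y c)"
      using s by (simp add: rpsi_def)
    also have "\<dots> < \<epsilon> * (norm y0 + 1)" using elim(1) \<epsilon> by (intro mult_strict_left_mono)
    also have "\<dots> = e" using n by (simp add: \<epsilon>_def)
    finally show ?case by simp
  qed
qed

lemma lim_rsol: "((\<lambda>c. rsol (l c, Y c)) \<longlongrightarrow> LL k y0) F"
proof -
  have "((\<lambda>c. LL k (Y c) + rpsi (l c, Y c)) \<longlongrightarrow> LL k y0 + 0) F"
    by (intro tendsto_add lim_rpsi bounded_linear.tendsto[OF bounded_linear_LL] lim_Y)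
  then show ?thesis by (simp add: rsol_def)
qed

lemma lim_rmap: "((\<lambda>c. rmap (l c, Y c)) \<longlongrightarrow> lim_map k y0) F"
  unfolding rmap_def lim_map_def snd_conv
  by (intro tendsto_add tendsto_minus lim_Y tendsto_cubic[OF k1] lim_rsol)

lemma lim_drmap_y:
  "((\<lambda>c. drmap_y (l c, Y c) d) \<longlongrightarrow> - d + 3 *\<^sub>R cubic k (LL k y0) (LL k y0) (LL k d)) F"
proof -
  have "isCont (pd (0, d) psiL) (\<sigma>, 0)"
    by (rule isCont_on_S[OF continuous_on_pd_psiL base_in_S])
  then have "((\<lambda>c. pd (0, d) psiL (l c, ampl (l c) *\<^sub>R Y c)) \<longlongrightarrow> pd (0, d) psiL (\<sigma>, 0)) F"
    using lim_rescaled by (rule isCont_tendsto_compose)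
  then have "((\<lambda>c. - d + 3 *\<^sub>R cubic k (rsol (l c, Y c)) (rsol (l c, Y c))
      (LL k d + pd (0, d) psiL (l c, ampl (l c) *\<^sub>R Y c))) \<longlongrightarrow>
      - d + 3 *\<^sub>R cubic k (LL k y0) (LL k y0) (LL k d + pd (0, d) psiL (\<sigma>, 0))) F"
    by (intro tendsto_intros tendsto_cubic[OF k1] lim_rsol)
  then show ?thesis by (simp add: drmap_y_def pd_base_zero)
qed

text \<open>The remainder estimates need the derivative close to its base value on the whole segment
  from 0 to the rescaled point, with a moving direction. Joint continuity at (y0, \<sigma>, 0)
  provides this uniformly.\<close>

lemma line_control:
  assumes g: "smooth_on S g" and e: "e > 0"
  shows "\<forall>\<^sub>F c in F. \<forall>\<tau>\<in>{0..ampl (l c)}. (l c, \<tau> *\<^sub>R Y c) \<in> S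
    \<and> norm ((pd (0, Y c) ^^ n) g (l c, \<tau> *\<^sub>R Y c) - (pd (0, y0) ^^ n) g (\<sigma>, 0)) < (e::real)"
proof -
  define R where "R = (\<lambda>(y, p). (pd (0, y) ^^ n) g p)"
  define W where "W = {q \<in> UNIV \<times> S. dist (R q) (R (y0, \<sigma>, 0)) < e}"
  have R: "continuous_on (UNIV \<times> S) R"
    unfolding R_def by (rule continuous_on_pd_funpow[OF open_S g])
  have "open ((UNIV \<times> S) \<inter> R -` ball (R (y0, \<sigma>, 0)) e)"
    by (rule continuous_open_preimage[OF R]) (auto intro: open_Times open_S)
  also have "(UNIV \<times> S) \<inter> R -` ball (R (y0, \<sigma>, 0)) e = W"
    by (auto simp: W_def dist_commute)
  finally have "open W" .
  moreover have "(y0, \<sigma>, 0) \<in> W" using base_in_S e by (simp add: W_def)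
  ultimately obtain A B where AB: "open A" "open B" "y0 \<in> A" "(\<sigma>, 0) \<in> B" "A \<times> B \<subseteq> W"
    by (metis mem_Sigma_iff open_prod_elim)
  obtain \<rho> where \<rho>: "\<rho> > 0" "\<And>l x. \<bar>l - \<sigma>\<bar> < \<rho> \<Longrightarrow> norm (x - 0) < \<rho> \<Longrightarrow> (l, x) \<in> B"
    using open_rectangle_around[OF AB(2,4)] by blast
  show ?thesis
    using topological_tendstoD[OF lim_Y AB(1,3)] near_l[OF \<rho>(1)] near_ampl_Y[OF \<rho>(1)]
  proof eventually_elim
    case (elim c)
    show ?case
    proof
      fix \<tau> assume \<tau>: "\<tau> \<in> {0..ampl (l c)}"
      have "norm (\<tau> *\<^sub>R Y c) \<le> ampl (l c) * norm (Y c)"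
        using \<tau> by (auto intro!: mult_right_mono)
      then have "(l c, \<tau> *\<^sub>R Y c) \<in> B" using elim by (intro \<rho>(2)) auto
      then have "(Y c, l c, \<tau> *\<^sub>R Y c) \<in> W" using elim(1) AB(5) by auto
      then show "(l c, \<tau> *\<^sub>R Y c) \<in> S
          \<and> norm ((pd (0, Y c) ^^ n) g (l c, \<tau> *\<^sub>R Y c) - (pd (0, y0) ^^ n) g (\<sigma>, 0)) < e"
        by (simp add: W_def R_def dist_norm)
    qed
  qed
qed

text \<open>The first term is a difference quotient along the segment, as the \<lambda>-derivative
  of \<psi> vanishes at its start. In the second, the cubic leading term of
  \<open>third_order_remainder\<close> with coefficient 1/3 meets the denominator 2 s^3, whence
  1/6.\<close>

lemma lim_rpsi_lam:
  "((\<lambda>c. rpsi_lam (l c, Y c)) \<longlongrightarrow> pd (0, y0) (pd (1, 0) psiL) (\<sigma>, 0) - (1/6) *\<^sub>R (pd (0, y0) ^^ 3) psiL (\<sigma>, 0)) F"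
proof -
  let ?c1 = "pd (0, y0) (pd (1, 0) psiL) (\<sigma>, 0)" and ?c3 = "(pd (0, y0) ^^ 3) psiL (\<sigma>, 0)"
  obtain r where r: "r > 0" "\<And>l. \<bar>l - \<sigma>\<bar> < r \<Longrightarrow> psiL (l, 0) = 0"
    "\<And>l. \<bar>l - \<sigma>\<bar> < r \<Longrightarrow> pd (1, 0) psiL (l, 0) = 0"
    "\<And>l y. \<bar>l - \<sigma>\<bar> < r \<Longrightarrow> (pd (0, y) ^^ 2) psiL (l, 0) = 0"
    by (rule base_vanishing) blast
  have first: "((\<lambda>c. (1 / ampl (l c)) *\<^sub>R pd (1, 0) psiL (l c, ampl (l c) *\<^sub>R Y c)) \<longlongrightarrow> ?c1) F"
  proof (rule tendstoI)
    fix e :: real assume e: "e > 0"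
    let ?g = "pd (1, 0) psiL"
    have g: "smooth_on S ?g" by (rule smooth_on_pd[OF LS_D(8)])
    show "\<forall>\<^sub>F c in F. dist ((1 / ampl (l c)) *\<^sub>R ?g (l c, ampl (l c) *\<^sub>R Y c)) ?c1 < e"
      using line_control[OF g half_gt_zero[OF e], of 1] near_l[OF r(1)] left
    proof eventually_elim
      case (elim c)
      let ?s = "ampl (l c)"
      note s = ampl_pos[OF elim(3)]
      have d: "((\<lambda>\<tau>. ?g (l c, \<tau> *\<^sub>R Y c)) has_vector_derivative pd (0, Y c) ?g (l c, \<tau> *\<^sub>R Y c)) (at \<tau>)"
        if "\<tau> \<in> {0..?s}" for \<tau> using elim(1) that by (intro pd_line[OF g]) auto
      have "norm ((\<lambda>\<tau>. ?g (l c, \<tau> *\<^sub>R Y c) - \<tau> *\<^sub>R ?c1) ?s - (\<lambda>\<tau>. ?g (l c, \<tau> *\<^sub>R Y c) - \<tau> *\<^sub>R ?c1) 0)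
          \<le> e / 2 * ?s - e / 2 * 0"
      proof (rule differentiable_bound_general[OF s, where \<phi>' = "\<lambda>\<tau>. e / 2"
            and f' = "\<lambda>\<tau>. pd (0, Y c) ?g (l c, \<tau> *\<^sub>R Y c) - ?c1"])
        show "continuous_on {0..?s} (\<lambda>\<tau>. ?g (l c, \<tau> *\<^sub>R Y c) - \<tau> *\<^sub>R ?c1)"
          by (intro continuous_intros continuous_at_imp_continuous_on ballI
              has_vector_derivative_continuous[OF d]) auto
        show "((\<lambda>\<tau>. ?g (l c, \<tau> *\<^sub>R Y c) - \<tau> *\<^sub>R ?c1) has_vector_derivative
            pd (0, Y c) ?g (l c, \<tau> *\<^sub>R Y c) - ?c1) (at \<tau>)" if "0 < \<tau>" "\<tau> < ?s" for \<tau>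
          using that by (auto intro!: derivative_eq_intros d)
        show "norm (pd (0, Y c) ?g (l c, \<tau> *\<^sub>R Y c) - ?c1) \<le> e / 2" if "0 < \<tau>" "\<tau> < ?s" for \<tau>
          using elim(1) that by (auto intro: less_imp_le)
        show "((*) (e / 2) has_vector_derivative e / 2) (at \<tau>)" for \<tau>
          by (auto intro!: derivative_eq_intros)
      qed (auto intro!: continuous_intros)
      then have "norm (?g (l c, ?s *\<^sub>R Y c) - ?s *\<^sub>R ?c1) \<le> e / 2 * ?s"
        using r(3)[OF elim(2)] by simp
      then have "norm (?g (l c, ?s *\<^sub>R Y c) - ?s *\<^sub>R ?c1) / ?s \<le> e / 2"
        using s by (simp add: field_simps)
      moreover have "(1 / ?s) *\<^sub>R ?g (l c, ?s *\<^sub>R Y c) - ?c1 = (1 / ?s) *\<^sub>R (?g (l c, ?s *\<^sub>R Y c) - ?s *\<^sub>R ?c1)"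
        using s by (simp add: scaleR_diff_right)
      then have "dist ((1 / ?s) *\<^sub>R ?g (l c, ?s *\<^sub>R Y c)) ?c1 = norm (?g (l c, ?s *\<^sub>R Y c) - ?s *\<^sub>R ?c1) / ?s"
        using s by (simp add: dist_norm)
      ultimately show ?case using e by linarith
    qed
  qed
  have third: "((\<lambda>c. (1 / (2 * ampl (l c) ^ 3)) *\<^sub>R (pd (0, ampl (l c) *\<^sub>R Y c) psiL (l c, ampl (l c) *\<^sub>R Y c)
      - psiL (l c, ampl (l c) *\<^sub>R Y c))) \<longlongrightarrow> (1/6) *\<^sub>R ?c3) F"
  proof (rule tendstoI)
    fix e :: real assume e: "e > 0"
    show "\<forall>\<^sub>F c in F. dist ((1 / (2 * ampl (l c) ^ 3)) *\<^sub>R (pd (0, ampl (l c) *\<^sub>R Y c) psiL (l c, ampl (l c) *\<^sub>R Y c)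
        - psiL (l c, ampl (l c) *\<^sub>R Y c))) ((1/6) *\<^sub>R ?c3) < e"
      using line_control[OF LS_D(8) e, of 3] near_l[OF r(1)] left
    proof eventually_elim
      case (elim c)
      let ?s = "ampl (l c)"
      note s = ampl_pos[OF elim(3)]
      have inS: "(l c, \<tau> *\<^sub>R Y c) \<in> S" if "\<tau> \<in> {0..?s}" for \<tau> using elim(1) that by blast
      have d: "((\<lambda>\<tau>. (pd (0, Y c) ^^ n) psiL (l c, \<tau> *\<^sub>R Y c)) has_vector_derivative
          (pd (0, Y c) ^^ Suc n) psiL (l c, \<tau> *\<^sub>R Y c)) (at \<tau>)" if "\<tau> \<in> {0..?s}" for \<tau> n
        using pd_line[OF smooth_on_pd_funpow[OF LS_D(8)] inS[OF that]] by simp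
      have "norm (?s *\<^sub>R pd (0, Y c) psiL (l c, ?s *\<^sub>R Y c) - psiL (l c, ?s *\<^sub>R Y c) - (?s ^ 3 / 3) *\<^sub>R ?c3)
          \<le> e * ?s ^ 3 / 3"
      proof (rule third_order_remainder[of ?s "\<lambda>\<tau>. psiL (l c, \<tau> *\<^sub>R Y c)" "\<lambda>\<tau>. pd (0, Y c) psiL (l c, \<tau> *\<^sub>R Y c)"
            "\<lambda>\<tau>. (pd (0, Y c) ^^ 2) psiL (l c, \<tau> *\<^sub>R Y c)" "\<lambda>\<tau>. (pd (0, Y c) ^^ 3) psiL (l c, \<tau> *\<^sub>R Y c)"])
        fix \<tau> assume \<tau>: "\<tau> \<in> {0..?s}"
        show "((\<lambda>\<tau>. psiL (l c, \<tau> *\<^sub>R Y c)) has_vector_derivative pd (0, Y c) psiL (l c, \<tau> *\<^sub>R Y c)) (at \<tau>)"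
          using d[OF \<tau>, of 0] by simp
        show "((\<lambda>\<tau>. pd (0, Y c) psiL (l c, \<tau> *\<^sub>R Y c)) has_vector_derivative
            (pd (0, Y c) ^^ 2) psiL (l c, \<tau> *\<^sub>R Y c)) (at \<tau>)"
          using d[OF \<tau>, of 1] by (simp add: numeral_2_eq_2)
        show "((\<lambda>\<tau>. (pd (0, Y c) ^^ 2) psiL (l c, \<tau> *\<^sub>R Y c)) has_vector_derivative
            (pd (0, Y c) ^^ 3) psiL (l c, \<tau> *\<^sub>R Y c)) (at \<tau>)"
          using d[OF \<tau>, of 2] by (simp add: numeral_3_eq_3 numeral_2_eq_2)
        show "norm ((pd (0, Y c) ^^ 3) psiL (l c, \<tau> *\<^sub>R Y c) - ?c3) \<le> e"
          using elim(1) \<tau> by (auto intro: less_imp_le)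
      qed (use s r(2,4)[OF elim(2)] in simp_all)
      moreover have "pd (0, ?s *\<^sub>R Y c) psiL (l c, ?s *\<^sub>R Y c) = ?s *\<^sub>R pd (0, Y c) psiL (l c, ?s *\<^sub>R Y c)"
        using linear_scale[OF linear_pd[OF LS_D(8) inS[of ?s]], of ?s "(0, Y c)"] s by simp
      ultimately have "norm ((pd (0, ?s *\<^sub>R Y c) psiL (l c, ?s *\<^sub>R Y c) - psiL (l c, ?s *\<^sub>R Y c)) - (?s ^ 3 / 3) *\<^sub>R ?c3)
          \<le> e * ?s ^ 3 / 3" (is "norm (?D - _) \<le> _") by simp
      then have "norm (?D - (?s ^ 3 / 3) *\<^sub>R ?c3) / (2 * ?s ^ 3) \<le> (e * ?s ^ 3 / 3) / (2 * ?s ^ 3)"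
        using s by (intro divide_right_mono) auto
      also have "\<dots> = e / 6" using s by simp
      finally have "norm (?D - (?s ^ 3 / 3) *\<^sub>R ?c3) / (2 * ?s ^ 3) \<le> e / 6" .
      moreover have "(1 / (2 * ?s ^ 3)) *\<^sub>R ?D - (1/6) *\<^sub>R ?c3 = (1 / (2 * ?s ^ 3)) *\<^sub>R (?D - (?s ^ 3 / 3) *\<^sub>R ?c3)"
        using s by (simp add: scaleR_diff_right)
      then have "dist ((1 / (2 * ?s ^ 3)) *\<^sub>R ?D) ((1/6) *\<^sub>R ?c3) = norm (?D - (?s ^ 3 / 3) *\<^sub>R ?c3) / (2 * ?s ^ 3)"
        using s by (simp add: dist_norm)
      ultimately show ?case using e by linarith
    qed
  qed
  show ?thesis
    unfolding rpsi_lam_def split using tendsto_diff[OF first third] .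
qed

lemma lim_drmap_l:
  "((\<lambda>c. drmap_l (l c, Y c)) \<longlongrightarrow> 3 *\<^sub>R cubic k (LL k y0) (LL k y0)
     (pd (0, y0) (pd (1, 0) psiL) (\<sigma>, 0) - (1/6) *\<^sub>R (pd (0, y0) ^^ 3) psiL (\<sigma>, 0))) F"
  unfolding drmap_l_def by (intro tendsto_scaleR tendsto_const tendsto_cubic[OF k1] lim_rsol lim_rpsi_lam)

end


section \<open>Branches and their uniqueness\<close>

context lyapunov_schmidt
begin

lemma blow_up_at_left: "(Y \<longlongrightarrow> y0) (at_left \<sigma>) \<Longrightarrow> blow_up k I \<N> \<O> \<psi> (at_left \<sigma>) (\<lambda>l. l) Y y0"
  by unfold_locales (auto simp: eventually_at_filter)

text \<open>The cap \<delta>0 later keeps the balls around the four limit points in different open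
  quadrants. Uniqueness is recorded throughout the closed ball, so every zero found there must be
  the branch.\<close>

definition branch where
  "branch y0 \<delta>0 \<rho> \<delta> Y Y' \<longleftrightarrow> 0 < \<rho> \<and> 0 < \<delta> \<and> \<delta> \<le> \<delta>0 \<and>
     (\<forall>l\<in>{\<sigma> - \<rho> <..< \<sigma>}. Y l \<in> ball y0 \<delta> \<and>
        (\<forall>y\<in>cball y0 \<delta>. (l, y) \<in> rdom \<and> (rmap (l, y) = 0 \<longleftrightarrow> y = Y l))) \<and>
     Y \<sigma> = y0 \<and>
     (\<forall>l\<in>{\<sigma> - \<rho> <.. \<sigma>}. (Y has_vector_derivative Y' l) (at l within {\<sigma> - \<rho> <.. \<sigma>})) \<and>
     continuous_on {\<sigma> - \<rho> <.. \<sigma>} Y'"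

text \<open>Composing with the inverse of the limit derivative makes the y-derivative converge to
  the identity, the normal form required by \<open>implicit_curve_left\<close>; the zeros stay the
  same.\<close>

lemma branch_exists:
  assumes z: "lim_map k y0 = 0"
    and nd: "\<And>d. - d + 3 *\<^sub>R cubic k (LL k y0) (LL k y0) (LL k d) = 0 \<Longrightarrow> d = 0"
    and \<delta>0: "\<delta>0 > 0"
  shows "\<exists>\<rho> \<delta> Y Y'. branch y0 \<delta>0 \<rho> \<delta> Y Y'"
proof -
  define A0 where "A0 d = - d + 3 *\<^sub>R cubic k (LL k y0) (LL k y0) (LL k d)" for d
  have "linear A0"
    by (intro linearI) (simp_all add: A0_def linear_add[OF linear_LL] linear_scale[OF linear_LL]
        cubic_add cubic_scale algebra_simps)
  moreover from this have "inj A0"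
    using nd by (simp add: linear_injective_0 A0_def)
  ultimately obtain Ai where Ai: "linear Ai" "\<And>d. Ai (A0 d) = d" "\<And>d. A0 (Ai d) = d"
    using linear_injective_isomorphism by metis
  then have bl: "bounded_linear Ai" by (simp add: linear_conv_bounded_linear)
  have Ai0: "Ai x = 0 \<longleftrightarrow> x = 0" for x
    using Ai(3)[of x] linear_0[OF \<open>linear A0\<close>] linear_0[OF Ai(1)] by metis
  define K where "K p = Ai (rmap p)" for p
  define a where "a p = Ai (drmap_l p)" for p
  define B where "B p d = Ai (drmap_y p d)" for p d
  \<comment> \<open>A joint limit in \<lambda> and y, with \<lambda> < \<sigma>: it yields a full
    rectangle on which the derivative is close to the identity.\<close>
  let ?F = "at (\<sigma>, y0) within ({..<\<sigma>} \<times> UNIV)"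
  have ev_left: "\<forall>\<^sub>F p in ?F. fst p < \<sigma>"
    unfolding eventually_at_filter by (rule always_eventually) auto
  interpret F: blow_up k I \<N> \<O> \<psi> ?F fst snd y0
    by unfold_locales
      (use tendsto_fst[OF tendsto_ident_at[of "(\<sigma>, y0)"]] tendsto_snd[OF tendsto_ident_at[of "(\<sigma>, y0)"]]
        ev_left in simp_all)
  have limB: "((\<lambda>p. B p d) \<longlongrightarrow> d) ?F" for d
    using bounded_linear.tendsto[OF bl F.lim_drmap_y[of d]] Ai(2)[of d] by (simp add: B_def A0_def)
  have evB: "\<forall>\<^sub>F p in ?F. dist (B p d) d < 1/4" for d
    by (rule tendstoD[OF limB]) simp
  have "\<forall>\<^sub>F p in ?F. p \<in> rdom \<and> dist (B p (1, 0)) (1, 0) < 1/4 \<and> dist (B p (0, 1)) (0, 1) < 1/4"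
    using F.ev_rdom evB[of "(1, 0)"] evB[of "(0, 1)"] by eventually_elim simp
  then obtain r where r: "r > 0" "\<And>p. fst p < \<sigma> \<Longrightarrow> dist p (\<sigma>, y0) < r \<Longrightarrow>
      p \<in> rdom \<and> dist (B p (1, 0)) (1, 0) < 1/4 \<and> dist (B p (0, 1)) (0, 1) < 1/4"
    unfolding eventually_at by fastforce
  \<comment> \<open>The radius in y is fixed first, from the derivative estimate; only then is the
    range of \<lambda> shortened until the residual at y0 is below \<delta>/4.\<close>
  define \<delta> where "\<delta> = min \<delta>0 (r / 2)"
  have \<delta>: "\<delta> > 0" "\<delta> \<le> \<delta>0" "\<delta> \<le> r / 2"
    using \<delta>0 r(1) by (auto simp: \<delta>_def min_def)
  interpret L: blow_up k I \<N> \<O> \<psi> "at_left \<sigma>" "\<lambda>l. l" "\<lambda>l. y0" y0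
    by (rule blow_up_at_left) simp
  have limK: "((\<lambda>l. K (l, y0)) \<longlongrightarrow> 0) (at_left \<sigma>)"
    using bounded_linear.tendsto[OF bl L.lim_rmap] linear_0[OF Ai(1)] by (simp add: K_def z)
  have "\<forall>\<^sub>F l in at_left \<sigma>. dist (K (l, y0)) 0 < \<delta> / 4"
    using \<delta>(1) by (intro tendstoD[OF limK]) simp
  then obtain b where b: "b < \<sigma>" "\<And>l. b < l \<Longrightarrow> l < \<sigma> \<Longrightarrow> norm (K (l, y0)) < \<delta> / 4"
    unfolding eventually_at_left_field by auto
  define \<rho> where "\<rho> = min (\<sigma> - b) (r / 2)"
  have \<rho>: "\<rho> > 0" "\<rho> \<le> \<sigma> - b" "\<rho> \<le> r / 2"
    using b(1) r(1) by (auto simp: \<rho>_def min_def)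
  have D: "(l, y) \<in> rdom" "dist (B (l, y) (1, 0)) (1, 0) < 1/4" "dist (B (l, y) (0, 1)) (0, 1) < 1/4"
    if "(l, y) \<in> {\<sigma> - \<rho><..<\<sigma>} \<times> cball y0 \<delta>" for l y
  proof -
    have "dist (l, y) (\<sigma>, y0) \<le> \<bar>l - \<sigma>\<bar> + norm (y - y0)"
      using norm_Pair_le[of "l - \<sigma>" "y - y0"] by (simp add: dist_norm)
    also have "\<dots> < r" using that \<rho> \<delta> by (auto simp: dist_norm norm_minus_commute)
    finally show "(l, y) \<in> rdom" "dist (B (l, y) (1, 0)) (1, 0) < 1/4" "dist (B (l, y) (0, 1)) (0, 1) < 1/4"
      using r(2)[of "(l, y)"] that by auto
  qed
  have linB: "linear (B p)" if "p \<in> rdom" for p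
    using linear_compose[OF linear_drmap_y[OF that] Ai(1)] by (simp add: B_def[abs_def] o_def)
  have sub: "{\<sigma> - \<rho><..<\<sigma>} \<times> cball y0 \<delta> \<subseteq> rdom" using D(1) by auto
  obtain Y Y' where Y:
    "\<And>l. l \<in> {\<sigma> - \<rho> <..< \<sigma>} \<Longrightarrow> Y l \<in> ball y0 \<delta>"
    "\<And>l y. (l, y) \<in> {\<sigma> - \<rho><..<\<sigma>} \<times> cball y0 \<delta> \<Longrightarrow> K (l, y) = 0 \<longleftrightarrow> y = Y l"
    "Y \<sigma> = y0"
    "\<And>l. l \<in> {\<sigma> - \<rho> <.. \<sigma>} \<Longrightarrow> (Y has_vector_derivative Y' l) (at l within {\<sigma> - \<rho> <.. \<sigma>})"
    "continuous_on {\<sigma> - \<rho> <.. \<sigma>} Y'"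
  proof (rule implicit_curve_left[of \<rho> \<delta> \<sigma> y0 K a B])
    show "0 < \<rho>" "0 < \<delta>" by (rule \<rho> \<delta>)+
    fix l y assume ly: "(l, y) \<in> {\<sigma> - \<rho><..<\<sigma>} \<times> cball y0 \<delta>"
    show "(K has_derivative (\<lambda>(h, d). h *\<^sub>R a (l, y) + B (l, y) d)) (at (l, y))"
      unfolding K_def[abs_def]
      by (rule has_derivative_eq_rhs[OF bounded_linear.has_derivative[OF bl rmap_has_derivative[OF D(1)[OF ly]]]])
        (auto simp: fun_eq_iff a_def B_def linear_add[OF Ai(1)] linear_scale[OF Ai(1)])
  next
    fix p :: "real \<times> real \<times> real" and d :: "real \<times> real"
    assume p: "p \<in> {\<sigma> - \<rho><..<\<sigma>} \<times> cball y0 \<delta>"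
    obtain l y where ly: "p = (l, y)" by (cases p)
    note D = D[OF p[unfolded ly], folded ly]
    note L = linB[OF D(1)]
    obtain d1 d2 where d: "d = (d1, d2)" by (cases d)
    have d': "d = d1 *\<^sub>R (1, 0) + d2 *\<^sub>R (0, 1)" by (simp add: d)
    \<comment> \<open>An error 1/4 on each of the two basis vectors adds up to 1/2 on every
      d.\<close>
    have "B p d - d = d1 *\<^sub>R (B p (1, 0) - (1, 0)) + d2 *\<^sub>R (B p (0, 1) - (0, 1))"
      unfolding d' by (simp only: linear_add[OF L] linear_scale[OF L]) (simp add: algebra_simps)
    then have "norm (B p d - d) \<le> \<bar>d1\<bar> * norm (B p (1, 0) - (1, 0)) + \<bar>d2\<bar> * norm (B p (0, 1) - (0, 1))"
      by (metis norm_scaleR norm_triangle_ineq)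
    also have "\<dots> \<le> \<bar>d1\<bar> * (1/4) + \<bar>d2\<bar> * (1/4)"
      using D(2,3) by (intro add_mono mult_left_mono) (auto simp: dist_norm)
    also have "\<dots> \<le> norm d / 2"
      using norm_fst_le[of d1 d2] norm_snd_le[of d2 d1] by (simp add: d)
    finally show "norm (B p d - d) \<le> norm d / 2" .
  next
    show "norm (K (l, y0)) \<le> \<delta> / 4" if "l \<in> {\<sigma> - \<rho><..<\<sigma>}" for l
      using b(2)[of l] that \<rho>(2) by auto
    show "((\<lambda>l. K (l, y0)) \<longlongrightarrow> 0) (at_left \<sigma>)" by (rule limK)
    show "continuous_on ({\<sigma> - \<rho><..<\<sigma>} \<times> cball y0 \<delta>) a"
      unfolding a_def[abs_def]
      by (intro bounded_linear.continuous_on[OF bl] continuous_on_subset[OF continuous_on_drmap(1) sub])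
    show "continuous_on ({\<sigma> - \<rho><..<\<sigma>} \<times> cball y0 \<delta>) (\<lambda>p. B p d)" for d
      unfolding B_def
      by (intro bounded_linear.continuous_on[OF bl] continuous_on_subset[OF continuous_on_drmap(2) sub])
  next
    fix Y assume "(Y \<longlongrightarrow> y0) (at_left \<sigma>)"
    then interpret Y: blow_up k I \<N> \<O> \<psi> "at_left \<sigma>" "\<lambda>l. l" Y y0 by (rule blow_up_at_left)
    show "((\<lambda>l. a (l, Y l)) \<longlongrightarrow> Ai (3 *\<^sub>R cubic k (LL k y0) (LL k y0)
      (pd (0, y0) (pd (1, 0) psiL) (\<sigma>, 0) - (1/6) *\<^sub>R (pd (0, y0) ^^ 3) psiL (\<sigma>, 0)))) (at_left \<sigma>)"
      unfolding a_def by (rule bounded_linear.tendsto[OF bl Y.lim_drmap_l])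
    show "((\<lambda>l. B (l, Y l) d) \<longlongrightarrow> d) (at_left \<sigma>)" for d
      using bounded_linear.tendsto[OF bl Y.lim_drmap_y[of d]] Ai(2)[of d] by (simp add: B_def A0_def)
  qed blast
  have "branch y0 \<delta>0 \<rho> \<delta> Y Y'"
    unfolding branch_def
    using \<rho>(1) \<delta>(1,2) Y(1,3-5) D(1) Y(2)[unfolded K_def Ai0] by auto
  then show ?thesis by blast
qed

text \<open>Pairing with x gives (\<sigma> - \<lambda>) |x|^2 = <x, cubic>. Coercivity bounds the
  right side below by a multiple of |x|^4, which gives \<lambda> < \<sigma> and the outer radius;
  boundedness of the cubic bounds it above, which gives the inner radius.\<close>

lemma small_solutions:
  obtains m R \<rho> where "m > 0" "\<rho> > 0"
    "\<And>lam x. \<bar>lam - \<sigma>\<bar> < \<rho> \<Longrightarrow> norm x < \<rho> \<Longrightarrow> (lam, x) \<in> S"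
    "\<And>lam. \<bar>lam - \<sigma>\<bar> < \<rho> \<Longrightarrow> sol (lam, 0) = 0"
    "\<And>lam x. \<bar>lam - \<sigma>\<bar> < \<rho> \<Longrightarrow> norm x < \<rho> \<Longrightarrow> x \<noteq> 0 \<Longrightarrow> red (lam, x) = 0 \<Longrightarrow>
       lam < \<sigma> \<and> m * ampl lam \<le> norm x \<and> norm x \<le> R * ampl lam"
proof -
  obtain c0 where c0: "c0 > 0" "\<And>y. c0 * norm y ^ 4 \<le> inner y (cubic k (LL k y) (LL k y) (LL k y))"
    using cubic_coercive[OF odd_k] by blast
  obtain C where C: "C > 0" "\<And>x. norm (LL k x) \<le> C * norm x"
    using bounded_linear.pos_bounded[OF bounded_linear_LL[of k]] by (auto simp: mult.commute)
  \<comment> \<open>Each of three telescoping terms costs 108 (C + 1)^2 \<epsilon>, hence 324 in C1.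
    C2 bounds the full cubic, using that a solution has norm at most (C + 1) |x|. The choice of
    \<epsilon> lets the perturbation consume only half of the coercivity constant.\<close>
  define C1 where "C1 = 324 * (C + 1)\<^sup>2"
  define C2 where "C2 = 108 * (C + 1) ^ 3"
  have C12: "C1 > 0" "C2 > 0" using C(1) by (auto simp: C1_def C2_def)
  define \<epsilon> where "\<epsilon> = min 1 (c0 / (2 * C1))"
  have \<epsilon>: "\<epsilon> > 0" "\<epsilon> \<le> 1" "C1 * \<epsilon> \<le> c0 / 2"
  proof -
    show "\<epsilon> > 0" "\<epsilon> \<le> 1" using c0(1) C12 by (auto simp: \<epsilon>_def)
    have "\<epsilon> \<le> c0 / (2 * C1)" by (simp add: \<epsilon>_def)
    then show "C1 * \<epsilon> \<le> c0 / 2" using C12 by (simp add: field_simps)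
  qed
  obtain \<rho> where \<rho>: "\<rho> > 0"
    "\<And>lam x. \<bar>lam - \<sigma>\<bar> < \<rho> \<Longrightarrow> norm x < \<rho> \<Longrightarrow> (lam, x) \<in> S"
    "\<And>lam x. \<bar>lam - \<sigma>\<bar> < \<rho> \<Longrightarrow> norm x < \<rho> \<Longrightarrow> norm (psiL (lam, x)) \<le> \<epsilon> * norm x"
    using psiL_small[OF \<epsilon>(1)] by metis
  show ?thesis
  proof (rule that[of "1 / sqrt C2" \<rho> "sqrt (2 / c0)"])
    show "1 / sqrt C2 > 0" "\<rho> > 0" using C12 \<rho>(1) by auto
    show "(lam, x) \<in> S" if "\<bar>lam - \<sigma>\<bar> < \<rho>" "norm x < \<rho>" for lam x using \<rho>(2) that .
    show "sol (lam, 0) = 0" if "\<bar>lam - \<sigma>\<bar> < \<rho>" for lam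
      using \<rho>(3)[OF that, of 0] \<rho>(1) by (simp add: sol_def LL_0)
    fix lam x assume lx: "\<bar>lam - \<sigma>\<bar> < \<rho>" "norm x < \<rho>" "x \<noteq> 0" "red (lam, x) = 0"
    define n where "n = norm x"
    have n: "n > 0" using lx(3) by (simp add: n_def)
    define L p u where "L = LL k x" and "p = psiL (lam, x)" and "u = sol (lam, x)"
    have u: "u = L + p" by (simp add: u_def L_def p_def sol_def)
    have bL: "norm L \<le> (C + 1) * n" 
      using C(2)[of x] n unfolding L_def distrib_right n_def[symmetric] by linarith
    have bp: "norm p \<le> \<epsilon> * n" using \<rho>(3)[OF lx(1,2)] by (simp add: p_def n_def)
    have bu: "norm u \<le> (C + 1) * n"
    proof -
      have "norm u \<le> norm L + norm p" unfolding u by (rule norm_triangle_ineq)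
      also have "\<dots> \<le> C * n + 1 * n"
        using C(2)[of x] bp mult_right_mono[OF \<epsilon>(2), of n] n unfolding L_def n_def[symmetric] by linarith
      finally show ?thesis by (simp add: algebra_simps)
    qed
    have bound: "norm (cubic k a b c) \<le> 108 * (A * B * D)"
      if "norm a \<le> A" "norm b \<le> B" "norm c \<le> D" for a b c A B D
    proof -
      have "norm (cubic k a b c) \<le> 108 * (norm a * norm b * norm c)" by (rule cubic_bound[OF k1])
      also have "\<dots> \<le> 108 * (A * B * D)"
        using that order_trans[OF norm_ge_zero that(1)] order_trans[OF norm_ge_zero that(2)]
        by (intro mult_left_mono mult_mono) auto
      finally show ?thesis .
    qed
    have "cubic k u u u - cubic k L L L = cubic k p u u + cubic k L p u + cubic k L L p"
    proof -
      have "cubic k u u u = cubic k L u u + cubic k p u u" by (subst (1) u) (rule cubic_add)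
      moreover have "cubic k L u u = cubic k L L u + cubic k L p u" by (subst (1) u) (rule cubic_add)
      moreover have "cubic k L L u = cubic k L L L + cubic k L L p" by (subst (1) u) (rule cubic_add)
      ultimately show ?thesis by simp
    qed
    then have "norm (cubic k u u u - cubic k L L L)
        \<le> norm (cubic k p u u) + norm (cubic k L p u) + norm (cubic k L L p)"
      by (metis norm_triangle_ineq norm_triangle_le add_right_mono)
    also have "\<dots> \<le> 108 * (\<epsilon> * n * ((C + 1) * n) * ((C + 1) * n)) + 108 * ((C + 1) * n * (\<epsilon> * n) * ((C + 1) * n))
        + 108 * ((C + 1) * n * ((C + 1) * n) * (\<epsilon> * n))"
      by (intro add_mono bound bp bu bL)
    also have "\<dots> = C1 * \<epsilon> * n ^ 3" by (simp add: C1_def power2_eq_square power3_eq_cube algebra_simps)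
    also have "\<dots> \<le> c0 / 2 * n ^ 3" using \<epsilon>(3) n by (intro mult_right_mono) auto
    finally have diff: "norm (cubic k u u u - cubic k L L L) \<le> c0 / 2 * n ^ 3" .
    have "inner x (cubic k u u u) = inner x (cubic k L L L) + inner x (cubic k u u u - cubic k L L L)"
      by (simp add: inner_diff_right)
    moreover have "\<bar>inner x (cubic k u u u - cubic k L L L)\<bar> \<le> n * (c0 / 2 * n ^ 3)"
    proof (rule order_trans[OF Cauchy_Schwarz_ineq2])
      show "norm x * norm (cubic k u u u - cubic k L L L) \<le> n * (c0 / 2 * n ^ 3)"
        unfolding n_def[symmetric] using n by (intro mult_left_mono diff) simp
    qed
    moreover have "n * (c0 / 2 * n ^ 3) = c0 / 2 * n ^ 4" by (simp add: power4_eq_xxxx power3_eq_cube)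
    ultimately have lower: "inner x (cubic k u u u) \<ge> c0 / 2 * n ^ 4"
      using c0(2)[of x] unfolding L_def[symmetric] n_def[symmetric] by linarith
    have "norm (cubic k u u u) \<le> 108 * ((C + 1) * n * ((C + 1) * n) * ((C + 1) * n))"
      by (intro bound bu)
    also have "\<dots> = C2 * n ^ 3" by (simp add: C2_def power3_eq_cube algebra_simps)
    finally have "n * norm (cubic k u u u) \<le> n * (C2 * n ^ 3)" using n by (intro mult_left_mono) auto
    moreover have n4': "C2 * n ^ 4 = n * (C2 * n ^ 3)" by (simp add: power4_eq_xxxx power3_eq_cube)
    ultimately have upper: "inner x (cubic k u u u) \<le> C2 * n ^ 4"
      using Cauchy_Schwarz_ineq2[of x "cubic k u u u"] unfolding n4' n_def by linarith
    have "cubic k u u u = (\<sigma> - lam) *\<^sub>R x"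
    proof -
      have "(lam - \<sigma>) *\<^sub>R x + cubic k u u u = 0" using lx(4) by (simp add: red_def u_def)
      then have "cubic k u u u = - ((lam - \<sigma>) *\<^sub>R x)" by (simp only: add_eq_0_iff)
      then show ?thesis by (simp flip: scaleR_minus_left)
    qed
    then have e: "inner x (cubic k u u u) = (\<sigma> - lam) * n\<^sup>2"
      by (simp add: n_def power2_norm_eq_inner)
    have n4: "n ^ 4 = n\<^sup>2 * n\<^sup>2" by (simp add: power4_eq_xxxx power2_eq_square)
    have n2: "n\<^sup>2 > 0" using n by simp
    have "c0 / 2 * n\<^sup>2 * n\<^sup>2 \<le> (\<sigma> - lam) * n\<^sup>2" using lower unfolding e n4 by (simp only: mult.assoc)
    then have 1: "c0 / 2 * n\<^sup>2 \<le> \<sigma> - lam" using n2 by (simp only: mult_le_cancel_right_pos)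
    have "(\<sigma> - lam) * n\<^sup>2 \<le> C2 * n\<^sup>2 * n\<^sup>2" using upper unfolding e n4 by (simp only: mult.assoc)
    then have 2: "\<sigma> - lam \<le> C2 * n\<^sup>2" using n2 by (simp only: mult_le_cancel_right_pos)
    have "c0 / 2 * n\<^sup>2 > 0" using c0(1) n2 by simp
    then have lam: "lam < \<sigma>" using 1 by linarith
    have "n\<^sup>2 \<le> 2 / c0 * (\<sigma> - lam)" using 1 c0(1) by (simp add: field_simps)
    then have "sqrt (n\<^sup>2) \<le> sqrt (2 / c0 * (\<sigma> - lam))" by (rule real_sqrt_le_mono)
    then have "\<bar>n\<bar> \<le> sqrt (2 / c0) * ampl lam" by (simp only: ampl_def real_sqrt_mult real_sqrt_abs)
    then have up: "n \<le> sqrt (2 / c0) * ampl lam" using n by simp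
    have "sqrt (\<sigma> - lam) \<le> sqrt (C2 * n\<^sup>2)" using 2 by (rule real_sqrt_le_mono)
    then have "ampl lam \<le> sqrt C2 * \<bar>n\<bar>" by (simp only: ampl_def real_sqrt_mult real_sqrt_abs)
    then have "ampl lam \<le> sqrt C2 * n" using n by simp
    then have "1 / sqrt C2 * ampl lam \<le> n" using C12 by (simp add: field_simps)
    then show "lam < \<sigma> \<and> 1 / sqrt C2 * ampl lam \<le> norm x \<and> norm x \<le> sqrt (2 / c0) * ampl lam"
      using lam up by (simp add: n_def)
  qed
qed

text \<open>Zeros with \<lambda> tending to \<sigma> would have a subsequence with convergent y in
  K, and the limit would be a zero of \<open>lim_map\<close>, as \<open>rmap\<close> converges along
  such sequences.\<close>

lemma no_zeros_near_compact:
  assumes K: "compact K" and nz: "\<And>y. y \<in> K \<Longrightarrow> lim_map k y \<noteq> 0"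
  obtains \<rho> where "\<rho> > 0" "\<And>l y. l \<in> {\<sigma> - \<rho><..<\<sigma>} \<Longrightarrow> y \<in> K \<Longrightarrow> rmap (l, y) \<noteq> 0"
proof (rule ccontr)
  assume "\<not> thesis"
  then have "\<forall>n. \<exists>l y. l \<in> {\<sigma> - 1 / real (Suc n)<..<\<sigma>} \<and> y \<in> K \<and> rmap (l, y) = 0"
    using that by (metis of_nat_0_less_iff zero_less_Suc zero_less_divide_1_iff)
  then obtain l y where ly: "\<And>n. l n \<in> {\<sigma> - 1 / real (Suc n)<..<\<sigma>}" "\<And>n. y n \<in> K" "\<And>n. rmap (l n, y n) = 0"
    by metis
  obtain y0 r where r: "y0 \<in> K" "strict_mono r" "(y \<circ> r) \<longlonglongrightarrow> y0"
    using K ly(2) unfolding compact_def by blast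
  have "l \<longlonglongrightarrow> \<sigma>"
  proof (rule tendsto_sandwich)
    show "\<forall>\<^sub>F n in sequentially. \<sigma> - 1 / real (Suc n) \<le> l n" "\<forall>\<^sub>F n in sequentially. l n \<le> \<sigma>"
      using ly(1) by (auto intro!: always_eventually less_imp_le)
    show "(\<lambda>n. \<sigma> - 1 / real (Suc n)) \<longlonglongrightarrow> \<sigma>"
      using tendsto_diff[OF tendsto_const LIMSEQ_Suc[OF lim_1_over_n], of \<sigma>] by simp
  qed simp
  then have l: "(l \<circ> r) \<longlonglongrightarrow> \<sigma>" by (rule LIMSEQ_subseq_LIMSEQ[OF _ r(2)])
  interpret B: blow_up k I \<N> \<O> \<psi> sequentially "l \<circ> r" "y \<circ> r" y0
    by unfold_locales (use l r(3) ly(1) in auto)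
  have "(\<lambda>n. rmap ((l \<circ> r) n, (y \<circ> r) n)) \<longlonglongrightarrow> lim_map k y0" by (rule B.lim_rmap)
  then have "lim_map k y0 = 0" using ly(3) by (simp add: LIMSEQ_const_iff)
  then show False using nz[OF r(1)] by simp
qed

end

context blow_up
begin

text \<open>Dividing by the amplitude and by \<kappa> does not move zeros, and turns the solution
  into cos + e sin plus an error tending to 0 in H^2. Once the error is below 1/3 in norm,
  \<open>h2_sup_bound\<close> puts it below 1 in C^1, which is within the tolerance of the zero
  count because 2k > 1.\<close>

lemma ev_card_zeros:
  assumes e: "e = 1 \<or> e = -1" and y0: "y0 = (a, e * a)" and a: "a \<noteq> 0"
  shows "\<forall>\<^sub>F c in F. card {t \<in> {0..<pi}. h2_fun (sol (l c, ampl (l c) *\<^sub>R Y c)) t = 0} = 2 * k"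
proof -
  define \<kappa> where "\<kappa> = a * sqrt (2 / pi)"
  have \<kappa>: "\<kappa> \<noteq> 0" using a by (simp add: \<kappa>_def)
  define f where "f t = cos (2 * real k * t) + e * sin (2 * real k * t)" for t
  define f' where "f' t = 2 * real k * (e * cos (2 * real k * t) - sin (2 * real k * t))" for t
  have f: "(f has_real_derivative f' t) (at t)" for t
    unfolding f_def[abs_def] f'_def by (auto intro!: derivative_eq_intros simp: algebra_simps)
  have LLf: "h2_fun (LL k y0) t = \<kappa> * f t" for t
    unfolding y0 h2_fun_LL by (simp add: phi_cos_def phi_sin_def \<kappa>_def f_def algebra_simps)
  define h where "h c = (1 / \<kappa>) *\<^sub>R (rsol (l c, Y c) - LL k y0)" for c
  have "(h \<longlongrightarrow> (1 / \<kappa>) *\<^sub>R (LL k y0 - LL k y0)) F"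
    unfolding h_def by (intro tendsto_intros lim_rsol)
  then have "\<forall>\<^sub>F c in F. dist (h c) ((1 / \<kappa>) *\<^sub>R (LL k y0 - LL k y0)) < 1/3"
    by (rule tendstoD) simp
  then show ?thesis using left
  proof eventually_elim
    case (elim c)
    have hc: "3 * norm (h c) < 1" using elim(1) by simp
    note s = ampl_pos[OF elim(2)]
    have "card {t \<in> {0..<pi}. f t + h2_fun (h c) t = 0} = 2 * k"
    proof (rule card_zeros_near_cos_sin[OF k1 e])
      fix t :: real assume t: "t \<in> {0..pi}"
      show "((\<lambda>t. f t + h2_fun (h c) t) has_real_derivative f' t + h2_D 1 (h c) t) (at t within {0..pi})"
        by (intro DERIV_add has_field_derivative_at_within[OF f] h2_fun_has_derivative t)
      show "\<bar>f t + h2_fun (h c) t - (cos (2 * real k * t) + e * sin (2 * real k * t))\<bar> < 1"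
        using h2_sup_bound(1)[OF t, of "h c"] hc by (simp add: f_def)
      have "1 < 2 * real k" using k1 by simp
      then show "\<bar>f' t + h2_D 1 (h c) t - 2 * real k * (e * cos (2 * real k * t) - sin (2 * real k * t))\<bar> < 2 * real k"
        using h2_sup_bound(2)[OF t, of "h c"] hc by (simp add: f'_def del: One_nat_def)
    qed
    moreover have "h2_fun (sol (l c, ampl (l c) *\<^sub>R Y c)) t = ampl (l c) * \<kappa> * (f t + h2_fun (h c) t)" for t
      unfolding sol_rescaled[OF elim(2)] h_def
      using \<kappa> by (simp add: h2_fun_simps LLf algebra_simps)
    ultimately show ?case using s \<kappa> by simp
  qed
qed

end

section \<open>Labelling and separation of the four branches\<close>

text \<open>The sign of the first coordinate. Together with \<open>branch_symmetry\<close>, which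
  selects the diagonal, it reproduces the numbering 1 to 4 of the theorem.\<close>

definition branch_sign :: "nat \<Rightarrow> real" where
  "branch_sign i = (if odd i then 1 else - 1)"

definition branch_symmetry :: "nat \<Rightarrow> real" where
  "branch_symmetry i = (if i \<le> 2 then 1 else - 1)"

definition branch_point :: "nat \<Rightarrow> nat \<Rightarrow> real \<times> real" where
  "branch_point k i = (branch_sign i * bif_radius k (branch_symmetry i),
     branch_sign i * branch_symmetry i * bif_radius k (branch_symmetry i))"

lemma branch_signs:
  "branch_sign i = 1 \<or> branch_sign i = - 1" "branch_symmetry i = 1 \<or> branch_symmetry i = - 1"
  by (auto simp: branch_sign_def branch_symmetry_def)

lemma atLeastAtMost_1_4: "{1..4::nat} = {1, 2, 3, 4}"
  by auto

lemma branch_index_unique: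
  assumes "i \<in> {1..4}" "j \<in> {1..4}" "branch_sign i = branch_sign j" "branch_symmetry i = branch_symmetry j"
  shows "i = j"
  using assms unfolding atLeastAtMost_1_4 by (auto simp: branch_sign_def branch_symmetry_def)

lemma branch_index_exists:
  assumes "t = 1 \<or> t = - 1" "e = 1 \<or> e = - 1"
  shows "\<exists>i\<in>{1..4}. branch_sign i = t \<and> branch_symmetry i = e"
  using assms unfolding atLeastAtMost_1_4 by (auto simp: branch_sign_def branch_symmetry_def)

text \<open>Both coordinates of a limit point have modulus equal to the radius, so a smaller
  displacement changes neither sign. The sign pattern thus recovers the index of the branch.\<close>

lemma near_branch_point_signs:
  assumes k: "odd k" and y: "y \<in> cball (branch_point k i) \<delta>"
    and \<delta>: "\<delta> < bif_radius k 1" "\<delta> < bif_radius k (- 1)"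
  shows "branch_sign i * fst y > 0" "branch_sign i * branch_symmetry i * snd y > 0"
proof -
  let ?r = "bif_radius k (branch_symmetry i)"
  have r: "\<delta> < ?r" using \<delta> branch_signs(2)[of i] by auto
  have "norm (y - branch_point k i) \<le> \<delta>" using y by (simp add: dist_norm norm_minus_commute)
  moreover have "norm (fst (y - branch_point k i)) \<le> norm (y - branch_point k i)"
    "norm (snd (y - branch_point k i)) \<le> norm (y - branch_point k i)"
    by (metis norm_fst_le prod.collapse, metis norm_snd_le prod.collapse)
  ultimately have "\<bar>fst y - fst (branch_point k i)\<bar> \<le> \<delta>" "\<bar>snd y - snd (branch_point k i)\<bar> \<le> \<delta>"
    by simp_all
  then have "\<bar>fst y - branch_sign i * ?r\<bar> < ?r" "\<bar>snd y - branch_sign i * branch_symmetry i * ?r\<bar> < ?r"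
    using r by (auto simp: branch_point_def)
  then show "branch_sign i * fst y > 0" "branch_sign i * branch_symmetry i * snd y > 0"
    using branch_signs[of i] by auto
qed

lemma C1_on_linear_image:
  fixes Y :: "real \<Rightarrow> 'a::real_normed_vector" and f :: "'a \<Rightarrow> real"
  assumes f: "bounded_linear f" and sub: "J \<subseteq> J'"
    and Y: "\<And>l. l \<in> J' \<Longrightarrow> (Y has_vector_derivative Y' l) (at l within J')"
    and Y': "continuous_on J' Y'"
  shows "C1_on J (\<lambda>l. f (Y l))"
  unfolding C1_on_def
proof (intro exI[of _ "\<lambda>l. f (Y' l)"] conjI ballI)
  fix l assume l: "l \<in> J"
  have "(Y has_vector_derivative Y' l) (at l within J)"
    using Y[of l] l sub has_vector_derivative_within_subset by blast
  then show "((\<lambda>l. f (Y l)) has_real_derivative f (Y' l)) (at l within J)"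
    unfolding has_real_derivative_iff_has_vector_derivative
    by (rule bounded_linear.has_vector_derivative[OF f])
next
  show "continuous_on J (\<lambda>l. f (Y' l))"
    by (intro bounded_linear.continuous_on[OF f] continuous_on_subset[OF Y' sub])
qed

context lyapunov_schmidt
begin

lemma bifurcation:
  "\<exists>(\<epsilon>::real) (U :: (real \<times> h2) set) (Y :: nat \<Rightarrow> real \<Rightarrow> real \<times> real) (u :: nat \<Rightarrow> real \<Rightarrow> h2).
    \<epsilon> > 0 \<and> open U \<and> (\<sigma>, 0) \<in> U \<and>
    (\<forall>i\<in>{1..4}. C1_on {\<sigma> - \<epsilon> <.. \<sigma>} (\<lambda>l. fst (Y i l)) \<and> C1_on {\<sigma> - \<epsilon> <.. \<sigma>} (\<lambda>l. snd (Y i l))) \<and>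
    (\<forall>i\<in>{1..4}. Y i \<sigma> = branch_point k i) \<and>
    (\<forall>i\<in>{1..4}. \<forall>lam\<in>{\<sigma> - \<epsilon> <..< \<sigma>}.
       (lam, ampl lam * fst (Y i lam), ampl lam * snd (Y i lam)) \<in> reduced_zeros k I \<N> \<psi> \<and>
       (lam, u i lam) = Psi k \<psi> (lam, ampl lam * fst (Y i lam), ampl lam * snd (Y i lam))) \<and>
    (\<forall>i\<in>{1..4}. continuous_on {\<sigma> - \<epsilon> <..< \<sigma>} (u i) \<and> (u i \<longlongrightarrow> 0) (at_left \<sigma>)) \<and>
    (\<forall>lam\<in>{\<sigma> - \<epsilon> <..< \<sigma>}.
       inj_on (\<lambda>i. u i lam) {1..4} \<and>
       {v. (lam, v) \<in> U \<and> is_solution lam v \<and> v \<noteq> 0} = (\<lambda>i. u i lam) ` {1..4} \<and>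
       (\<forall>i\<in>{1..4}. card {t \<in> {0..<pi}. h2_fun (u i lam) t = 0} = 2 * k)) \<and>
    (\<forall>lam\<in>{\<sigma> <..< \<sigma> + \<epsilon>}. {v. (lam, v) \<in> U \<and> is_solution lam v} = {0})"
proof -
  define \<delta>0 where "\<delta>0 = min (bif_radius k 1) (bif_radius k (- 1)) / 2"
  have radii: "bif_radius k 1 > 0" "bif_radius k (- 1) > 0"
    using bif_params(3)[OF odd_k] by simp_all
  have \<delta>0: "\<delta>0 > 0" "\<delta>0 < bif_radius k 1" "\<delta>0 < bif_radius k (- 1)"
    using radii by (auto simp: \<delta>0_def min_def)
  have pt: "lim_map k (branch_point k i) = 0"
    "- d + 3 *\<^sub>R cubic k (LL k (branch_point k i)) (LL k (branch_point k i)) (LL k d) = 0 \<Longrightarrow> d = 0" for i d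
    unfolding branch_point_def using lim_map_bif_point[OF odd_k branch_signs(2) branch_signs(1)] by blast+
  have "\<forall>i. \<exists>\<rho> \<delta> Y Y'. branch (branch_point k i) \<delta>0 \<rho> \<delta> Y Y'"
    by (intro allI branch_exists pt(1) \<delta>0(1)) (rule pt(2))
  then obtain \<rho> \<delta> Y Y' where br: "\<And>i. branch (branch_point k i) \<delta>0 (\<rho> i) (\<delta> i) (Y i) (Y' i)"
    by metis
  have \<rho>: "0 < \<rho> i" and \<delta>: "0 < \<delta> i" "\<delta> i \<le> \<delta>0"
    and Y_ball: "\<And>l. l \<in> {\<sigma> - \<rho> i <..< \<sigma>} \<Longrightarrow> Y i l \<in> ball (branch_point k i) (\<delta> i)"
    and Y_rdom: "\<And>l y. l \<in> {\<sigma> - \<rho> i <..< \<sigma>} \<Longrightarrow> y \<in> cball (branch_point k i) (\<delta> i) \<Longrightarrow> (l, y) \<in> rdom"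
    and Y_iff: "\<And>l y. l \<in> {\<sigma> - \<rho> i <..< \<sigma>} \<Longrightarrow> y \<in> cball (branch_point k i) (\<delta> i) \<Longrightarrow>
      rmap (l, y) = 0 \<longleftrightarrow> y = Y i l"
    and Y_\<sigma>: "Y i \<sigma> = branch_point k i"
    and Y_der: "\<And>l. l \<in> {\<sigma> - \<rho> i <.. \<sigma>} \<Longrightarrow> (Y i has_vector_derivative Y' i l) (at l within {\<sigma> - \<rho> i <.. \<sigma>})"
    and Y'_cont: "continuous_on {\<sigma> - \<rho> i <.. \<sigma>} (Y' i)" for i
    using br[of i] unfolding branch_def by blast+
  have signs: "branch_sign i * fst y > 0" "branch_sign i * branch_symmetry i * snd y > 0"
    if "y \<in> cball (branch_point k i) (\<delta> i)" for i y
    using near_branch_point_signs[OF odd_k, of y i \<delta>0] that \<delta>0(2,3) \<delta>(2)[of i] by auto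
  have Y_cont: "continuous_on {\<sigma> - \<rho> i <.. \<sigma>} (Y i)" for i
    unfolding continuous_on_eq_continuous_within
    by (intro ballI has_vector_derivative_continuous[OF Y_der])
  have Y_lim: "(Y i \<longlongrightarrow> branch_point k i) (at_left \<sigma>)" for i
  proof -
    have "(Y i \<longlongrightarrow> Y i \<sigma>) (at \<sigma> within {\<sigma> - \<rho> i <.. \<sigma>})"
      using Y_cont[of i] \<rho>[of i] by (simp add: continuous_on_def)
    moreover have "at \<sigma> within {\<sigma> - \<rho> i <.. \<sigma>} = at_left \<sigma>"
      using \<rho>[of i] by (intro at_within_nhd[of _ "{\<sigma> - \<rho> i <..}"]) auto
    ultimately show ?thesis by (simp add: Y_\<sigma>)
  qed
  obtain m R \<rho>1 where m: "m > 0" and \<rho>1: "\<rho>1 > 0"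
    and small_S: "\<And>lam x. \<bar>lam - \<sigma>\<bar> < \<rho>1 \<Longrightarrow> norm x < \<rho>1 \<Longrightarrow> (lam, x) \<in> S"
    and sol_0: "\<And>lam. \<bar>lam - \<sigma>\<bar> < \<rho>1 \<Longrightarrow> sol (lam, 0) = 0"
    and small: "\<And>lam x. \<bar>lam - \<sigma>\<bar> < \<rho>1 \<Longrightarrow> norm x < \<rho>1 \<Longrightarrow> x \<noteq> 0 \<Longrightarrow> red (lam, x) = 0 \<Longrightarrow>
       lam < \<sigma> \<and> m * ampl lam \<le> norm x \<and> norm x \<le> R * ampl lam"
    by (rule small_solutions) blast
  \<comment> \<open>By \<open>small_solutions\<close> every small nonzero solution rescales into the
    closed annulus with radii m and R. Removing open sets keeps K compact, and all nonzero zeros of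
    \<open>lim_map\<close> lie in the removed balls.\<close>
  define K where "K = (cball 0 R - ball 0 m) - (\<Union>i\<in>{1..4}. ball (branch_point k i) (\<delta> i))"
  have "compact K"
    unfolding K_def by (intro compact_diff compact_cball open_ball open_UN ballI)
  moreover have "lim_map k y \<noteq> 0" if "y \<in> K" for y
  proof
    assume z: "lim_map k y = 0"
    have "y \<noteq> 0" using that m by (auto simp: K_def)
    then obtain e t where et: "e \<in> {1, -1}" "t \<in> {1, -1}" "y = (t * bif_radius k e, t * e * bif_radius k e)"
      using lim_map_zero_cases[OF odd_k z] by blast
    then obtain i where i: "i \<in> {1..4}" "branch_sign i = t" "branch_symmetry i = e"
      using branch_index_exists[of t e] by auto
    then have "y = branch_point k i" using et by (simp add: branch_point_def)
    then have "y \<in> ball (branch_point k i) (\<delta> i)" using \<delta>(1)[of i] by simp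
    then show False using that i(1) by (auto simp: K_def)
  qed
  ultimately obtain \<rho>2 where \<rho>2: "\<rho>2 > 0"
    "\<And>l y. l \<in> {\<sigma> - \<rho>2<..<\<sigma>} \<Longrightarrow> y \<in> K \<Longrightarrow> rmap (l, y) \<noteq> 0"
    using no_zeros_near_compact by blast
  \<comment> \<open>Restricting \<lambda> and the kernel coordinates suffices, since inside \<O>
    they determine a solution.\<close>
  define U where "U = {p \<in> \<O>. \<bar>fst p - \<sigma>\<bar> < \<rho>1 \<and> norm (coords k (snd p)) < \<rho>1}"
  define u where "u i lam = sol (lam, ampl lam *\<^sub>R Y i lam)" for i lam
  have "open U"
  proof -
    have "open {p. \<bar>fst p - \<sigma>\<bar> < \<rho>1 \<and> norm (coords k (snd p)) < \<rho>1}"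
      by (intro open_Collect_conj open_Collect_less continuous_intros
          bounded_linear.continuous_on[OF bounded_linear_coords[OF k1]])
    then have "open (\<O> \<inter> {p. \<bar>fst p - \<sigma>\<bar> < \<rho>1 \<and> norm (coords k (snd p)) < \<rho>1})"
      by (intro open_Int LS_D(5))
    then show ?thesis by (simp add: U_def Int_def)
  qed
  have coords_0: "coords k 0 = 0" by (rule linear_0[OF linear_coords])
  have "(\<sigma>, 0) \<in> U" using LS_D(6) \<rho>1 by (simp add: U_def coords_0)
  have ev: "\<forall>\<^sub>F l in at_left \<sigma>. \<forall>i\<in>{1..4}. l \<in> {\<sigma> - \<rho> i <..< \<sigma>} \<and> norm (ampl l *\<^sub>R Y i l) < \<rho>1 \<and>
      card {t \<in> {0..<pi}. h2_fun (u i l) t = 0} = 2 * k"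
  proof (intro eventually_ball_finite ballI)
    fix i :: nat
    interpret B: blow_up k I \<N> \<O> \<psi> "at_left \<sigma>" "\<lambda>l. l" "Y i" "branch_point k i"
      by (rule blow_up_at_left[OF Y_lim])
    have "\<forall>\<^sub>F l in at_left \<sigma>. l \<in> {\<sigma> - \<rho> i <..< \<sigma>}"
      using \<rho>[of i] by (intro eventually_at_leftI[of "\<sigma> - \<rho> i"]) auto
    moreover have "\<forall>\<^sub>F l in at_left \<sigma>. card {t \<in> {0..<pi}. h2_fun (u i l) t = 0} = 2 * k"
      unfolding u_def
    proof (rule B.ev_card_zeros[OF branch_signs(2)])
      show "branch_point k i = (branch_sign i * bif_radius k (branch_symmetry i),
          branch_symmetry i * (branch_sign i * bif_radius k (branch_symmetry i)))"
        by (simp add: branch_point_def)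
      show "branch_sign i * bif_radius k (branch_symmetry i) \<noteq> 0"
        using branch_signs[of i] radii by auto
    qed
    ultimately show "\<forall>\<^sub>F l in at_left \<sigma>. l \<in> {\<sigma> - \<rho> i <..< \<sigma>} \<and> norm (ampl l *\<^sub>R Y i l) < \<rho>1 \<and>
      card {t \<in> {0..<pi}. h2_fun (u i l) t = 0} = 2 * k"
      using B.near_ampl_Y[OF \<rho>1] B.left
      by eventually_elim (use ampl_pos in \<open>simp add: abs_of_pos\<close>)
  qed simp
  then obtain b where b: "b < \<sigma>" and bD: "\<And>l i. b < l \<Longrightarrow> l < \<sigma> \<Longrightarrow> i \<in> {1..4} \<Longrightarrow>
      l \<in> {\<sigma> - \<rho> i <..< \<sigma>} \<and> norm (ampl l *\<^sub>R Y i l) < \<rho>1 \<and>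
      card {t \<in> {0..<pi}. h2_fun (u i l) t = 0} = 2 * k"
    unfolding eventually_at_left_field by blast
  \<comment> \<open>The three numbers ensure, in turn, that all branches exist with the right zero
    count, that small solutions lie in the annulus, and that none rescales into K.\<close>
  define \<epsilon> where "\<epsilon> = Min {\<sigma> - b, \<rho>1, \<rho>2}"
  have \<epsilon>: "\<epsilon> > 0" "\<epsilon> \<le> \<sigma> - b" "\<epsilon> \<le> \<rho>1" "\<epsilon> \<le> \<rho>2"
    using b \<rho>1 \<rho>2(1) by (auto simp: \<epsilon>_def)
  have left: "l < \<sigma>" "l \<in> {\<sigma> - \<rho> i <..< \<sigma>}" "norm (ampl l *\<^sub>R Y i l) < \<rho>1" "\<bar>l - \<sigma>\<bar> < \<rho>1" "l \<in> {\<sigma> - \<rho>2<..<\<sigma>}"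
    "card {t \<in> {0..<pi}. h2_fun (u i l) t = 0} = 2 * k"
    if "l \<in> {\<sigma> - \<epsilon> <..< \<sigma>}" "i \<in> {1..4}" for l i
    using that bD[of l i] \<epsilon> by auto
  have in_S: "(l, ampl l *\<^sub>R Y i l) \<in> S" and red_0: "red (l, ampl l *\<^sub>R Y i l) = 0"
    and Y_cball: "Y i l \<in> cball (branch_point k i) (\<delta> i)" and Y_nz: "ampl l *\<^sub>R Y i l \<noteq> 0"
    if "l \<in> {\<sigma> - \<epsilon> <..< \<sigma>}" "i \<in> {1..4}" for l i
  proof -
    note l = left[OF that]
    show *: "Y i l \<in> cball (branch_point k i) (\<delta> i)" using Y_ball[OF l(2)] by auto
    show "(l, ampl l *\<^sub>R Y i l) \<in> S" using Y_rdom[OF l(2) *] by (simp add: rdom_def)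
    show "red (l, ampl l *\<^sub>R Y i l) = 0" using Y_iff[OF l(2) *] by (simp add: red_zero_iff_rmap[OF l(1)])
    have "Y i l \<noteq> 0" using signs(1)[OF *] by auto
    then show "ampl l *\<^sub>R Y i l \<noteq> 0" using ampl_pos[OF l(1)] by simp
  qed
  have coords_u: "coords k (u i l) = ampl l *\<^sub>R Y i l" if "l \<in> {\<sigma> - \<epsilon> <..< \<sigma>}" "i \<in> {1..4}" for l i
    using coords_sol[OF in_S[OF that]] by (simp add: u_def)
  have u_sol: "is_solution l (u i l)" "(l, u i l) \<in> U" "u i l \<noteq> 0"
    if li: "l \<in> {\<sigma> - \<epsilon> <..< \<sigma>}" "i \<in> {1..4}" for l i
  proof -
    show "is_solution l (u i l)"
      using is_solution_sol_iff[OF in_S[OF li]] red_0[OF li] by (simp add: u_def)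
    show "(l, u i l) \<in> U"
      using sol_equation(1)[OF in_S[OF li]] left(3,4)[OF li] coords_u[OF li] by (simp add: U_def u_def)
    show "u i l \<noteq> 0" using coords_u[OF li] Y_nz[OF li] coords_0 by auto
  qed
  \<comment> \<open>Exhaustion: a nontrivial solution rescales into the annulus, misses K, hence
    lies in one of the balls, where uniqueness makes it the branch.\<close>
  have sol_cases: "lam < \<sigma> \<and> (\<exists>i\<in>{1..4}. v = u i lam)"
    if U: "(lam, v) \<in> U" and sol: "is_solution lam v" and nz: "v \<noteq> 0" and near: "\<bar>lam - \<sigma>\<bar> < \<epsilon>" for lam v
  proof -
    let ?x = "coords k v"
    have x: "\<bar>lam - \<sigma>\<bar> < \<rho>1" "norm ?x < \<rho>1" "(lam, v) \<in> \<O>" using U by (auto simp: U_def)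
    note v = solution_in_O[OF x(3) sol]
    have "?x \<noteq> 0" using nz v(2) sol_0[OF x(1)] by auto
    then have *: "lam < \<sigma>" "m * ampl lam \<le> norm ?x" "norm ?x \<le> R * ampl lam"
      using small[OF x(1,2) _ v(3)] by auto
    have lam: "lam \<in> {\<sigma> - \<epsilon> <..< \<sigma>}" using near *(1) by auto
    note s = ampl_pos[OF *(1)]
    define y where "y = (1 / ampl lam) *\<^sub>R ?x"
    have xy: "?x = ampl lam *\<^sub>R y" using s by (simp add: y_def)
    have ny: "m \<le> norm y" "norm y \<le> R" using *(2,3) s by (simp_all add: y_def field_simps)
    have rmap: "rmap (lam, y) = 0" using v(3) red_zero_iff_rmap[OF *(1)] by (simp add: xy)
    then have "y \<notin> K" using \<rho>2(2)[OF left(5)[OF lam, of 1], of y] by auto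
    then obtain i where i: "i \<in> {1..4}" "y \<in> ball (branch_point k i) (\<delta> i)"
      using ny by (auto simp: K_def)
    then have "y = Y i lam" using Y_iff[OF left(2)[OF lam i(1)], of y] rmap by auto
    then have "v = u i lam" using v(2) xy by (simp add: u_def)
    then show ?thesis using *(1) i(1) by blast
  qed
  \<comment> \<open>Equal solutions have equal coordinates, hence equal rescaled points, and the
    signs of such a point fix the index.\<close>
  have inj: "inj_on (\<lambda>i. u i lam) {1..4}" if lam: "lam \<in> {\<sigma> - \<epsilon> <..< \<sigma>}" for lam
  proof (rule inj_onI)
    fix i j assume ij: "i \<in> {1..4::nat}" "j \<in> {1..4::nat}" "u i lam = u j lam"
    then have "ampl lam *\<^sub>R Y i lam = ampl lam *\<^sub>R Y j lam"
      using coords_u[OF lam] by metis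
    then have Yij: "Y i lam = Y j lam" using ampl_pos[OF left(1)[OF lam ij(1)]] by simp
    have "branch_sign i = branch_sign j \<and> branch_symmetry i = branch_symmetry j"
      using signs[OF Y_cball[OF lam ij(1)]] signs[OF Y_cball[OF lam ij(2)]]
        branch_signs[of i] branch_signs[of j] unfolding Yij by auto
    then show "i = j" using branch_index_unique ij by blast
  qed
  have u_cont: "continuous_on {\<sigma> - \<epsilon> <..< \<sigma>} (u i)" if i: "i \<in> {1..4}" for i
    unfolding u_def[abs_def]
  proof (rule continuous_on_compose2[OF continuous_on_sol])
    have "{\<sigma> - \<epsilon> <..< \<sigma>} \<subseteq> {\<sigma> - \<rho> i <.. \<sigma>}" using left(2)[OF _ i] by force
    from continuous_on_subset[OF Y_cont this]
    show "continuous_on {\<sigma> - \<epsilon> <..< \<sigma>} (\<lambda>l. (l, ampl l *\<^sub>R Y i l))"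
      unfolding ampl_def by (intro continuous_intros)
  qed (use in_S i in auto)
  have u_lim: "(u i \<longlongrightarrow> 0) (at_left \<sigma>)" for i
  proof -
    interpret B: blow_up k I \<N> \<O> \<psi> "at_left \<sigma>" "\<lambda>l. l" "Y i" "branch_point k i"
      by (rule blow_up_at_left[OF Y_lim])
    have "((\<lambda>l. sol (l, ampl l *\<^sub>R Y i l)) \<longlongrightarrow> sol (\<sigma>, 0)) (at_left \<sigma>)"
      by (rule isCont_tendsto_compose[OF isCont_on_S[OF continuous_on_sol base_in_S] B.lim_rescaled])
    moreover have "sol (\<sigma>, 0) = 0" using sol_0 \<rho>1 by simp
    ultimately show ?thesis by (simp add: u_def[abs_def])
  qed
  have C1: "C1_on {\<sigma> - \<epsilon> <.. \<sigma>} (\<lambda>l. fst (Y i l)) \<and> C1_on {\<sigma> - \<epsilon> <.. \<sigma>} (\<lambda>l. snd (Y i l))"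
    if i: "i \<in> {1..4}" for i
  proof -
    have sub: "{\<sigma> - \<epsilon> <.. \<sigma>} \<subseteq> {\<sigma> - \<rho> i <.. \<sigma>}"
    proof
      fix l assume "l \<in> {\<sigma> - \<epsilon> <.. \<sigma>}"
      then show "l \<in> {\<sigma> - \<rho> i <.. \<sigma>}" using left(2)[OF _ i, of l] \<rho>[of i] by (cases "l = \<sigma>") auto
    qed
    show ?thesis
      using C1_on_linear_image[OF bounded_linear_fst sub Y_der Y'_cont]
        C1_on_linear_image[OF bounded_linear_snd sub Y_der Y'_cont] by simp
  qed
  have scale_pair: "(lam, ampl lam * fst (Y i lam), ampl lam * snd (Y i lam)) = (lam, ampl lam *\<^sub>R Y i lam)" for i lam
    by (simp add: prod_eq_iff)
  show ?thesis
  proof (rule exI[of _ \<epsilon>], rule exI[of _ U], rule exI[of _ Y], rule exI[of _ u], intro conjI ballI)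
    fix lam assume lam: "lam \<in> {\<sigma> - \<epsilon> <..< \<sigma>}"
    show "{v. (lam, v) \<in> U \<and> is_solution lam v \<and> v \<noteq> 0} = (\<lambda>i. u i lam) ` {1..4}"
      using sol_cases[of lam] u_sol[OF lam] lam by (auto simp del: atLeastAtMost_iff)
  next
    fix lam assume lam: "lam \<in> {\<sigma> <..< \<sigma> + \<epsilon>}"
    have near: "\<bar>lam - \<sigma>\<bar> < \<epsilon>" "\<bar>lam - \<sigma>\<bar> < \<rho>1" using lam \<epsilon>(3) by auto
    have S0: "(lam, 0) \<in> S" using small_S[OF near(2)] \<rho>1 by simp
    \<comment> \<open>Scaling by 0 in the first slot shows that the cubic term vanishes at the
      trivial solution.\<close>
    have "red (lam, 0) = 0"
      using cubic_scale(1)[of k 0 0 0 0] sol_0[OF near(2)] by (simp add: red_def)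
    then have "is_solution lam 0" "(lam, 0) \<in> U"
      using is_solution_sol_iff[OF S0] sol_equation(1)[OF S0] sol_0[OF near(2)] near(2) \<rho>1
      by (simp_all add: U_def coords_0)
    then show "{v. (lam, v) \<in> U \<and> is_solution lam v} = {0}"
      using sol_cases[of lam, OF _ _ _ near(1)] lam by fastforce
  next
    fix i lam assume i: "i \<in> {1..4::nat}" and lam: "lam \<in> {\<sigma> - \<epsilon> <..< \<sigma>}"
    show "(lam, ampl lam * fst (Y i lam), ampl lam * snd (Y i lam)) \<in> reduced_zeros k I \<N> \<psi>"
      unfolding scale_pair reduced_zeros_eq using in_S[OF lam i] red_0[OF lam i] by simp
    show "(lam, u i lam) = Psi k \<psi> (lam, ampl lam * fst (Y i lam), ampl lam * snd (Y i lam))"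
      unfolding scale_pair Psi_eq by (simp add: u_def)
  qed (use \<epsilon>(1) \<open>open U\<close> \<open>(\<sigma>, 0) \<in> U\<close> C1 Y_\<sigma> u_cont u_lim inj left(6) in auto)
qed

end

theorem theorem3p18:
  fixes k :: nat and I :: "real set" and \<N> :: "h2 set" and \<O> :: "(real \<times> h2) set"
    and \<psi> :: "real \<times> h2 \<Rightarrow> h2"
  assumes "odd k"
    and "LS_data k I \<N> \<O> \<psi>"
  shows "\<exists>(\<epsilon>::real) (U :: (real \<times> h2) set) (z :: nat \<Rightarrow> real \<Rightarrow> real) (w :: nat \<Rightarrow> real \<Rightarrow> real)
           (u :: nat \<Rightarrow> real \<Rightarrow> h2).
    \<epsilon> > 0 \<and> open U \<and> (4 * (real k)\<^sup>2, 0) \<in> U \<and>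
    (\<forall>i\<in>{1..4}. C1_on {4 * (real k)\<^sup>2 - \<epsilon> <.. 4 * (real k)\<^sup>2} (z i) \<and>
                C1_on {4 * (real k)\<^sup>2 - \<epsilon> <.. 4 * (real k)\<^sup>2} (w i)) \<and>
    (z 1 (4 * (real k)\<^sup>2), w 1 (4 * (real k)\<^sup>2)) =
      (2 * sqrt (real k) * pi / sqrt (3 * real k * pi + 8), 2 * sqrt (real k) * pi / sqrt (3 * real k * pi + 8)) \<and>
    (z 2 (4 * (real k)\<^sup>2), w 2 (4 * (real k)\<^sup>2)) =
      (- 2 * sqrt (real k) * pi / sqrt (3 * real k * pi + 8), - 2 * sqrt (real k) * pi / sqrt (3 * real k * pi + 8)) \<and>
    (z 3 (4 * (real k)\<^sup>2), w 3 (4 * (real k)\<^sup>2)) =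
      (2 * sqrt (real k) * pi / sqrt (3 * real k * pi - 8), - 2 * sqrt (real k) * pi / sqrt (3 * real k * pi - 8)) \<and>
    (z 4 (4 * (real k)\<^sup>2), w 4 (4 * (real k)\<^sup>2)) =
      (- 2 * sqrt (real k) * pi / sqrt (3 * real k * pi - 8), 2 * sqrt (real k) * pi / sqrt (3 * real k * pi - 8)) \<and>
    (\<forall>i\<in>{1..4}. \<forall>lam\<in>{4 * (real k)\<^sup>2 - \<epsilon> <..< 4 * (real k)\<^sup>2}.
       (lam, sqrt (4 * (real k)\<^sup>2 - lam) * z i lam, sqrt (4 * (real k)\<^sup>2 - lam) * w i lam)
         \<in> reduced_zeros k I \<N> \<psi> \<and>
       (lam, u i lam) =
         Psi k \<psi> (lam, sqrt (4 * (real k)\<^sup>2 - lam) * z i lam, sqrt (4 * (real k)\<^sup>2 - lam) * w i lam)) \<and>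
    (\<forall>i\<in>{1..4}. continuous_on {4 * (real k)\<^sup>2 - \<epsilon> <..< 4 * (real k)\<^sup>2} (u i) \<and>
                (u i \<longlongrightarrow> 0) (at_left (4 * (real k)\<^sup>2))) \<and>
    (\<forall>lam\<in>{4 * (real k)\<^sup>2 - \<epsilon> <..< 4 * (real k)\<^sup>2}.
       inj_on (\<lambda>i. u i lam) {1..4} \<and>
       {v. (lam, v) \<in> U \<and> is_solution lam v \<and> v \<noteq> 0} = (\<lambda>i. u i lam) ` {1..4} \<and>
       (\<forall>i\<in>{1..4}. card {t \<in> {0..<pi}. h2_fun (u i lam) t = 0} = 2 * k)) \<and>
    (\<forall>lam\<in>{4 * (real k)\<^sup>2 <..< 4 * (real k)\<^sup>2 + \<epsilon>}.
       {v. (lam, v) \<in> U \<and> is_solution lam v} = {0})"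
proof -
  interpret lyapunov_schmidt k I \<N> \<O> \<psi>
    using assms by unfold_locales
  have \<sigma>: "4 * (real k)\<^sup>2 = sigma k" by (simp add: sigma_def)
  have vals:
    "branch_point k 1 = (2 * sqrt (real k) * pi / sqrt (3 * real k * pi + 8), 2 * sqrt (real k) * pi / sqrt (3 * real k * pi + 8))"
    "branch_point k 2 = (- 2 * sqrt (real k) * pi / sqrt (3 * real k * pi + 8), - 2 * sqrt (real k) * pi / sqrt (3 * real k * pi + 8))"
    "branch_point k 3 = (2 * sqrt (real k) * pi / sqrt (3 * real k * pi - 8), - 2 * sqrt (real k) * pi / sqrt (3 * real k * pi - 8))"
    "branch_point k 4 = (- 2 * sqrt (real k) * pi / sqrt (3 * real k * pi - 8), 2 * sqrt (real k) * pi / sqrt (3 * real k * pi - 8))"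
    by (simp_all add: branch_point_def branch_sign_def branch_symmetry_def bif_radius_def)
  show ?thesis
    unfolding \<sigma>
    apply (insert bifurcation, elim exE)
    subgoal premises B for \<epsilon> U Y u
      by (rule exI[of _ \<epsilon>], rule exI[of _ U], rule exI[of _ "\<lambda>i l. fst (Y i l)"],
          rule exI[of _ "\<lambda>i l. snd (Y i l)"], rule exI[of _ u], intro conjI)
        (use B vals in \<open>simp_all add: ampl_def\<close>)
    done
qed

end
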